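(* Let $t>0$, let $d\ge1$ be an integer, $m\in\{0,1\}$, $n\ge1$ an integer, $v_0=\frac n2$, $v_1=n+1$, and suppose $v_m>\frac d2-1$. Then, given $N(t)=n$, the process $X_m$ stopped at the Bessel random time $R^d(t)$ has the conditional distribution $$P\left\{X_m(R^d(t))\in dx\,|\,N(t)=n\right\}=\frac{dx}{B\left(\frac d2,v_m-\frac d2+1\right)}\int_0^1w^{\frac d2-1}(1-w)^{v_m-\frac d2}\,\frac{e^{-\frac{x^2}{2c^2tw}}}{\sqrt{2\pi tw}\,c}\,dw,\qquad x\in\mathbb{R}.$$
   Context: Fix $c>0$, $\lambda>0$. For $m\in\{0,1\}$ let $X_m(s)=c\sum_{j=1}^{N(s)+1}(s_j-s_{j-1})\cos\theta_j$, where $N$ is a homogeneous Poisson process of rate $\lambda$ with event times $s_1<s_2<\cdots$, $s_0=0$, $s_{N(s)+1}=s$, and the $\theta_j$ are i.i.d. (independent of $N$) with density $\frac{\Gamma(m+1)}{\sqrt\pi\,\Gamma(m+\frac12)}\sin^{2m}\theta$ on $(0,\pi)$. For $n\ge1$ let $p_n^m(x,s)$ be the density of $X_m(s)$ given $N(s)=n$; explicitly $p_n^m(x,s)=\frac{\Gamma(v_m)\Gamma(v_m+1)}{2\pi\Gamma(2v_m)}\left(\frac{2}{cs}\right)^{2v_m}(c^2s^2-x^2)^{v_m-\frac12}$ for $|x|<cs$ and $0$ otherwise. $R^d(t)=\sqrt{\sum_{i=1}^dB_i^2(t)}$ with $B_i$ independent standard Brownian motions is the Bessel process started at zero, independent of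 $X_m$ and $N$; its density is $f^d(r)=\frac{1}{\Gamma(d/2)}\frac{r^{d-1}}{2^{d/2-1}t^{d/2}}e^{-r^2/(2t)}$, $r>0$. For an independent positive random time $T$, the conditional law $P\{X_m(T)\in dx\,|\,N(t)=n\}$ means the law of $X_m$ at time $T$ when the number of Poisson events up to that time is fixed to be $n$, i.e. $P\{X_m(T)\in dx\,|\,N(t)=n\}=dx\int_0^\infty p_n^m(x,s)\,P\{T\in ds\}$. $B(a,b)=\Gamma(a)\Gamma(b)/\Gamma(a+b)$ is the Beta function. Equalities of laws are equalities of Lebesgue densities (a.e. $x$). *)

theory Defs
  imports "HOL-Probability.Probability"
begin

text \<open>The sigma-algebra (on the sample space) generated by the process
  \<open>(Z i)\<close>, \<open>i \<in> I\<close>, with state space \<open>E\<close>.\<close>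

definition process_events ::
    "'a measure \<Rightarrow> 'i set \<Rightarrow> ('i \<Rightarrow> 'a \<Rightarrow> 'b) \<Rightarrow> 'b measure \<Rightarrow> 'a set set" where
  "process_events M I Z E =
     sets (vimage_algebra (space M) (\<lambda>\<omega>. \<lambda>i\<in>I. Z i \<omega>) (Pi\<^sub>M I (\<lambda>_. E)))"

text \<open>A homogeneous Poisson process is given by its event times \<open>S 1 < S 2 < \<dots>\<close>, with the
  convention \<open>S 0 = 0\<close>: the waiting times between consecutive events are
  i.i.d. exponential with parameter \<open>l\<close>. The counting process is recovered by
  \<open>event_count\<close>; the set counted there is almost surely finite.\<close>

definition poisson_event_times :: "'a measure \<Rightarrow> real \<Rightarrow> (nat \<Rightarrow> 'a \<Rightarrow> real) \<Rightarrow> bool" where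
  "poisson_event_times M l S \<longleftrightarrow>
     (\<forall>\<omega>\<in>space M. S 0 \<omega> = 0) \<and>
     prob_space.indep_vars M (\<lambda>_. borel) (\<lambda>k \<omega>. S (Suc k) \<omega> - S k \<omega>) UNIV \<and>
     (\<forall>k. distributed M lborel (\<lambda>\<omega>. S (Suc k) \<omega> - S k \<omega>)
            (\<lambda>x. ennreal (exponential_density l x)))"

definition event_count :: "(nat \<Rightarrow> 'a \<Rightarrow> real) \<Rightarrow> real \<Rightarrow> 'a \<Rightarrow> nat" where
  "event_count S s \<omega> = card {k. 1 \<le> k \<and> S k \<omega> \<le> s}"

definition angle_density :: "nat \<Rightarrow> real \<Rightarrow> real" where
  "angle_density m x =
     (if 0 < x \<and> x < pi
      then Gamma (real m + 1) / (sqrt pi * Gamma (real m + 1/2)) * sin x ^ (2 * m) else 0)"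

text \<open>The family of angles starts at index 1.\<close>

definition iid_angles :: "'a measure \<Rightarrow> nat \<Rightarrow> (nat \<Rightarrow> 'a \<Rightarrow> real) \<Rightarrow> bool" where
  "iid_angles M m \<theta> \<longleftrightarrow>
     prob_space.indep_vars M (\<lambda>_. borel) \<theta> {1..} \<and>
     (\<forall>j\<ge>1. distributed M lborel (\<theta> j) (\<lambda>x. ennreal (angle_density m x)))"

text \<open>The process \<open>X\<^sub>m\<close>. The last of the \<open>N(s) + 1\<close> displacements is cut off at the
  current time \<open>s\<close>, i.e. the \<open>(N(s) + 1)\<close>-st time is \<open>s\<close> and not an event time.\<close>

definition flight :: "real \<Rightarrow> (nat \<Rightarrow> 'a \<Rightarrow> real) \<Rightarrow> (nat \<Rightarrow> 'a \<Rightarrow> real) \<Rightarrow> real \<Rightarrow> 'a \<Rightarrow> real" where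
  "flight c S \<theta> s \<omega> =
     (let N = event_count S s \<omega>;
          \<sigma> = (\<lambda>j. if j = N + 1 then s else S j \<omega>)
      in c * (\<Sum>j=1..N+1. (\<sigma> j - \<sigma> (j - 1)) * cos (\<theta> j \<omega>)))"

definition standard_brownian_motion :: "'a measure \<Rightarrow> (real \<Rightarrow> 'a \<Rightarrow> real) \<Rightarrow> bool" where
  "standard_brownian_motion M B \<longleftrightarrow>
     (\<forall>s\<ge>0. B s \<in> borel_measurable M) \<and>
     (AE \<omega> in M. B 0 \<omega> = 0) \<and>
     (\<forall>\<tau>::nat \<Rightarrow> real. 0 \<le> \<tau> 0 \<and> strict_mono \<tau> \<longrightarrow>
        prob_space.indep_vars M (\<lambda>_. borel) (\<lambda>i \<omega>. B (\<tau> (Suc i)) \<omega> - B (\<tau> i) \<omega>) UNIV) \<and>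
     (\<forall>s u. 0 \<le> s \<and> s < u \<longrightarrow>
        distributed M lborel (\<lambda>\<omega>. B u \<omega> - B s \<omega>)
          (\<lambda>x. ennreal (normal_density 0 (sqrt (u - s)) x))) \<and>
     (AE \<omega> in M. continuous_on {0..} (\<lambda>s. B s \<omega>))"

definition bessel_process :: "nat \<Rightarrow> (nat \<Rightarrow> real \<Rightarrow> 'a \<Rightarrow> real) \<Rightarrow> real \<Rightarrow> 'a \<Rightarrow> real" where
  "bessel_process d B s \<omega> = sqrt (\<Sum>i=1..d. (B i s \<omega>)\<^sup>2)"

text \<open>\<open>p x s\<close> is, as a function of \<open>x\<close>, a Lebesgue density of \<open>X s\<close> given \<open>N s = n\<close>, for each
  \<open>s > 0\<close>. The measure \<open>uniform_measure M A\<close> is the conditional probability measure given the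
  event \<open>A\<close>. Joint measurability is what makes the mixture in \<open>stopped_density\<close> meaningful;
  changing \<open>p\<close> to another such density changes that mixture only on a null set.\<close>

definition conditional_density ::
    "'a measure \<Rightarrow> (real \<Rightarrow> 'a \<Rightarrow> real) \<Rightarrow> (real \<Rightarrow> 'a \<Rightarrow> nat) \<Rightarrow> nat \<Rightarrow> (real \<Rightarrow> real \<Rightarrow> real) \<Rightarrow> bool"
  where
  "conditional_density M X N n p \<longleftrightarrow>
     (\<lambda>(x, s). p x s) \<in> borel_measurable (borel \<Otimes>\<^sub>M borel) \<and>
     (\<forall>x s. 0 \<le> p x s) \<and>
     (\<forall>s>0. distributed (uniform_measure M {\<omega> \<in> space M. N s \<omega> = n}) lborel (X s)
              (\<lambda>x. ennreal (p x s)))"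

text \<open>The density at \<open>x\<close> of the process stopped at the random time \<open>T\<close> when the number of events up
  to that time is fixed: the densities \<open>p x s\<close> at fixed times are mixed with the law of \<open>T\<close>.\<close>

definition stopped_density ::
    "'a measure \<Rightarrow> (real \<Rightarrow> real \<Rightarrow> real) \<Rightarrow> ('a \<Rightarrow> real) \<Rightarrow> real \<Rightarrow> ennreal" where
  "stopped_density M p T x = (\<integral>\<^sup>+ s\<in>{0<..}. ennreal (p x s) \<partial>(distr M borel T))"

definition v_index :: "nat \<Rightarrow> nat \<Rightarrow> real" where
  "v_index m n = (if m = 0 then real n / 2 else real n + 1)"

end

theory Submission
  imports Defs
begin

text \<open>
  Let \<open>Y\<close> be the sum of \<open>gap\<^sub>j cos \<theta>\<^sub>j\<close> over the first \<open>n\<close> displacements and \<open>S\<close> the \<open>n\<close>-th event time. By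
  induction on \<open>n\<close>, \<open>E (g S * Y\<^sup>k)\<close> is the integral of \<open>g\<close> against an Erlang-type density in which the
  angles enter only through the \<open>k\<close>-th coefficient of \<open>A\<^sup>n\<close>, where \<open>A\<close> is the generating series of the
  moments of \<open>cos \<theta>\<close>; cutting off the last displacement turns \<open>n\<close> into \<open>n + 1\<close>. The powers of the
  arcsine series (\<open>m = 0\<close>) and of the semicircle series (\<open>m = 1\<close>) satisfy differential equations which
  show that the conditional moments of \<open>X\<^sub>m(s)\<close> are those of the density proportional to
  \<open>(c\<^sup>2s\<^sup>2 - x\<^sup>2)\<close> to the power \<open>v\<^sub>m - 1/2\<close>. Laws on a bounded interval are determined by their moments.
  Finally, \<open>R\<^sup>d(t)\<^sup>2 / (2t)\<close> has the Gamma law with parameter \<open>d/2\<close>, and the mixture is rewritten by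
  Kummer's transformation of the confluent hypergeometric function.
\<close>

section \<open>Power kernels and substitutions\<close>

text \<open>Moments separate the time part from the angle part. Powers of displacement lengths,
  divided by factorials, are power kernels, which form a convolution semigroup; so the time integral
  depends only on the total degree k, while the sum over the degrees of the single displacements is
  a Cauchy product of moment series. The exponential waiting times contribute exp (- l u), which
  depends only on the sum u of the gaps. All moments are finite since the path has bounded speed;
  test functions that are bounded and vanish beyond some s make Fubini applicable. The induction
  cannot start at n = 0, where the epoch is the constant 0 and has no density. The condition v_m >
  d/2 - 1 says that b = v_m - d/2 + 1 is positive: g^(-b) is the power of the Gamma variable g left
  over in the mixture, and b becomes the second Beta parameter. Null sets enter twice. At each time
  the conditional density is determined up to a null set depending on that time, so two
  almost-everywhere quantifiers have to be exchanged. And x = 0 is discarded, since for d = 1 the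
  integral over w diverges there.\<close>

definition power_kernel :: "real \<Rightarrow> real \<Rightarrow> real" where
  "power_kernel a u = (if u > 0 then u powr (a - 1) / Gamma a else 0)"

lemma power_kernel_measurable [measurable]: "power_kernel a \<in> borel_measurable borel"
  unfolding power_kernel_def by measurable

lemma power_kernel_nonneg: "a > 0 \<Longrightarrow> 0 \<le> power_kernel a u"
  using Gamma_real_pos[of a] by (auto simp: power_kernel_def)

lemma power_kernel_Suc: "u > 0 \<Longrightarrow> power_kernel (real (Suc k)) u = u ^ k / fact k"
  using Gamma_fact[of k, where 'a=real] by (simp add: power_kernel_def powr_realpow add.commute)

text \<open>The Jacobian 2 y of u = y^2 cancels the singularity of the kernel of order 1/2. This is
  how integrals over a symmetric real variable become convolutions or Gamma integrals in its
  square.\<close>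

lemma power_kernel_half_square: "y > 0 \<Longrightarrow> power_kernel (1/2) (y\<^sup>2) * (2 * y) = 2 / sqrt pi"
proof -
  assume y: "y > 0"
  have "(y\<^sup>2) powr (-1/2) = y powr (2 * (-1/2))" using y
    by (subst powr_powr[symmetric]) (simp add: powr_numeral)
  then show ?thesis using y
    by (simp add: power_kernel_def Gamma_one_half_real powr_minus field_simps)
qed

lemma nn_integral_Beta:
  assumes "a > 0" "b > (0::real)"
  shows "(\<integral>\<^sup>+u. ennreal (u powr (a - 1) * (1 - u) powr (b - 1)) * indicator {0<..<1} u \<partial>lborel) = ennreal (Beta a b)"
proof -
  have "(\<integral>\<^sup>+u. ennreal (indicator {0..1} u * (u powr (a - 1) * (1 - u) powr (b - 1))) \<partial>lborel) = ennreal (Beta a b)"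
    by (rule nn_integral_has_integral_lebesgue[OF _ has_integral_Beta_real[OF assms]]) auto
  moreover have "(\<integral>\<^sup>+u. ennreal (u powr (a - 1) * (1 - u) powr (b - 1)) * indicator {0<..<1} u \<partial>lborel) =
     (\<integral>\<^sup>+u. ennreal (indicator {0..1} u * (u powr (a - 1) * (1 - u) powr (b - 1))) \<partial>lborel)"
    by (intro nn_integral_cong_AE)
       (use AE_lborel_singleton[of 0] AE_lborel_singleton[of 1] in eventually_elim, auto split: split_indicator)
  ultimately show ?thesis by simp
qed

text \<open>The substitution u -> z u leaves a Beta integral, and the division by
  \<open>Gamma a\<close> in the kernel is chosen so that its value cancels. Since kernels vanish for
  u \<le> 0, the integration limits 0 and z are implicit.\<close>

lemma power_kernel_convolution:
  assumes a: "a > 0" and b: "b > (0::real)"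
  shows "(\<integral>\<^sup>+u. ennreal (power_kernel a u) * ennreal (power_kernel b (z - u)) \<partial>lborel) = ennreal (power_kernel (a + b) z)"
proof (cases "z > 0")
  case False
  then have "ennreal (power_kernel a u) * ennreal (power_kernel b (z - u)) = 0" for u
    by (auto simp: power_kernel_def)
  then have "(\<integral>\<^sup>+u. ennreal (power_kernel a u) * ennreal (power_kernel b (z - u)) \<partial>lborel) = (\<integral>\<^sup>+(u::real). 0 \<partial>lborel)"
    by (intro nn_integral_cong)
  then show ?thesis using False by (simp add: power_kernel_def)
next
  case z: True
  have G: "Gamma a > 0" "Gamma b > 0" "Gamma (a + b) > 0" using a b by (auto intro: Gamma_real_pos)
  have "(\<integral>\<^sup>+u. ennreal (power_kernel a u) * ennreal (power_kernel b (z - u)) \<partial>lborel)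
      = ennreal \<bar>z\<bar> * (\<integral>\<^sup>+u. ennreal (power_kernel a (0 + z * u)) * ennreal (power_kernel b (z - (0 + z * u))) \<partial>lborel)"
    by (rule nn_integral_real_affine) (use z in auto)
  also have "(\<integral>\<^sup>+u. ennreal (power_kernel a (0 + z * u)) * ennreal (power_kernel b (z - (0 + z * u))) \<partial>lborel)
     = (\<integral>\<^sup>+u. ennreal (z powr (a + b - 2) / (Gamma a * Gamma b)) *
           (ennreal (u powr (a - 1) * (1 - u) powr (b - 1)) * indicator {0<..<1} u) \<partial>lborel)"
  proof (rule nn_integral_cong)
    fix u :: real
    show "ennreal (power_kernel a (0 + z * u)) * ennreal (power_kernel b (z - (0 + z * u))) =
        ennreal (z powr (a + b - 2) / (Gamma a * Gamma b)) *
           (ennreal (u powr (a - 1) * (1 - u) powr (b - 1)) * indicator {0<..<1} u)"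
    proof (cases "0 < u \<and> u < 1")
      case True
      have "(z * (1 - u)) powr (b - 1) = z powr (b - 1) * (1 - u) powr (b - 1)"
        "(z * u) powr (a - 1) = z powr (a - 1) * u powr (a - 1)"
        "z powr (a + b - 2) = z powr (a - 1) * z powr (b - 1)"
        using True z by (simp_all add: powr_mult powr_add[symmetric])
      moreover have "z - z * u = z * (1 - u)" by (simp add: algebra_simps)
      ultimately      have "power_kernel a (z * u) * power_kernel b (z - z * u) =
         z powr (a + b - 2) / (Gamma a * Gamma b) * (u powr (a - 1) * (1 - u) powr (b - 1))"
        using True z G by (simp add: power_kernel_def zero_less_mult_iff)
      then show ?thesis using True G a b
        by (simp add: ennreal_mult[symmetric] power_kernel_nonneg)
    next
      case False
      then have "z * u \<le> 0 \<or> z - z * u \<le> 0" using z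
        by (auto simp: mult_le_0_iff not_less)
      then show ?thesis using False by (auto simp: power_kernel_def)
    qed
  qed
  also have "\<dots> = ennreal (z powr (a + b - 2) / (Gamma a * Gamma b)) * ennreal (Beta a b)"
    by (subst nn_integral_cmult) (auto simp: nn_integral_Beta[OF a b])
  also have "ennreal \<bar>z\<bar> * \<dots> = ennreal (z * (z powr (a + b - 2) / (Gamma a * Gamma b) * Beta a b))"
    using z G by (simp add: ennreal_mult[symmetric] Beta_def)
  also have "z * (z powr (a + b - 2) / (Gamma a * Gamma b) * Beta a b) = power_kernel (a + b) z"
    using z G by (simp add: Beta_def power_kernel_def powr_diff field_simps power2_eq_square)
  finally show ?thesis .
qed

text \<open>Read from right to left this represents a negative power of g as a Laplace integral, the
  starting point of \<open>nn_integral_Kummer\<close>.\<close>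

lemma nn_integral_Gamma_scaled:
  assumes a: "a > 0" and g: "g > (0::real)"
  shows "(\<integral>\<^sup>+q. ennreal (q powr (a - 1) * exp (- g * q)) * indicator {0<..} q \<partial>lborel) = ennreal (Gamma a * g powr (- a))"
proof -
  have 1: "(\<integral>\<^sup>+q. ennreal (q powr (a - 1) * exp (- q)) * indicator {0<..} q \<partial>lborel) = ennreal (Gamma a)"
    unfolding Gamma_conv_nn_integral_real[OF a]
    by (intro nn_integral_cong_AE)
       (use AE_lborel_singleton[of 0] in eventually_elim, auto split: split_indicator simp: exp_minus field_simps)
  have "ennreal (Gamma a) = ennreal \<bar>g\<bar> * (\<integral>\<^sup>+q. ennreal ((0 + g * q) powr (a - 1) * exp (- (0 + g * q))) * indicator {0<..} (0 + g * q) \<partial>lborel)"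
    unfolding 1[symmetric] by (rule nn_integral_real_affine) (use g in auto)
  also have "\<dots> = ennreal (g powr a) * (\<integral>\<^sup>+q. ennreal (q powr (a - 1) * exp (- g * q)) * indicator {0<..} q \<partial>lborel)"
  proof -
    have "(\<integral>\<^sup>+q. ennreal ((0 + g * q) powr (a - 1) * exp (- (0 + g * q))) * indicator {0<..} (0 + g * q) \<partial>lborel)
       = (\<integral>\<^sup>+q. ennreal (g powr (a - 1)) * (ennreal (q powr (a - 1) * exp (- g * q)) * indicator {0<..} q) \<partial>lborel)"
      using g by (intro nn_integral_cong) (auto split: split_indicator simp: powr_mult ennreal_mult[symmetric]
          zero_less_mult_iff mult.assoc)
    also have "\<dots> = ennreal (g powr (a - 1)) * (\<integral>\<^sup>+q. ennreal (q powr (a - 1) * exp (- g * q)) * indicator {0<..} q \<partial>lborel)"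
      by (rule nn_integral_cmult) auto
    finally show ?thesis using g by (simp add: mult.assoc[symmetric] ennreal_mult[symmetric] powr_diff)
  qed
  finally have E: "ennreal (Gamma a) = ennreal (g powr a) * (\<integral>\<^sup>+q. ennreal (q powr (a - 1) * exp (- g * q)) * indicator {0<..} q \<partial>lborel)" .
  \<comment> \<open>In \<open>ennreal\<close> the integral might still be infinite; multiplying by
    the finite inverse factor isolates it without a cancellation law.\<close>
  have "ennreal (g powr (-a)) * ennreal (Gamma a) = ennreal (g powr (-a) * g powr a) * (\<integral>\<^sup>+q. ennreal (q powr (a - 1) * exp (- g * q)) * indicator {0<..} q \<partial>lborel)"
    unfolding E by (simp add: ennreal_mult mult.assoc)
  also have "g powr (-a) * g powr a = 1" using g by (simp add: powr_add[symmetric])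
  finally show ?thesis using Gamma_real_pos[OF a] by (simp add: ennreal_mult[symmetric] mult.commute)
qed

text \<open>Both sides are increasing limits: the rule for compact intervals is applied on
  \<open>{a i..b i}\<close> and monotone convergence passes to the union. In this way g may blow up
  at the ends of I.\<close>

lemma nn_integral_substitution_exhaust:
  fixes f :: "real \<Rightarrow> ennreal" and a b :: "nat \<Rightarrow> real"
  assumes f [measurable]: "f \<in> borel_measurable borel"
    and deriv: "\<And>x. x \<in> I \<Longrightarrow> (g has_real_derivative g' x) (at x)"
    and cont: "continuous_on I g'"
    and nonneg: "\<And>x. x \<in> I \<Longrightarrow> g' x \<ge> 0"
    and ab: "decseq a" "incseq b" "\<And>i. a i < b i"
    and I: "I = (\<Union>i. {a i..b i})" and J: "J = (\<Union>i. {g (a i)..g (b i)})"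
  shows "(\<integral>\<^sup>+x. f x * indicator J x \<partial>lborel) = (\<integral>\<^sup>+x. f (g x) * ennreal (g' x) * indicator I x \<partial>lborel)"
proof -
  have sub: "{a i..b i} \<subseteq> I" for i using I by auto
  have mono: "g x \<le> g y" if "x \<le> y" "{x..y} \<subseteq> I" for x y
    by (rule deriv_nonneg_imp_mono[of x y g g']) (use that deriv nonneg in auto)
  have incI: "incseq (\<lambda>i. {a i..b i})"
    using ab by (auto simp: incseq_def decseq_def intro: order_trans)
  have incJ: "incseq (\<lambda>i. {g (a i)..g (b i)})"
  proof (rule incseq_SucI)
    fix i
    have s: "a (Suc i) \<le> a i" "b i \<le> b (Suc i)" "a i < b i"
      using ab by (auto simp: incseq_Suc_iff decseq_Suc_iff)
    have "g (a (Suc i)) \<le> g (a i)" "g (b i) \<le> g (b (Suc i))"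
      using s sub[of "Suc i"] by (auto intro!: mono)
    then show "{g (a i)..g (b i)} \<subseteq> {g (a (Suc i))..g (b (Suc i))}" by auto
  qed
  have [measurable]: "I \<in> sets borel" unfolding I by measurable
  have c: "continuous_on I g"
    by (meson DERIV_isCont deriv continuous_at_imp_continuous_on)
  have [measurable]: "(\<lambda>x. indicator I x *\<^sub>R g x) \<in> borel_measurable borel"
      "(\<lambda>x. indicator I x *\<^sub>R g' x) \<in> borel_measurable borel"
    using borel_measurable_continuous_on_indicator[OF _ c] borel_measurable_continuous_on_indicator[OF _ cont]
    by simp_all
  \<comment> \<open>Outside I nothing is known about g and g', so both are cut off by the indicator
    before measurability on the whole line is claimed.\<close>
  define h where "h x = f (indicator I x *\<^sub>R g x) * ennreal (indicator I x *\<^sub>R g' x)" for x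
  have [measurable]: "h \<in> borel_measurable borel" unfolding h_def by measurable
  have "(\<integral>\<^sup>+x. f x * indicator J x \<partial>lborel) = emeasure (density lborel f) (\<Union>i. {g (a i)..g (b i)})"
    by (subst emeasure_density) (auto simp: J)
  also have "\<dots> = (SUP i. emeasure (density lborel f) {g (a i)..g (b i)})"
    by (rule SUP_emeasure_incseq[symmetric]) (use incJ in auto)
  also have "\<dots> = (SUP i. emeasure (density lborel h) {a i..b i})"
  proof (rule SUP_cong[OF refl])
    fix i
    have "emeasure (density lborel f) {g (a i)..g (b i)} = (\<integral>\<^sup>+x. f x * indicator {g (a i)..g (b i)} x \<partial>lborel)"
      by (subst emeasure_density) auto
    also have "\<dots> = (\<integral>\<^sup>+x. f (g x) * ennreal (g' x) * indicator {a i..b i} x \<partial>lborel)"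
      by (rule nn_integral_substitution_aux)
         (use ab(3) sub[of i] deriv nonneg continuous_on_subset[OF cont sub[of i]] in auto)
    also have "\<dots> = (\<integral>\<^sup>+x. h x * indicator {a i..b i} x \<partial>lborel)"
      using sub[of i] by (intro nn_integral_cong) (auto simp: h_def split: split_indicator)
    finally show "emeasure (density lborel f) {g (a i)..g (b i)} = emeasure (density lborel h) {a i..b i}"
      by (subst (2) emeasure_density) auto
  qed
  also have "\<dots> = emeasure (density lborel h) (\<Union>i. {a i..b i})"
    by (rule SUP_emeasure_incseq) (use incI in auto)
  also have "\<dots> = (\<integral>\<^sup>+x. f (g x) * ennreal (g' x) * indicator I x \<partial>lborel)"
    unfolding I[symmetric]
    by (subst emeasure_density) (auto simp: h_def intro!: nn_integral_cong split: split_indicator)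
  finally show ?thesis .
qed

lemma nn_integral_substitution_square:
  fixes f :: "real \<Rightarrow> ennreal"
  assumes [measurable]: "f \<in> borel_measurable borel"
  shows "(\<integral>\<^sup>+u. f u * indicator {0<..} u \<partial>lborel) = (\<integral>\<^sup>+x. f (x\<^sup>2) * ennreal (2 * x) * indicator {0<..} x \<partial>lborel)"
proof (rule nn_integral_substitution_exhaust
    [where a="\<lambda>i. 1 / real (i + 2)" and b="\<lambda>i. real (i + 2)"])
  show *: "{0<..} = (\<Union>i. {1 / real (i + 2)..real (i + 2)})"
  proof safe
    fix x :: real assume "x > 0"
    obtain i where "max x (1 / x) < real i" using reals_Archimedean2 by blast
    then have "1 / real (i + 2) \<le> x \<and> x \<le> real (i + 2)"
      using \<open>x > 0\<close> by (auto simp: field_simps)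
    then show "x \<in> (\<Union>i. {1 / real (i + 2)..real (i + 2)})" by auto
  next
    fix x :: real and i assume "x \<in> {1 / real (i + 2)..real (i + 2)}"
    moreover have "0 < 1 / real (i + 2)" by simp
    ultimately show "0 < x" unfolding atLeastAtMost_iff by linarith
  qed
  show "{0<..} = (\<Union>i. {(1 / real (i + 2))\<^sup>2..(real (i + 2))\<^sup>2})"
  proof safe
    fix x :: real assume "x > 0"
    then obtain i where i: "1 / real (i + 2) \<le> sqrt x" "sqrt x \<le> real (i + 2)"
      using * by (metis (no_types, lifting) UN_iff atLeastAtMost_iff greaterThan_iff real_sqrt_gt_0_iff)
    have "(1 / real (i + 2))\<^sup>2 \<le> (sqrt x)\<^sup>2" by (rule power_mono) (use i in auto)
    moreover have "(sqrt x)\<^sup>2 \<le> (real (i + 2))\<^sup>2" by (rule power_mono) (use i \<open>x > 0\<close> in auto)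
    ultimately show "x \<in> (\<Union>i. {(1 / real (i + 2))\<^sup>2..(real (i + 2))\<^sup>2})" using \<open>x > 0\<close> by auto
  next
    fix x :: real and i assume "x \<in> {(1 / real (i + 2))\<^sup>2..(real (i + 2))\<^sup>2}"
    moreover have "0 < (1 / real (i + 2))\<^sup>2" by simp
    ultimately show "0 < x" unfolding atLeastAtMost_iff by linarith
  qed
  \<comment> \<open>The shift by 2 keeps the interval proper already for i = 0; with i + 1 it would
    be a point.\<close>
  show "1 / real (i + 2) < real (i + 2)" for i
    by (auto simp: field_simps intro!: add_pos_nonneg) 
qed (auto intro!: derivative_eq_intros continuous_intros simp: decseq_def incseq_def field_simps)

text \<open>The map w -> (1 - w) / w decreases, whereas the substitution rule wants a nonnegative
  derivative. So the increasing map z -> z / (1 - z) is used, followed by the reflection z = 1 -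
  w.\<close>

lemma nn_integral_substitution_odds:
  fixes f :: "real \<Rightarrow> ennreal"
  assumes [measurable]: "f \<in> borel_measurable borel"
  shows "(\<integral>\<^sup>+q. f q * indicator {0<..} q \<partial>lborel) =
    (\<integral>\<^sup>+w. f ((1 - w) / w) * ennreal (1 / w\<^sup>2) * indicator {0<..<1} w \<partial>lborel)"
proof -
  have "(\<integral>\<^sup>+q. f q * indicator {0<..} q \<partial>lborel) =
    (\<integral>\<^sup>+z. f (z / (1 - z)) * ennreal (1 / (1 - z)\<^sup>2) * indicator {0<..<1} z \<partial>lborel)"
  proof (rule nn_integral_substitution_exhaust
      [where a="\<lambda>i. 1 / real (i + 3)" and b="\<lambda>i. 1 - 1 / real (i + 3)"])
    show "{0<..<1} = (\<Union>i. {1 / real (i + 3)..1 - 1 / real (i + 3)})"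
    proof safe
      fix x :: real assume x: "x \<in> {0<..<1}"
      obtain i where "max (1 / (1 - x)) (1 / x) < real i" using reals_Archimedean2 by blast
      then have "1 / real (i + 3) \<le> x \<and> 1 / real (i + 3) \<le> 1 - x"
        using x by (auto simp: field_simps)
      then show "x \<in> (\<Union>i. {1 / real (i + 3)..1 - 1 / real (i + 3)})" by (auto simp: algebra_simps)
    next
      fix x :: real and i assume "x \<in> {1 / real (i + 3)..1 - 1 / real (i + 3)}"
      moreover have "0 < 1 / real (i + 3)" by simp
      ultimately have "0 < x" "x < 1" unfolding atLeastAtMost_iff by linarith+
      then show "x \<in> {0<..<1}" by simp
    qed
    \<comment> \<open>With i + 3 on the unit interval, the image intervals run exactly from 1 / (i +
      2) to i + 2 and exhaust the positive half line.\<close>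
    have e: "1 / real (i + 3) / (1 - 1 / real (i + 3)) = 1 / real (i + 2)"
      "(1 - 1 / real (i + 3)) / (1 - (1 - 1 / real (i + 3))) = real (i + 2)" for i
      by (auto simp: field_simps)
    show "{0<..} = (\<Union>i. {1 / real (i + 3) / (1 - 1 / real (i + 3))..(1 - 1 / real (i + 3)) / (1 - (1 - 1 / real (i + 3)))})"
      unfolding e
    proof safe
      fix x :: real assume "x > 0"
      obtain i where "max x (1 / x) < real i" using reals_Archimedean2 by blast
      then have "1 / real (i + 2) \<le> x \<and> x \<le> real (i + 2)"
        using \<open>x > 0\<close> by (auto simp: field_simps)
      then show "x \<in> (\<Union>i. {1 / real (i + 2)..real (i + 2)})" by auto
    next
      fix x :: real and i assume "x \<in> {1 / real (i + 2)..real (i + 2)}"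
      moreover have "0 < 1 / real (i + 2)" by simp
      ultimately show "0 < x" unfolding atLeastAtMost_iff by linarith
    qed
    show "((\<lambda>z. z / (1 - z)) has_real_derivative 1 / (1 - z)\<^sup>2) (at z)" if "z \<in> {0<..<1}" for z :: real
      using that by (auto intro!: derivative_eq_intros simp: power2_eq_square field_simps)
  qed (auto intro!: continuous_intros simp: decseq_def incseq_def field_simps)
  also have "\<dots> = ennreal \<bar>-1\<bar> * (\<integral>\<^sup>+w. f ((1 + (-1) * w) / (1 - (1 + (-1) * w))) * ennreal (1 / (1 - (1 + (-1) * w))\<^sup>2) * indicator {0<..<1} (1 + (-1) * w) \<partial>lborel)"
    by (rule nn_integral_real_affine) auto
  also have "\<dots> = (\<integral>\<^sup>+w. f ((1 - w) / w) * ennreal (1 / w\<^sup>2) * indicator {0<..<1} w \<partial>lborel)"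
    by (auto intro!: nn_integral_cong split: split_indicator)
  finally show ?thesis .
qed

section \<open>Moment series\<close>

unbundle no vec_syntax
unbundle fps_syntax

text \<open>For v > -1/2 these are the moments of the law on (-1, 1) with density proportional to (1
  - x^2)^(v - 1/2); the moment of order 2j is (1/2)_j / (v + 1)_j in rising factorials. The two-step
  recursion serves as definition because it is what the later identifications verify.\<close>

fun ultra_moment :: "real \<Rightarrow> nat \<Rightarrow> real" where
  "ultra_moment v 0 = 1"
| "ultra_moment v (Suc 0) = 0"
| "ultra_moment v (Suc (Suc k)) = (real k + 1) / (real k + 2 * v + 2) * ultra_moment v k"

text \<open>Unlike the plain derivative it does not shift indices, so a recursion with coefficients
  polynomial in k turns directly into an equation between series.\<close>

definition euler_op :: "real fps \<Rightarrow> real fps" where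
  "euler_op F = fps_X * fps_deriv F"

lemma euler_op_nth: "euler_op F $ k = real k * F $ k"
  by (cases k) (auto simp: euler_op_def)

lemma euler_op_mult: "euler_op (F * G) = euler_op F * G + F * euler_op G"
  by (simp add: euler_op_def algebra_simps)

lemma euler_op_add: "euler_op (F + G) = euler_op F + euler_op G"
  by (simp add: euler_op_def algebra_simps)

lemma euler_op_power: "euler_op (F ^ n) = of_nat n * F ^ (n - 1) * euler_op F"
  by (simp add: euler_op_def fps_deriv_power fps_of_nat algebra_simps)

lemma fps_X_square_mult_nth: "(fps_X\<^sup>2 * F) $ k = (if k < 2 then 0 else F $ (k - 2))"
  by (simp add: fps_X_power_mult_nth)

text \<open>Plays the role of the integration constant: an expression annihilated by the operator is
  determined by its coefficient at 0.\<close>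

lemma euler_op_eq_0: "euler_op F = 0 \<Longrightarrow> F = fps_const (F $ 0)"
  proof (rule fps_ext)
  fix k
  assume "euler_op F = 0"
  then have "real k * F $ k = 0" by (metis euler_op_nth fps_zero_nth)
  then show "F $ k = fps_const (F $ 0) $ k" by auto
qed

lemma nat_cases_Suc_Suc: "(k::nat) = 0 \<or> k = Suc 0 \<or> (\<exists>j. k = Suc (Suc j))"
  by (metis not0_implies_Suc)

text \<open>Moment series of cos \<theta> for m = 0 and m = 1; as functions they are (1 -
  x^2)^(-1/2) and 2 (1 - (1 - x^2)^(1/2)) / x^2.\<close>

definition arcsine_fps :: "real fps" where "arcsine_fps = Abs_fps (ultra_moment 0)"
definition semicircle_fps :: "real fps" where "semicircle_fps = Abs_fps (ultra_moment 1)"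

lemma euler_op_arcsine: "euler_op arcsine_fps = fps_X\<^sup>2 * (euler_op arcsine_fps + arcsine_fps)"
proof (rule fps_ext)
  fix k
  show "euler_op arcsine_fps $ k = (fps_X\<^sup>2 * (euler_op arcsine_fps + arcsine_fps)) $ k"
    unfolding fps_X_square_mult_nth euler_op_nth fps_add_nth using nat_cases_Suc_Suc[of k]
    by (auto simp: arcsine_fps_def field_simps)
qed

lemma euler_op_arcsine': "(1 - fps_X\<^sup>2) * euler_op arcsine_fps = fps_X\<^sup>2 * arcsine_fps"
proof -
  have "(1 - x) * a = x * b" if "a = x * (a + b)" for a b x :: "real fps"
    using that by algebra
  from this[OF euler_op_arcsine] show ?thesis .
qed

text \<open>By the differential equation the left side has derivative zero, and its constant term is
  1. The identity replaces the closed form (1 - X^2)^(-1/2), so no root of a series has to be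
  chosen.\<close>

lemma arcsine_square: "(1 - fps_X\<^sup>2) * arcsine_fps\<^sup>2 = 1"
proof -
  have tx: "euler_op (1 - fps_X\<^sup>2) = - 2 * fps_X\<^sup>2" by (simp add: euler_op_def fps_deriv_power power2_eq_square)
  have "euler_op ((1 - fps_X\<^sup>2) * arcsine_fps\<^sup>2) =
     - 2 * fps_X\<^sup>2 * arcsine_fps\<^sup>2 + 2 * arcsine_fps * ((1 - fps_X\<^sup>2) * euler_op arcsine_fps)"
    unfolding euler_op_mult tx power2_eq_square[of arcsine_fps] euler_op_mult by algebra
  also have "\<dots> = 0" unfolding euler_op_arcsine' by (simp add: algebra_simps power2_eq_square)
  finally have "(1 - fps_X\<^sup>2) * arcsine_fps\<^sup>2 = fps_const (((1 - fps_X\<^sup>2) * arcsine_fps\<^sup>2) $ 0)"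
    by (rule euler_op_eq_0)
  then show ?thesis by (simp add: arcsine_fps_def power2_eq_square)
qed

text \<open>Equivalently, X^2 times the semicircle series is a primitive: its Euler derivative is 2
  X^2 times the arcsine series. On coefficients the relation is an induction over the two moment
  recursions.\<close>

lemma semicircle_arcsine: "euler_op semicircle_fps + 2 * semicircle_fps = 2 * arcsine_fps"
proof (rule fps_ext)
  have *: "(real k + 2) * ultra_moment 1 k = 2 * ultra_moment 0 k" for k
  proof (induction k rule: nat_less_induct)
    case (1 k)
    consider "k = 0" | "k = 1" | j where "k = Suc (Suc j)" using nat_cases_Suc_Suc[of k] by auto
    then show ?case
    proof cases
      case 3
      with 1 have "(real j + 2) * ultra_moment 1 j = 2 * ultra_moment 0 j" by simp
      then have "ultra_moment 0 j = (real j + 2) * ultra_moment 1 j / 2" by simp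
      then show ?thesis unfolding 3 by (simp add: divide_simps) (simp add: algebra_simps)
    qed auto
  qed
  fix k
  have "(2 * semicircle_fps) $ k = 2 * semicircle_fps $ k" "(2 * arcsine_fps) $ k = 2 * arcsine_fps $ k"
    by (simp_all add: numeral_fps_const)
  then show "(euler_op semicircle_fps + 2 * semicircle_fps) $ k = (2 * arcsine_fps) $ k"
    unfolding euler_op_nth fps_add_nth using *[of k] by (simp add: semicircle_fps_def arcsine_fps_def algebra_simps)
qed

text \<open>With \<open>P\<close> the arcsine series and \<open>R = (1 - X\<^sup>2) P\<close> the square root of \<open>1 - X\<^sup>2\<close>, the semicircle series is \<open>2 / (1 + R)\<close>.\<close>

lemma euler_op_semicircle: "euler_op semicircle_fps + semicircle_fps = arcsine_fps * semicircle_fps"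
proof -
  let ?P = arcsine_fps and ?M = semicircle_fps and ?X = "fps_X :: real fps"
  define R where "R = (1 - ?X\<^sup>2) * ?P"
  have tx: "euler_op (1 - ?X\<^sup>2) = - 2 * ?X\<^sup>2" by (simp add: euler_op_def fps_deriv_power power2_eq_square)
  have tx2: "euler_op (?X\<^sup>2) = 2 * ?X\<^sup>2" by (simp add: euler_op_def fps_deriv_power power2_eq_square)
  have "euler_op R = - (?X\<^sup>2 * ?P)"
    unfolding R_def euler_op_mult tx euler_op_arcsine' by (simp add: algebra_simps)
  moreover have "euler_op (?X\<^sup>2 * ?M) = ?X\<^sup>2 * (2 * ?P)"
    unfolding euler_op_mult tx2 semicircle_arcsine[symmetric] by (simp add: algebra_simps)
  ultimately have "euler_op (?X\<^sup>2 * ?M + R + R) = 0" unfolding euler_op_add by (simp add: algebra_simps)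
  then have "?X\<^sup>2 * ?M + R + R = fps_const ((?X\<^sup>2 * ?M + R + R) $ 0)" by (rule euler_op_eq_0)
  also have "\<dots> = 2" by (simp add: R_def arcsine_fps_def numeral_fps_const)
  finally have M: "?X\<^sup>2 * ?M = 2 * (1 - R)" by (simp add: algebra_simps)
  have RP: "R * ?P = 1" using arcsine_square by (simp add: R_def power2_eq_square mult.assoc)
  have RR: "R * R = 1 - ?X\<^sup>2"
  proof -
    have "R * R = (1 - ?X\<^sup>2) * (R * ?P)" by (simp add: R_def algebra_simps)
    then show ?thesis by (simp add: RP)
  qed
  have "?X\<^sup>2 * (?M * (1 + R)) = 2 * (1 - R) * (1 + R)"
    unfolding mult.assoc[symmetric] M ..
  also have "\<dots> = 2 * (1 - R * R)" by (simp add: algebra_simps)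
  also have "\<dots> = ?X\<^sup>2 * 2" by (simp add: RR)
  finally have "?M * (1 + R) = 2" by (subst (asm) mult_left_cancel) auto
  then have "?M * (1 + R) * ?P = 2 * ?P" by simp
  moreover have "?M * (1 + R) * ?P = ?M * ?P + ?M * (R * ?P)" by (simp add: algebra_simps)
  ultimately have "?M * ?P + ?M = 2 * ?P" by (simp add: RP)
  then show ?thesis using semicircle_arcsine by algebra
qed

text \<open>Common criterion for the coefficients of series powers, the moments of the
  ultraspherical density and those of the cosine of an angle. For v > -1 the factor k + 2 v + 2 is
  positive and may be divided out.\<close>

lemma ultra_moment_unique:
  assumes "f 0 = 1" "f (Suc 0) = 0"
    and "\<And>k. (real k + 2 * v + 2) * f (Suc (Suc k)) = (real k + 1) * f k" and "v > - 1"
  shows "f k = ultra_moment v k"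
proof (induction k rule: nat_less_induct)
  case (1 k)
  consider "k = 0" | "k = 1" | j where "k = Suc (Suc j)" using nat_cases_Suc_Suc[of k] by auto
  then show ?case
  proof cases
    case 3
    with 1 have "f j = ultra_moment v j" by simp
    moreover have "real j + 2 * v + 2 > 0" using assms(4) by simp
    ultimately show ?thesis using assms(3)[of j] unfolding 3 by (simp add: field_simps)
  qed (use assms in auto)
qed

text \<open>The power F satisfies (1 - X^2) X F' = (n + 1) X^2 F, hence (k + 2) F_(k+2) = (k + n +
  1) F_k. The weight k! n! / (k + n)! is, up to s^k, the ratio of the time factors in
  \<open>flight_moment_gaps\<close> at k and at 0; it turns this recursion into that of
  \<open>ultra_moment\<close> with 2 v = n.\<close>

lemma arcsine_power_nth:
  "(arcsine_fps ^ Suc n) $ k * fact k * fact n / fact (k + n) = ultra_moment (real n / 2) k"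
proof (rule ultra_moment_unique)
  define F where "F = arcsine_fps ^ Suc n"
  have "(1 - fps_X\<^sup>2) * euler_op F = of_nat (Suc n) * arcsine_fps ^ n * ((1 - fps_X\<^sup>2) * euler_op arcsine_fps)"
    unfolding F_def euler_op_power diff_Suc_1 by (simp only: mult_ac)
  also have "\<dots> = fps_X\<^sup>2 * (of_nat (Suc n) * F)"
    unfolding euler_op_arcsine' F_def power_Suc by (simp only: mult_ac)
  finally have E: "euler_op F = fps_X\<^sup>2 * (euler_op F + of_nat (Suc n) * F)" by algebra
  have N: "(of_nat (Suc n) * F) $ k = real (Suc n) * F $ k" for k
    by (simp only: fps_of_nat[symmetric] fps_mult_left_const_nth)
  have rec: "real k * F $ k = (if k < 2 then 0 else real (k - 2) * F $ (k - 2) + real (Suc n) * F $ (k - 2))" for k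
    using arg_cong[OF E, of "\<lambda>F. F $ k"] unfolding fps_X_square_mult_nth euler_op_nth fps_add_nth N .
  show "(arcsine_fps ^ Suc n) $ 0 * fact 0 * fact n / fact (0 + n) = 1"
    by (simp add: arcsine_fps_def fps_nth_power_0)
  show "(arcsine_fps ^ Suc n) $ Suc 0 * fact (Suc 0) * fact n / fact (Suc 0 + n) = 0"
    using rec[of 1] by (simp add: F_def)
  fix k
  have r: "(real k + 2) * F $ (k + 2) = (real k + real n + 1) * F $ k"
    using rec[of "k+2"] by (simp add: algebra_simps)
  have f: "(fact (Suc (Suc k)) :: real) = (real k + 2) * (real k + 1) * fact k"
     "(fact (Suc (Suc k) + n) :: real) = (real k + real n + 2) * (real k + real n + 1) * fact (k + n)"
    by (simp_all add: algebra_simps)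
  have "(real k + 2 * (real n / 2) + 2) * (F $ (k + 2) * fact (Suc (Suc k)) * fact n / fact (Suc (Suc k) + n))
     = (real k + real n + 2) * (((real k + 2) * F $ (k + 2)) * (real k + 1) * fact k * fact n / fact (Suc (Suc k) + n))"
    unfolding f(1) by simp
  also have "\<dots> = (real k + 1) * (F $ k * fact k * fact n / fact (k + n))"
    unfolding r f(2) by (simp add: divide_simps add_eq_0_iff)
  finally show "(real k + 2 * (real n / 2) + 2) * ((arcsine_fps ^ Suc n) $ Suc (Suc k) * fact (Suc (Suc k)) * fact n / fact (Suc (Suc k) + n)) =
         (real k + 1) * ((arcsine_fps ^ Suc n) $ k * fact k * fact n / fact (k + n))"
    by (simp add: F_def)
qed simp

text \<open>With N = n + 1 and P the arcsine series, the first-order equation X F' + N F = N P F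
  still contains P. Applying the operator once more and eliminating P gives a second-order equation
  with polynomial coefficients, that is, a two-step recursion.\<close>

lemma semicircle_power_nth:
  "(semicircle_fps ^ Suc n) $ k * fact k * fact n / fact (k + n) = ultra_moment (real n + 1) k"
proof (rule ultra_moment_unique)
  let ?P = arcsine_fps and ?X = "fps_X :: real fps" and ?N = "of_nat (Suc n) :: real fps"
  define F where "F = semicircle_fps ^ Suc n"
  have 1: "euler_op F + ?N * F = ?N * (?P * F)"
  proof -
    have "euler_op F + ?N * F = ?N * semicircle_fps ^ n * (euler_op semicircle_fps + semicircle_fps)"
      unfolding F_def euler_op_power diff_Suc_1 by (simp add: algebra_simps)
    then show ?thesis unfolding euler_op_semicircle F_def by (simp add: mult_ac)
  qed
  have tN: "euler_op (?N * G) = ?N * euler_op G" for G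
    by (simp add: euler_op_def fps_of_nat[symmetric] mult.left_commute del: of_nat_Suc)
  \<comment> \<open>By the first-order equation G equals N P F, so applying the operator to G
    produces P^2, which \<open>arcsine_square\<close> removes.\<close>
  define G where "G = euler_op F + ?N * F"
  have "euler_op G = ?N * (euler_op ?P * F + ?P * euler_op F)"
    unfolding G_def 1 tN by (simp only: euler_op_mult)
  then have "euler_op G + ?N * G = ?N * (euler_op ?P * F + ?P * (euler_op F + ?N * F))"
    using 1[folded G_def] by algebra
  also have "\<dots> = ?N * (euler_op ?P * F + ?N * (?P\<^sup>2 * F))"
    unfolding 1 by (simp add: algebra_simps power2_eq_square)
  finally have "(1 - ?X\<^sup>2) * (euler_op G + ?N * G) = ?N * (((1 - ?X\<^sup>2) * euler_op ?P) * F + ?N * (((1 - ?X\<^sup>2) * ?P\<^sup>2) * F))"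
    by (simp add: algebra_simps)
  also have "\<dots> = ?X\<^sup>2 * (?N * (?P * F)) + ?N * ?N * F"
    unfolding euler_op_arcsine' arcsine_square by (simp add: algebra_simps)
  finally have E: "euler_op G + ?N * G - ?N * ?N * F = ?X\<^sup>2 * (euler_op G + ?N * G + G)"
    unfolding 1[symmetric] G_def[symmetric] by algebra
  have N: "(?N * H) $ k = real (Suc n) * H $ k" for k H
    by (simp only: fps_of_nat[symmetric] fps_mult_left_const_nth)
  have G: "G $ k = (real k + real (Suc n)) * F $ k" for k
    unfolding G_def fps_add_nth euler_op_nth N by (simp add: algebra_simps)
  \<comment> \<open>The coefficients of G are (k + N) F_k, and (k + N)^2 - N^2 = k (k + 2 N). The
    factor k is absorbed by k!, and k + 2 N taken at k + 2 is k + 2 v + 2 for v = n + 1.\<close>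
  have rec: "((real k + real (Suc n))\<^sup>2 - (real (Suc n))\<^sup>2) * F $ k = (if k < 2 then 0 else
      (real (k - 2) + real (Suc n)) * (real (k - 2) + real (Suc n) + 1) * F $ (k - 2))" for k
    using arg_cong[OF E, of "\<lambda>F. F $ k"]
    unfolding fps_X_square_mult_nth euler_op_nth fps_add_nth fps_sub_nth mult.assoc[of ?N] N G
    by (simp add: algebra_simps power2_eq_square split: if_splits)
  show "(semicircle_fps ^ Suc n) $ 0 * fact 0 * fact n / fact (0 + n) = 1"
    by (simp add: semicircle_fps_def fps_nth_power_0)
  show "(semicircle_fps ^ Suc n) $ Suc 0 * fact (Suc 0) * fact n / fact (Suc 0 + n) = 0"
  proof -
    have "(real 1 + real (Suc n))\<^sup>2 - (real (Suc n))\<^sup>2 \<noteq> 0" by (simp add: power2_eq_square algebra_simps)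
    then show ?thesis using rec[of 1] by (simp add: F_def)
  qed
  fix k
  have "(real k + 2) * ((real k + 2 * real n + 4) * F $ (k + 2)) =
     (real k + real n + 1) * (real k + real n + 2) * F $ k"
    using rec[of "k+2"] by (simp add: algebra_simps power2_eq_square)
  then have r: "(real k + 2 * real n + 4) * F $ (k + 2) =
     (real k + real n + 1) * (real k + real n + 2) * F $ k / (real k + 2)"
    by (simp add: divide_simps mult.commute)
  have f: "(fact (Suc (Suc k)) :: real) = (real k + 2) * (real k + 1) * fact k"
     "(fact (Suc (Suc k) + n) :: real) = (real k + real n + 2) * (real k + real n + 1) * fact (k + n)"
    by (simp_all add: algebra_simps)
  have "(real k + 2 * (real n + 1) + 2) * (F $ (k + 2) * fact (Suc (Suc k)) * fact n / fact (Suc (Suc k) + n))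
     = ((real k + 2 * real n + 4) * F $ (k + 2)) * (fact (Suc (Suc k)) * fact n / fact (Suc (Suc k) + n))"
    by (simp add: algebra_simps)
  also have "\<dots> = (real k + 1) * (F $ k * fact k * fact n / fact (k + n))"
    unfolding r f by (simp add: divide_simps add_eq_0_iff)
  finally show "(real k + 2 * (real n + 1) + 2) * ((semicircle_fps ^ Suc n) $ Suc (Suc k) * fact (Suc (Suc k)) * fact n / fact (Suc (Suc k) + n)) =
         (real k + 1) * ((semicircle_fps ^ Suc n) $ k * fact k * fact n / fact (k + n))"
    by (simp add: F_def)
qed simp

text \<open>The binomial coefficient times the two factorials is k!, so the binomial expansion of a
  moment becomes a Cauchy product of ordinary power series. Hence one more displacement means one
  more factor \<open>A\<close>.\<close>

lemma fps_power_binomial_sum: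
  fixes A :: "real fps"
  shows "(\<Sum>i\<le>k. real (k choose i) * A $ (k - i) * (fact (k - i) * fact i * (A ^ n) $ i * c)) = fact k * (A ^ Suc n) $ k * c"
proof -
  have "real (k choose i) * A $ (k - i) * (fact (k - i) * fact i * (A ^ n) $ i * c) = fact k * c * ((A ^ n) $ i * A $ (k - i))" if "i \<le> k" for i
  proof -
    have "real (k choose i) * (fact i * fact (k - i)) = fact k"
      using that by (simp add: binomial_fact)
    then have "fact k * c * ((A ^ n) $ i * A $ (k - i)) = (real (k choose i) * (fact i * fact (k - i))) * c * ((A ^ n) $ i * A $ (k - i))"
      by simp
    then show ?thesis by (simp only: mult_ac)
  qed
  then have "(\<Sum>i\<le>k. real (k choose i) * A $ (k - i) * (fact (k - i) * fact i * (A ^ n) $ i * c)) = (\<Sum>i\<le>k. fact k * c * ((A ^ n) $ i * A $ (k - i)))"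
    by (intro sum.cong) auto
  also have "\<dots> = fact k * c * (A ^ n * A) $ k"
    by (simp add: fps_mult_nth sum_distrib_left atLeast0AtMost)
  finally show ?thesis by (simp add: mult_ac)
qed

section \<open>Angle and ultraspherical densities\<close>

lemma nn_integral_even:
  fixes h :: "real \<Rightarrow> ennreal"
  assumes [measurable]: "h \<in> borel_measurable borel" and even: "\<And>x. h (- x) = h x"
  shows "(\<integral>\<^sup>+x. h x \<partial>lborel) = 2 * (\<integral>\<^sup>+x. h x * indicator {0<..} x \<partial>lborel)"
proof -
  have "(\<integral>\<^sup>+x. h x \<partial>lborel) = (\<integral>\<^sup>+x. h x * indicator {0<..} x + h x * indicator {..<0} x \<partial>lborel)"
    by (intro nn_integral_cong_AE) (use AE_lborel_singleton[of 0] in eventually_elim, auto split: split_indicator)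
  also have "\<dots> = (\<integral>\<^sup>+x. h x * indicator {0<..} x \<partial>lborel) + (\<integral>\<^sup>+x. h x * indicator {..<0} x \<partial>lborel)"
    by (rule nn_integral_add) auto
  also have "(\<integral>\<^sup>+x. h x * indicator {..<0} x \<partial>lborel) =
      ennreal \<bar>-1\<bar> * (\<integral>\<^sup>+x. h (0 + (-1) * x) * indicator {..<0} (0 + (-1) * x) \<partial>lborel)"
    by (rule nn_integral_real_affine) auto
  also have "\<dots> = (\<integral>\<^sup>+x. h x * indicator {0<..} x \<partial>lborel)"
    by (auto simp: even intro!: nn_integral_cong split: split_indicator)
  finally show ?thesis by (simp add: mult_2)
qed

text \<open>For v > 0, a > 0 and |x| < a this equals Gamma(v) Gamma(v+1) / (2 pi Gamma(2v))
  (2/a)^(2v) (a^2 - x^2)^(v - 1/2) by the duplication formula. The form with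
  \<open>power_kernel\<close> vanishes by itself for |x| \<ge> a and also makes sense for -1/2 < v
  \<le> 0.\<close>

definition ultraspherical_density :: "real \<Rightarrow> real \<Rightarrow> real \<Rightarrow> real" where
  "ultraspherical_density v a x = Gamma (v + 1) / (sqrt pi * a powr (2 * v)) * power_kernel (v + 1/2) (a\<^sup>2 - x\<^sup>2)"

lemma ultraspherical_density_measurable [measurable]:
  "ultraspherical_density v a \<in> borel_measurable borel"
  unfolding ultraspherical_density_def by measurable

lemma ultraspherical_density_nonneg:
  "v > - 1/2 \<Longrightarrow> 0 \<le> ultraspherical_density v a x"
  unfolding ultraspherical_density_def using Gamma_real_pos[of "v+1"] power_kernel_nonneg[of "v+1/2"] by simp

text \<open>Kernels of orders 1/2 and v + 1/2 convolve at a^2 to the kernel of order v + 1. With u =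
  x^2 the first one becomes constant, and by evenness the convolution is the total mass up to the
  normalising constant.\<close>

lemma nn_integral_ultraspherical_density:
  assumes a: "a > 0" and v: "v > - 1/2"
  shows "(\<integral>\<^sup>+x. ennreal (ultraspherical_density v a x) \<partial>lborel) = 1"
proof -
  define K where "K = Gamma (v + 1) / (sqrt pi * a powr (2 * v))"
  have Gp: "Gamma (v + 1) > 0" using v by (intro Gamma_real_pos) simp
  have K: "K > 0" unfolding K_def using a Gp by simp
  have "ennreal (power_kernel (v + 1) (a\<^sup>2)) =
     (\<integral>\<^sup>+u. ennreal (power_kernel (1/2) u) * ennreal (power_kernel (v + 1/2) (a\<^sup>2 - u)) \<partial>lborel)"
    using power_kernel_convolution[of "1/2" "v+1/2" "a\<^sup>2"] v by (simp add: add.commute)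
  also have "\<dots> = (\<integral>\<^sup>+u. (ennreal (power_kernel (1/2) u) * ennreal (power_kernel (v + 1/2) (a\<^sup>2 - u))) * indicator {0<..} u \<partial>lborel)"
    by (intro nn_integral_cong) (auto simp: power_kernel_def split: split_indicator)
  also have "\<dots> = (\<integral>\<^sup>+x. (ennreal (power_kernel (1/2) (x\<^sup>2)) * ennreal (power_kernel (v + 1/2) (a\<^sup>2 - x\<^sup>2))) * ennreal (2 * x) * indicator {0<..} x \<partial>lborel)"
    by (rule nn_integral_substitution_square) measurable
  also have "\<dots> = (\<integral>\<^sup>+x. ennreal (2 / sqrt pi) * (ennreal (power_kernel (v + 1/2) (a\<^sup>2 - x\<^sup>2)) * indicator {0<..} x) \<partial>lborel)"
  proof (intro nn_integral_cong)
    fix x :: real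
    show "(ennreal (power_kernel (1/2) (x\<^sup>2)) * ennreal (power_kernel (v + 1/2) (a\<^sup>2 - x\<^sup>2))) * ennreal (2 * x) * indicator {0<..} x
       = ennreal (2 / sqrt pi) * (ennreal (power_kernel (v + 1/2) (a\<^sup>2 - x\<^sup>2)) * indicator {0<..} x)"
    proof (cases "x > 0")
      case True
      have "power_kernel (1/2) (x\<^sup>2) * (2 * x) = 2 / sqrt pi"
        by (rule power_kernel_half_square[OF True])
      then have "ennreal (power_kernel (1/2) (x\<^sup>2)) * ennreal (2 * x) = ennreal (2 / sqrt pi)"
        using True by (subst ennreal_mult[symmetric]) (auto intro: power_kernel_nonneg)
      then have "ennreal (power_kernel (1/2) (x\<^sup>2)) * y * ennreal (2 * x) = ennreal (2 / sqrt pi) * y" for y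
        by (metis mult.assoc mult.commute)
      then show ?thesis using True by simp
    qed auto
  qed
  also have "\<dots> = ennreal (2 / sqrt pi) * (\<integral>\<^sup>+x. ennreal (power_kernel (v + 1/2) (a\<^sup>2 - x\<^sup>2)) * indicator {0<..} x \<partial>lborel)"
    by (rule nn_integral_cmult) auto
  also have "ennreal (2 / sqrt pi) = ennreal (1 / sqrt pi) * 2"
    using ennreal_mult[of "1 / sqrt pi" 2] by simp
  also have "\<dots> * (\<integral>\<^sup>+x. ennreal (power_kernel (v + 1/2) (a\<^sup>2 - x\<^sup>2)) * indicator {0<..} x \<partial>lborel)
     = ennreal (1 / sqrt pi) * (\<integral>\<^sup>+x. ennreal (power_kernel (v + 1/2) (a\<^sup>2 - x\<^sup>2)) \<partial>lborel)"
    by (subst nn_integral_even) (auto simp: mult.assoc)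
  finally have *: "ennreal (power_kernel (v + 1) (a\<^sup>2)) = \<dots>" .
  have "(a\<^sup>2) powr v = a powr (2 * v)" using a by (subst powr_powr[symmetric]) (simp add: powr_numeral)
  then have p: "K * sqrt pi * power_kernel (v + 1) (a\<^sup>2) = 1"
    using a Gp by (auto simp: K_def power_kernel_def)
  have "(\<integral>\<^sup>+x. ennreal (ultraspherical_density v a x) \<partial>lborel) = (\<integral>\<^sup>+x. ennreal K * ennreal (power_kernel (v + 1/2) (a\<^sup>2 - x\<^sup>2)) \<partial>lborel)"
    unfolding ultraspherical_density_def K_def[symmetric] using K v
    by (simp add: ennreal_mult power_kernel_nonneg)
  also have "\<dots> = ennreal K * (\<integral>\<^sup>+x. ennreal (power_kernel (v + 1/2) (a\<^sup>2 - x\<^sup>2)) \<partial>lborel)"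
    by (rule nn_integral_cmult) auto
  also have "\<dots> = ennreal (K * sqrt pi) * (ennreal (1 / sqrt pi) * (\<integral>\<^sup>+x. ennreal (power_kernel (v + 1/2) (a\<^sup>2 - x\<^sup>2)) \<partial>lborel))"
    using K by (simp add: mult.assoc[symmetric] ennreal_mult[symmetric])
  also have "\<dots> = ennreal (K * sqrt pi * power_kernel (v + 1) (a\<^sup>2))"
    using K v by (subst *[symmetric]) (simp add: ennreal_mult power_kernel_nonneg)
  finally show ?thesis using p by simp
qed

lemma integrable_ultraspherical_moment:
  assumes a: "a > 0" and v: "v > - 1/2"
  shows "integrable lborel (\<lambda>x. ultraspherical_density v a x * x ^ k)"
proof (rule Bochner_Integration.integrable_bound)
  show "integrable lborel (\<lambda>x. ultraspherical_density v a x * a ^ k)"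
  proof (intro integrable_mult_left integrableI_nonneg)
    show "(\<integral>\<^sup>+x. ennreal (ultraspherical_density v a x) \<partial>lborel) < \<infinity>"
      by (simp add: nn_integral_ultraspherical_density[OF a v])
  qed (use ultraspherical_density_nonneg[OF v] in auto)
  have "norm (ultraspherical_density v a x * x ^ k) \<le> norm (ultraspherical_density v a x * a ^ k)" for x
  proof (cases "\<bar>x\<bar> < a")
    case True
    then have "\<bar>x\<bar> ^ k \<le> a ^ k" by (intro power_mono) auto
    then show ?thesis using a by (auto simp: abs_mult power_abs intro!: mult_left_mono)
  next
    case False
    then have "a\<^sup>2 - x\<^sup>2 \<le> 0" using a by (simp add: abs_le_square_iff[symmetric])
    then show ?thesis by (simp add: ultraspherical_density_def power_kernel_def)
  qed
  then show "AE x in lborel. norm (ultraspherical_density v a x * x ^ k) \<le> norm (ultraspherical_density v a x * a ^ k)" by simp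
qed simp

text \<open>The function x^j (a^2 - x^2)^(v + 1/2) vanishes at both ends of [-a, a]; integrating its
  derivative relates the moments of orders j - 1 and j + 1.\<close>

lemma ultraspherical_moment:
  assumes a: "a > 0" and v: "v > - 1/2"
  shows "(LINT x|lborel. ultraspherical_density v a x * x ^ k) = a ^ k * ultra_moment v k"
proof -
  define I where "I k = (LINT x|lborel. ultraspherical_density v a x * x ^ k)" for k
  define L where "L = Gamma (v + 1) / (sqrt pi * a powr (2 * v)) / Gamma (v + 1/2)"
  note int = integrable_ultraspherical_moment[OF a v]
  have q: "ultraspherical_density v a x = L * indicator {-a<..<a} x * (a\<^sup>2 - x\<^sup>2) powr (v - 1/2)" for x
  proof (cases "\<bar>x\<bar> < a")
    case True
    then have "x\<^sup>2 < a\<^sup>2" using abs_square_less_1 power_strict_mono[of "\<bar>x\<bar>" a 2] by simp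
    with True show ?thesis by (auto simp: ultraspherical_density_def power_kernel_def L_def indicator_def)
  next
    case False
    then have "a\<^sup>2 - x\<^sup>2 \<le> 0" using a by (simp add: abs_le_square_iff[symmetric])
    with False show ?thesis by (auto simp: ultraspherical_density_def power_kernel_def indicator_def)
  qed
  \<comment> \<open>For j = 0 the factor \<open>real j\<close> makes the truncated
    \<open>j - 1\<close> harmless; this case gives the vanishing first moment.\<close>
  have FTC: "real j * a\<^sup>2 * I (j - 1) = (real j + 2 * v + 1) * I (Suc j)" for j
  proof -
    define f where "f x = real j * x ^ (j - 1) * (a\<^sup>2 - x\<^sup>2) powr (v + 1/2) - x ^ j * ((v + 1/2) * (a\<^sup>2 - x\<^sup>2) powr (v - 1/2) * (2 * x))" for x
    have 1: "(f has_integral a ^ j * (a\<^sup>2 - a\<^sup>2) powr (v + 1/2) - (-a) ^ j * (a\<^sup>2 - (-a)\<^sup>2) powr (v + 1/2)) {-a..a}"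
    \<comment> \<open>For v < 1/2 the derivative may be unbounded at the ends; the interior form
      asks there only for continuity of the primitive, which holds since v + 1/2 > 0.\<close>
    proof (rule fundamental_theorem_of_calculus_interior)
      show "continuous_on {-a..a} (\<lambda>x. x ^ j * (a\<^sup>2 - x\<^sup>2) powr (v + 1/2))"
        using v by (auto intro!: continuous_intros continuous_on_powr' simp: abs_le_square_iff[symmetric])
      fix x assume "x \<in> {-a<..<a}"
      then have "\<bar>x\<bar> < a" by auto
      then have "x\<^sup>2 < a\<^sup>2" using power_strict_mono[of "\<bar>x\<bar>" a 2] by simp
      then show "((\<lambda>x. x ^ j * (a\<^sup>2 - x\<^sup>2) powr (v + 1/2)) has_vector_derivative f x) (at x)"
        unfolding f_def has_real_derivative_iff_has_vector_derivative[symmetric]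
        by (auto intro!: derivative_eq_intros simp: powr_diff powr_add field_simps)
    qed (use a in auto)
    define h where "h x = L * f x * indicator {-a<..<a} x" for x
    have h: "h x = ultraspherical_density v a x * x ^ (j - 1) * (real j * a\<^sup>2) - ultraspherical_density v a x * x ^ Suc j * (real j + 2 * v + 1)" for x
    proof (cases "x \<in> {-a<..<a}")
      case True
      then have "\<bar>x\<bar> < a" by auto
      then have "x\<^sup>2 < a\<^sup>2" using power_strict_mono[of "\<bar>x\<bar>" a 2] by simp
      then have p: "(a\<^sup>2 - x\<^sup>2) powr (v + 1/2) = (a\<^sup>2 - x\<^sup>2) powr (v - 1/2) * (a\<^sup>2 - x\<^sup>2)"
        using powr_add[of "a\<^sup>2 - x\<^sup>2" "v - 1/2" 1] by (simp add: add.commute)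
      have "real j * x ^ (j - 1) * x\<^sup>2 = real j * x ^ Suc j"
        by (cases j) (auto simp: power2_eq_square)
      moreover have "L * (r * A * (w * (aa - xx)) - B * ((v + 1/2) * w * (2 * x))) = L * w * A * (r * aa) - L * w * (x * B) * (r + 2 * v + 1)"
        if "r * A * xx = r * (x * B)" for r A B w aa xx
      proof -
        have Q: "(v + 1/2) * w * (2 * x) = (2 * v + 1) * w * x" by (simp add: algebra_simps)
        have "L * (r * A * (w * (aa - xx)) - B * ((v + 1/2) * w * (2 * x))) =
            L * w * A * (r * aa) - L * w * (r * A * xx) - L * B * ((2 * v + 1) * w * x)"
          unfolding Q by (simp add: algebra_simps)
        then show ?thesis unfolding that by (simp add: algebra_simps)
      qed
      ultimately show ?thesis using True unfolding h_def f_def q p power_Suc by (simp only: indicator_simps mult_1_right)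
    qed (simp add: h_def q)
    have inth: "integrable lborel h" unfolding h
      by (intro Bochner_Integration.integrable_diff integrable_mult_left int)
    have "(h has_integral (LINT x|lborel. h x)) UNIV"
      by (rule has_integral_integral_lborel[OF inth])
    moreover have "(h has_integral L * 0) UNIV"
    proof -
      have "((\<lambda>x. L * f x) has_integral L * 0) {-a..a}"
        using has_integral_mult_right[OF 1, of L] v by simp
      then have "((\<lambda>x. L * f x) has_integral L * 0) {-a<..<a}"
        by (simp add: has_integral_Icc_iff_Ioo)
      then have "((\<lambda>x. if x \<in> {-a<..<a} then L * f x else 0) has_integral L * 0) UNIV"
        by (subst has_integral_restrict_UNIV)
      moreover have "(\<lambda>x. if x \<in> {-a<..<a} then L * f x else 0) = h"
        by (auto simp: h_def)
      ultimately show ?thesis by simp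
    qed
    ultimately have "(LINT x|lborel. h x) = L * 0" by (rule has_integral_unique)
    then have "(LINT x|lborel. h x) = 0" by simp
    moreover have "(LINT x|lborel. h x) = I (j - 1) * (real j * a\<^sup>2) - I (Suc j) * (real j + 2 * v + 1)"
      unfolding h I_def
      by (subst Bochner_Integration.integral_diff) (auto intro!: integrable_mult_left int simp del: power_Suc)
    ultimately show ?thesis by (simp add: algebra_simps)
  qed
  have "I k / a ^ k = ultra_moment v k"
  proof (rule ultra_moment_unique)
    have "I 0 = 1" unfolding I_def using nn_integral_ultraspherical_density[OF a v] ultraspherical_density_nonneg[OF v]
      by (subst integral_eq_nn_integral) auto
    then show "I 0 / a ^ 0 = 1" by simp
    show "I (Suc 0) / a ^ Suc 0 = 0" using FTC[of 0] v by simp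
    show "(real k + 2 * v + 2) * (I (Suc (Suc k)) / a ^ Suc (Suc k)) = (real k + 1) * (I k / a ^ k)" for k
    proof -
      have e: "(real k + 2 * v + 2) * I (Suc (Suc k)) = (real k + 1) * a\<^sup>2 * I k"
        using FTC[of "Suc k"] by (simp add: algebra_simps)
      show ?thesis unfolding times_divide_eq_right e using a by (simp add: power2_eq_square)
    qed
  qed (use v in simp)
  then show ?thesis using a by (simp add: I_def field_simps)
qed

text \<open>Here the primitive is cos^j sin^(2m+1), which vanishes at 0 and at pi. The recursion is
  that of the ultraspherical law with index v = m.\<close>

lemma angle_density_moment:
  assumes "prob_space M" and D: "distributed M lborel X (\<lambda>x. ennreal (angle_density m x))"
  shows "prob_space.expectation M (\<lambda>\<omega>. cos (X \<omega>) ^ k) = ultra_moment (real m) k"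
proof -
  interpret prob_space M by fact
  define C where "C = Gamma (real m + 1) / (sqrt pi * Gamma (real m + 1/2))"
  have nn: "0 \<le> angle_density m x" for x
    using Gamma_real_pos[of "real m + 1"] Gamma_real_pos[of "real m + 1/2"] by (simp add: angle_density_def)
  have [measurable]: "angle_density m \<in> borel_measurable borel" unfolding angle_density_def by measurable
  define J where "J k = (LINT x|lborel. (cos x ^ k * sin x ^ (2 * m)) * indicator {0..pi} x)" for k
  have E: "expectation (\<lambda>\<omega>. cos (X \<omega>) ^ k) = C * J k" for k
  proof -
    have "expectation (\<lambda>\<omega>. cos (X \<omega>) ^ k) = (LINT x|lborel. angle_density m x * cos x ^ k)"
      by (rule distributed_integral[OF D, symmetric]) (auto intro: nn)
    also have "\<dots> = (LINT x|lborel. C * ((cos x ^ k * sin x ^ (2 * m)) * indicator {0..pi} x))"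
    proof (rule integral_cong_AE)
      show "AE x in lborel. angle_density m x * cos x ^ k = C * ((cos x ^ k * sin x ^ (2 * m)) * indicator {0..pi} x)"
        using AE_lborel_singleton[of 0] AE_lborel_singleton[of pi]
        by eventually_elim (auto simp: angle_density_def C_def split: split_indicator)
    qed auto
    finally show ?thesis by (simp add: J_def)
  qed
  have I: "integrable lborel (\<lambda>x. (cos x ^ k * sin x ^ (2 * m)) * indicator {0..pi} x)" for k
    using borel_integrable_atLeastAtMost'[of 0 pi "\<lambda>x. cos x ^ k * sin x ^ (2 * m)"]
    by (simp add: set_integrable_def continuous_intros mult.commute)
  have FTC: "real j * J (j - 1) = (real j + 2 * real m + 1) * J (Suc j)" for j
  proof -
    define f where "f x = (2 * real m + 1) * cos x ^ Suc j * sin x ^ (2 * m) - real j * cos x ^ (j - 1) * sin x ^ (2 * m + 2)" for x :: real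
    have "(LINT x|lborel. f x * indicator {0..pi} x) = cos pi ^ j * sin pi ^ Suc (2 * m) - cos 0 ^ j * sin 0 ^ Suc (2 * m)"
    proof (rule integral_FTC_Icc_real)
      show "((\<lambda>x. cos x ^ j * sin x ^ Suc (2 * m)) has_real_derivative f x) (at x)" for x
        unfolding f_def by (rule derivative_eq_intros refl)+ (simp add: algebra_simps)
      show "isCont f x" for x unfolding f_def by (intro continuous_intros)
    qed auto
    also have "\<dots> = 0" by simp
    finally have "0 = (LINT x|lborel. f x * indicator {0..pi} x)" by simp
    also have "(\<lambda>x. f x * indicator {0..pi} x) = (\<lambda>x. (real j + 2 * real m + 1) * ((cos x ^ Suc j * sin x ^ (2 * m)) * indicator {0..pi} x)
        - real j * ((cos x ^ (j - 1) * sin x ^ (2 * m)) * indicator {0..pi} x))"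
    proof
      fix x :: real
      have "real j * cos x ^ (j - 1) * sin x ^ (2 * m + 2) = (real j * cos x ^ (j - 1)) * sin x ^ (2 * m) * (1 - (cos x)\<^sup>2)"
        unfolding power_add sin_squared_eq by (simp only: mult.assoc)
      also have "\<dots> = real j * cos x ^ (j - 1) * sin x ^ (2 * m) - real j * cos x ^ Suc j * sin x ^ (2 * m)"
        by (cases j) (auto simp: algebra_simps power2_eq_square)
      finally have e: "real j * cos x ^ (j - 1) * sin x ^ (2 * m + 2) = \<dots>" .
      show "f x * indicator {0..pi} x = (real j + 2 * real m + 1) * ((cos x ^ Suc j * sin x ^ (2 * m)) * indicator {0..pi} x)
        - real j * ((cos x ^ (j - 1) * sin x ^ (2 * m)) * indicator {0..pi} x)"
        unfolding f_def e by (simp add: algebra_simps)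
    qed
    also have "(LINT x|lborel. (real j + 2 * real m + 1) * ((cos x ^ Suc j * sin x ^ (2 * m)) * indicator {0..pi} x)
        - real j * ((cos x ^ (j - 1) * sin x ^ (2 * m)) * indicator {0..pi} x)) = (real j + 2 * real m + 1) * J (Suc j) - real j * J (j - 1)"
      unfolding J_def by (subst Bochner_Integration.integral_diff) (use I in \<open>auto simp del: power_Suc\<close>)
    finally show ?thesis by simp
  qed
  show ?thesis unfolding E
  proof (rule ultra_moment_unique)
    \<comment> \<open>Total probability supplies the normalisation, so the integral of sin^(2m) need
      not be evaluated.\<close>
    show "C * J 0 = 1" using E[of 0] by (simp add: prob_space)
    show "C * J (Suc 0) = 0" using FTC[of 0] by simp
    show "(real k + 2 * real m + 2) * (C * J (Suc (Suc k))) = (real k + 1) * (C * J k)" for k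
      using FTC[of "Suc k"] by (simp add: algebra_simps)
  qed simp
qed

section \<open>Moments, convolution and independence\<close>

text \<open>On a bounded support the Taylor polynomials of the characteristic function at 0 converge
  to it, with error at most 2 (|t| a)^n / n!, and they involve the moments alone.\<close>

lemma real_distribution_eqI_moments:
  assumes "real_distribution M1" "real_distribution M2"
    and b1: "AE x in M1. \<bar>x\<bar> \<le> a" and b2: "AE x in M2. \<bar>x\<bar> \<le> a"
    and eq: "\<And>k. (LINT x|M1. x ^ k) = (LINT x|M2. x ^ k)"
  shows "M1 = M2"
proof (rule Levy_uniqueness)
  show "char M1 = char M2"
  proof
    fix t :: real
    define P where "P n = (\<Sum>k \<le> n. ((\<i> * t)^k / fact k) * (LINT x|M1. x ^ k))" for n
    have *: "P \<longlonglongrightarrow> char N t" if N: "real_distribution N" and b: "AE x in N. \<bar>x\<bar> \<le> a"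
      and e: "\<And>k. (LINT x|M1. x ^ k) = (LINT x|N. x ^ k)" for N
    proof -
      interpret N: real_distribution N by fact
      have m: "AE x in N. norm (x ^ k) \<le> a ^ k" for k
        using b by eventually_elim (simp add: power_abs power_mono)
      have int: "integrable N (\<lambda>x. x ^ k)" for k
        by (rule N.integrable_const_bound[OF m]) simp
      have bd: "norm (P n - char N t) \<le> 2 * ((\<bar>t\<bar> * a) ^ n / fact n)" for n
      proof -
        have "(LINT x|N. \<bar>x\<bar> ^ n) \<le> a ^ n"
        proof -
          have "(LINT x|N. \<bar>x\<bar> ^ n) \<le> (LINT x|N. a ^ n)"
            by (rule integral_mono_AE) (use m[of n] int[of n] in \<open>auto simp: power_abs[symmetric]\<close>)
          then show ?thesis using N.prob_space by simp
        qed
        then have "(2*\<bar>t\<bar>^n / fact n) * (LINT x|N. \<bar>x\<bar> ^ n) \<le> (2*\<bar>t\<bar>^n / fact n) * a ^ n"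
          by (intro mult_left_mono) auto
        moreover have "norm (char N t - P n) \<le> (2*\<bar>t\<bar>^n / fact n) * (LINT x|N. \<bar>x\<bar> ^ n)"
          unfolding P_def e by (rule N.char_approx1) (rule int)
        ultimately show ?thesis by (simp add: norm_minus_commute power_mult_distrib)
      qed
      have "(\<lambda>n. 2 * ((\<bar>t\<bar> * a) ^ n / fact n)) \<longlonglongrightarrow> 2 * 0"
      proof (rule tendsto_mult[OF tendsto_const])
        show "(\<lambda>n. (\<bar>t\<bar> * a) ^ n / fact n) \<longlonglongrightarrow> 0"
          using summable_LIMSEQ_zero[OF summable_exp[of "\<bar>t\<bar> * a"]]
          unfolding divide_inverse mult.commute[of "inverse (fact n)" for n] .
      qed
      then have "(\<lambda>n. P n - char N t) \<longlonglongrightarrow> 0"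
        unfolding mult_zero_right by (rule Lim_null_comparison[OF always_eventually[OF allI[OF bd]]])
      then show ?thesis by (simp add: LIM_zero_iff)
    qed
    show "char M1 t = char M2 t"
      by (rule LIMSEQ_unique[OF *[OF assms(1) b1 refl] *[OF assms(2) b2 eq]])
  qed
qed fact+

text \<open>Fubini for a signed g followed by the semigroup law. Power kernels are not integrable at
  infinity, which is why g has to vanish beyond s.\<close>

lemma power_kernel_convolution_integral:
  fixes g :: "real \<Rightarrow> real"
  assumes [measurable]: "g \<in> borel_measurable borel" and g: "\<And>z. \<bar>g z\<bar> \<le> K" "\<And>z. z > s \<Longrightarrow> g z = 0"
    and a: "a > 0" and b: "b > 0"
  shows "(LINT u|lborel. (LINT t|lborel. g (u + t) * power_kernel a t) * power_kernel b u) =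
      (LINT z|lborel. g z * power_kernel (b + a) z)"
proof -
  note nn = power_kernel_nonneg[OF a] power_kernel_nonneg[OF b]
  have cv: "(\<integral>\<^sup>+u. ennreal (power_kernel b u * power_kernel a (z - u)) \<partial>lborel) = ennreal (power_kernel (b + a) z)" for z
    using power_kernel_convolution[OF b a, of z] by (simp add: ennreal_mult nn)
  have K0: "0 \<le> K" using g(1)[of 0] by linarith
  have m [measurable]: "(\<lambda>(z, u). g z * power_kernel a (z - u) * power_kernel b u) \<in> borel_measurable (lborel \<Otimes>\<^sub>M lborel)"
    by measurable
  have int: "integrable (lborel \<Otimes>\<^sub>M lborel) (\<lambda>(z, u). g z * power_kernel a (z - u) * power_kernel b u)"
  proof (rule integrableI_bounded)
    have "(\<integral>\<^sup>+x. ennreal (norm (case x of (z, u) \<Rightarrow> g z * power_kernel a (z - u) * power_kernel b u)) \<partial>(lborel \<Otimes>\<^sub>M lborel))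
      = (\<integral>\<^sup>+z. \<integral>\<^sup>+u. ennreal \<bar>g z\<bar> * ennreal (power_kernel b u * power_kernel a (z - u)) \<partial>lborel \<partial>lborel)"
      by (subst lborel.nn_integral_fst[symmetric])
         (auto simp: abs_mult ennreal_mult nn split_beta' ac_simps intro!: nn_integral_cong)
    also have "\<dots> = (\<integral>\<^sup>+z. ennreal \<bar>g z\<bar> * ennreal (power_kernel (b + a) z) \<partial>lborel)"
      by (subst nn_integral_cmult) (auto simp: cv)
    also have "\<dots> \<le> (\<integral>\<^sup>+z. ennreal K * (ennreal (power_kernel (b + a) z * indicator {..s} z)) \<partial>lborel)"
      using g K0 by (intro nn_integral_mono)
        (auto split: split_indicator intro!: mult_right_mono ennreal_leI simp: not_le)
    also have "\<dots> = ennreal K * (\<integral>\<^sup>+z. (ennreal (power_kernel (b + a) z * indicator {..s} z)) \<partial>lborel)"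
      by (rule nn_integral_cmult) measurable
    \<comment> \<open>The kernel of order 1 is constant on the positive axis. Evaluated at s + 1 - z
      it dominates the cut-off at s, so the semigroup law bounds the truncated integral.\<close>
    also have "\<dots> \<le> ennreal K * (\<integral>\<^sup>+z. ennreal (Gamma 1) * (ennreal (power_kernel (b + a) z) * ennreal (power_kernel 1 (s + 1 - z))) \<partial>lborel)"
      by (intro mult_left_mono nn_integral_mono) (auto simp: power_kernel_def split: split_indicator)
    also have "\<dots> = ennreal K * ennreal (power_kernel (b + a + 1) (s + 1))"
      using a b by (simp add: power_kernel_convolution)
    also have "\<dots> < \<infinity>" by (simp add: ennreal_mult_less_top)
    finally show "(\<integral>\<^sup>+x. ennreal (norm (case x of (z, u) \<Rightarrow> g z * power_kernel a (z - u) * power_kernel b u)) \<partial>(lborel \<Otimes>\<^sub>M lborel)) < \<infinity>" .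
  qed (rule m)
  have "(LINT u|lborel. (LINT t|lborel. g (u + t) * power_kernel a t) * power_kernel b u)
     = (LINT u|lborel. (LINT z|lborel. g z * power_kernel a (z - u) * power_kernel b u))"
  proof (rule Bochner_Integration.integral_cong[OF refl])
    fix u
    have "(LINT z|lborel. g z * power_kernel a (z - u)) = \<bar>1\<bar> *\<^sub>R (LINT t|lborel. g (u + 1 * t) * power_kernel a (u + 1 * t - u))"
      by (rule lborel_integral_real_affine) simp
    then show "(LINT t|lborel. g (u + t) * power_kernel a t) * power_kernel b u = (LINT z|lborel. g z * power_kernel a (z - u) * power_kernel b u)"
      by simp
  qed
  also have "\<dots> = (LINT z|lborel. (LINT u|lborel. g z * power_kernel a (z - u) * power_kernel b u))"
    by (rule lborel_pair.Fubini_integral[OF int])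
  also have "\<dots> = (LINT z|lborel. g z * power_kernel (b + a) z)"
  proof (rule Bochner_Integration.integral_cong[OF refl])
    fix z
    have "(LINT u|lborel. power_kernel b u * power_kernel a (z - u)) = power_kernel (b + a) z"
      using a b by (subst integral_eq_nn_integral) (auto simp: cv nn power_kernel_nonneg)
    then show "(LINT u|lborel. g z * power_kernel a (z - u) * power_kernel b u) = g z * power_kernel (b + a) z"
      by (simp add: mult.assoc mult.commute[of "power_kernel b _"])
  qed
  finally show ?thesis .
qed

text \<open>A finite intersection of events splits into its \<open>Inl\<close> and
  \<open>Inr\<close> parts, which lie in V and W; independence of these \<sigma>-algebras separates
  the parts, and independence within each family does the rest. V and W may be larger than what X
  and Y generate, so the gaps can be tested in the \<sigma>-algebra of the event times.\<close>

lemma (in prob_space) indep_vars_case_sum: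
  assumes X: "indep_vars (\<lambda>_. N) X I" and Y: "indep_vars (\<lambda>_. N) Y J"
    and V: "space V = space M" "space W = space M"
    and mX: "\<And>i. i \<in> I \<Longrightarrow> X i \<in> measurable V N" and mY: "\<And>j. j \<in> J \<Longrightarrow> Y j \<in> measurable W N"
    and indep: "indep_set (sets V) (sets W)"
  shows "indep_vars (\<lambda>_. N) (case_sum X Y) (I <+> J)"
  unfolding indep_vars_def2
proof (intro conjI ballI indep_setsI)
  show "random_variable N (case_sum X Y i)" if "i \<in> I <+> J" for i
    using that X Y unfolding indep_vars_def2 by auto
  then show "{case_sum X Y i -` A \<inter> space M |A. A \<in> sets N} \<subseteq> events" if "i \<in> I <+> J" for i
    using that by (auto intro: measurable_sets)
  fix A K assume K: "K \<noteq> {}" "K \<subseteq> I <+> J" "finite K"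
    and A: "\<forall>j\<in>K. A j \<in> {case_sum X Y j -` A \<inter> space M |A. A \<in> sets N}"
  then obtain B where B: "\<And>k. k \<in> K \<Longrightarrow> B k \<in> sets N" "\<And>k. k \<in> K \<Longrightarrow> A k = case_sum X Y k -` B k \<inter> space M"
    by simp metis
  define K1 K2 where "K1 = Inl -` K" and "K2 = Inr -` K"
  have K12: "K1 \<subseteq> I" "K2 \<subseteq> J" "finite K1" "finite K2" using K
    by (auto simp: K1_def K2_def intro!: finite_vimageI)
  have KE: "K = Inl ` K1 \<union> Inr ` K2"
    by (auto simp: K1_def K2_def image_iff) (metis sum.exhaust)
  define U where "U = {\<omega>\<in>space M. \<forall>i\<in>K1. X i \<omega> \<in> B (Inl i)}"
  define U' where "U' = {\<omega>\<in>space M. \<forall>i\<in>K2. Y i \<omega> \<in> B (Inr i)}"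
  have "(\<Inter>j\<in>K. A j) = U \<inter> U'"
    unfolding U_def U'_def using K(1) by (auto simp: KE B(2) ball_Un)
  moreover have "U \<in> sets V"
  proof -
    have [measurable]: "\<And>i. i \<in> K1 \<Longrightarrow> X i \<in> measurable V N" "\<And>i. i \<in> K1 \<Longrightarrow> B (Inl i) \<in> sets N"
      using mX K12 B by (auto simp: K1_def)
    show ?thesis unfolding U_def V(1)[symmetric] using K12(3) by measurable
  qed
  moreover have "U' \<in> sets W"
  proof -
    have [measurable]: "\<And>i. i \<in> K2 \<Longrightarrow> Y i \<in> measurable W N" "\<And>i. i \<in> K2 \<Longrightarrow> B (Inr i) \<in> sets N"
      using mY K12 B by (auto simp: K2_def)
    show ?thesis unfolding U'_def V(2)[symmetric] using K12(4) by measurable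
  qed
  ultimately have 1: "prob (\<Inter>j\<in>K. A j) = prob U * prob U'"
    using indep by (simp add: indep_setD)
  have 2: "prob U = (\<Prod>i\<in>K1. prob (A (Inl i)))"
  proof (cases "K1 = {}")
    case False
    have "U = (\<Inter>i\<in>K1. X i -` B (Inl i) \<inter> space M)" using False by (auto simp: U_def)
    also have "prob \<dots> = (\<Prod>i\<in>K1. prob (X i -` B (Inl i) \<inter> space M))"
      by (rule indep_varsD[OF X False]) (use K12 B in \<open>auto simp: K1_def\<close>)
    also have "\<dots> = (\<Prod>i\<in>K1. prob (A (Inl i)))" by (rule prod.cong) (use B in \<open>auto simp: K1_def\<close>)
    finally show ?thesis .
  qed (simp add: U_def prob_space)
  have 3: "prob U' = (\<Prod>i\<in>K2. prob (A (Inr i)))"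
  proof (cases "K2 = {}")
    case False
    have "U' = (\<Inter>i\<in>K2. Y i -` B (Inr i) \<inter> space M)" using False by (auto simp: U'_def)
    also have "prob \<dots> = (\<Prod>i\<in>K2. prob (Y i -` B (Inr i) \<inter> space M))"
      by (rule indep_varsD[OF Y False]) (use K12 B in \<open>auto simp: K2_def\<close>)
    also have "\<dots> = (\<Prod>i\<in>K2. prob (A (Inr i)))" by (rule prod.cong) (use B in \<open>auto simp: K2_def\<close>)
    finally show ?thesis .
  qed (simp add: U'_def prob_space)
  have "(\<Prod>j\<in>K. prob (A j)) = (\<Prod>i\<in>K1. prob (A (Inl i))) * (\<Prod>i\<in>K2. prob (A (Inr i)))"
    unfolding KE using K12 by (subst prod.union_disjoint) (auto simp: prod.reindex)
  then show "prob (\<Inter>j\<in>K. A j) = (\<Prod>j\<in>K. prob (A j))" using 1 2 3 by simp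
qed

section \<open>Random flights\<close>

text \<open>Puts independence as an identity between a product measure and a joint law, the form in
  which Fubini integrates one variable out.\<close>

lemma (in prob_space) indep_var_distr_pair:
  assumes ind: "indep_var N1 X N2 Y" and [measurable]: "f \<in> measurable N1 L1" "g \<in> measurable N2 L2"
  shows "distr M L1 (\<lambda>\<omega>. f (X \<omega>)) \<Otimes>\<^sub>M distr M L2 (\<lambda>\<omega>. g (Y \<omega>)) = distr M (L1 \<Otimes>\<^sub>M L2) (\<lambda>\<omega>. (f (X \<omega>), g (Y \<omega>)))"
proof -
  have [measurable]: "X \<in> measurable M N1" "Y \<in> measurable M N2"
    using ind by (auto dest: indep_var_rv1 indep_var_rv2)
  have "prob_space (distr (distr M N2 Y) L2 g)"
    by (intro prob_space.prob_space_distr prob_space_distr) auto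
  then interpret D: prob_space "distr (distr M N2 Y) L2 g" .
  have "distr M L1 (\<lambda>\<omega>. f (X \<omega>)) \<Otimes>\<^sub>M distr M L2 (\<lambda>\<omega>. g (Y \<omega>)) =
      distr (distr M N1 X) L1 f \<Otimes>\<^sub>M distr (distr M N2 Y) L2 g"
    by (simp add: distr_distr comp_def)
  also have "\<dots> = distr (distr M N1 X \<Otimes>\<^sub>M distr M N2 Y) (L1 \<Otimes>\<^sub>M L2) (\<lambda>(x, y). (f x, g y))"
    by (rule pair_measure_distr) (auto intro: D.sigma_finite_measure_axioms)
  also have "distr M N1 X \<Otimes>\<^sub>M distr M N2 Y = distr M (N1 \<Otimes>\<^sub>M N2) (\<lambda>\<omega>. (X \<omega>, Y \<omega>))"
    using ind unfolding indep_var_distribution_eq by simp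
  finally show ?thesis by (simp add: distr_distr comp_def)
qed

text \<open>Measurability is not asked for: the integral of a nonintegrable function is 0 by
  convention, and K is nonnegative because it bounds an absolute value.\<close>

lemma (in prob_space) expectation_bound:
  fixes f :: "'a \<Rightarrow> real"
  assumes "\<And>\<omega>. \<bar>f \<omega>\<bar> \<le> K"
  shows "\<bar>expectation f\<bar> \<le> K"
proof (cases "integrable M f")
  case True
  have "\<bar>expectation f\<bar> \<le> expectation (\<lambda>\<omega>. \<bar>f \<omega>\<bar>)" by (rule integral_abs_bound)
  also have "\<dots> \<le> expectation (\<lambda>_. K)" using True assms by (intro integral_mono) auto
  finally show ?thesis by (simp add: prob_space)
next
  case False
  then show ?thesis using assms[of undefined] by (simp add: not_integrable_integral_eq)
qed

text \<open>Fubini for the pair (U, V) against an independent \<tau>. The integrand is bounded: F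
  vanishes for U > s, and otherwise |V| \<le> U bounds the power of V by |s|^i.\<close>

lemma (in prob_space) expectation_indep_kernel:
  fixes U V \<tau> :: "'a \<Rightarrow> real"
  assumes ind: "distr M (borel \<Otimes>\<^sub>M borel) (\<lambda>\<omega>. (U \<omega>, V \<omega>)) \<Otimes>\<^sub>M distr M borel \<tau> =
      distr M ((borel \<Otimes>\<^sub>M borel) \<Otimes>\<^sub>M borel) (\<lambda>\<omega>. ((U \<omega>, V \<omega>), \<tau> \<omega>))"
    and [measurable]: "U \<in> borel_measurable M" "V \<in> borel_measurable M" "\<tau> \<in> borel_measurable M"
    and F [measurable]: "F \<in> borel_measurable (borel \<Otimes>\<^sub>M borel)"
    and bound: "\<And>u t. \<bar>F (u, t)\<bar> \<le> K" and supp: "\<And>u t. u > s \<Longrightarrow> F (u, t) = 0"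
    and V: "AE \<omega> in M. \<bar>V \<omega>\<bar> \<le> U \<omega>"
  shows "expectation (\<lambda>\<omega>. F (U \<omega>, \<tau> \<omega>) * V \<omega> ^ i)
      = expectation (\<lambda>\<omega>. expectation (\<lambda>\<omega>'. F (U \<omega>, \<tau> \<omega>')) * V \<omega> ^ i)"
    and "integrable M (\<lambda>\<omega>. F (U \<omega>, \<tau> \<omega>) * V \<omega> ^ i)"
proof -
  have K: "K \<ge> 0" using bound[of 0 0] by linarith
  show int: "integrable M (\<lambda>\<omega>. F (U \<omega>, \<tau> \<omega>) * V \<omega> ^ i)"
  proof (rule integrable_const_bound)
    show "AE \<omega> in M. norm (F (U \<omega>, \<tau> \<omega>) * V \<omega> ^ i) \<le> K * \<bar>s\<bar> ^ i"
      using V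
    proof eventually_elim
      case (elim \<omega>)
      show ?case
      proof (cases "U \<omega> > s")
        case False
        then have "\<bar>V \<omega>\<bar> ^ i \<le> \<bar>s\<bar> ^ i" using elim by (intro power_mono) auto
        then show ?thesis using bound K by (auto simp: abs_mult power_abs intro!: mult_mono)
      qed (use K supp in auto)
    qed
  qed measurable
  let ?D = "distr M (borel \<Otimes>\<^sub>M borel) (\<lambda>\<omega>. (U \<omega>, V \<omega>))" and ?T = "distr M borel \<tau>"
  interpret D: prob_space ?D by (rule prob_space_distr) measurable
  interpret T: prob_space ?T by (rule prob_space_distr) measurable
  interpret DT: pair_sigma_finite ?D ?T ..
  define f where "f = (\<lambda>p. F (fst (fst p), snd p) * snd (fst p) ^ i :: real)"
  have [measurable]: "f \<in> borel_measurable ((borel \<Otimes>\<^sub>M borel) \<Otimes>\<^sub>M borel)" unfolding f_def by measurable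
  have intf: "integrable (?D \<Otimes>\<^sub>M ?T) f"
    unfolding ind using int by (subst integrable_distr_eq) (auto simp: f_def)
  have "expectation (\<lambda>\<omega>. F (U \<omega>, \<tau> \<omega>) * V \<omega> ^ i) = (LINT p|(?D \<Otimes>\<^sub>M ?T). f p)"
    unfolding ind by (subst integral_distr) (auto simp: f_def)
  also have "\<dots> = (LINT x|?D. LINT y|?T. f (x, y))"
    using DT.integral_fst'[OF intf] by simp
  also have "\<dots> = (LINT x|?D. expectation (\<lambda>\<omega>'. F (fst x, \<tau> \<omega>')) * snd x ^ i)"
    by (rule Bochner_Integration.integral_cong[OF refl], subst integral_distr) (auto simp: f_def)
  also have "\<dots> = expectation (\<lambda>\<omega>. expectation (\<lambda>\<omega>'. F (U \<omega>, \<tau> \<omega>')) * V \<omega> ^ i)"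
    by (subst integral_distr) auto
  finally show "expectation (\<lambda>\<omega>. F (U \<omega>, \<tau> \<omega>) * V \<omega> ^ i)
      = expectation (\<lambda>\<omega>. expectation (\<lambda>\<omega>'. F (U \<omega>, \<tau> \<omega>')) * V \<omega> ^ i)" .
qed

text \<open>Models one further displacement: U and V are the time and position so far, H is its
  length and G a weight. After the binomial expansion the powers of cos \<theta> factor out by
  independence, and \<tau> is integrated out. A length depending on (U, \<tau>) covers both a full
  gap and the last piece, cut off at a fixed time.\<close>

lemma (in prob_space) expectation_indep_step:
  fixes U V \<tau> \<theta> :: "'a \<Rightarrow> real" and G H :: "real \<times> real \<Rightarrow> real"
  assumes ind: "\<And>f g. f \<in> borel_measurable ((borel \<Otimes>\<^sub>M borel) \<Otimes>\<^sub>M borel) \<Longrightarrow> g \<in> borel_measurable borel \<Longrightarrow>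
        indep_var borel (\<lambda>\<omega>. f ((U \<omega>, V \<omega>), \<tau> \<omega>) :: real) borel (\<lambda>\<omega>. g (\<theta> \<omega>))"
    and ind': "distr M (borel \<Otimes>\<^sub>M borel) (\<lambda>\<omega>. (U \<omega>, V \<omega>)) \<Otimes>\<^sub>M distr M borel \<tau> =
      distr M ((borel \<Otimes>\<^sub>M borel) \<Otimes>\<^sub>M borel) (\<lambda>\<omega>. ((U \<omega>, V \<omega>), \<tau> \<omega>))"
    and [measurable]: "U \<in> borel_measurable M" "V \<in> borel_measurable M" "\<tau> \<in> borel_measurable M" "\<theta> \<in> borel_measurable M"
    and [measurable]: "G \<in> borel_measurable (borel \<Otimes>\<^sub>M borel)" "H \<in> borel_measurable (borel \<Otimes>\<^sub>M borel)"
    and bound: "\<And>p. \<bar>G p\<bar> \<le> K"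
    and supp: "\<And>u t. G (u, t) \<noteq> 0 \<Longrightarrow> u \<le> s \<and> \<bar>H (u, t)\<bar> \<le> s"
    and V: "AE \<omega> in M. \<bar>V \<omega>\<bar> \<le> U \<omega>"
  shows "expectation (\<lambda>\<omega>. G (U \<omega>, \<tau> \<omega>) * (V \<omega> + H (U \<omega>, \<tau> \<omega>) * cos (\<theta> \<omega>)) ^ k)
    = (\<Sum>i\<le>k. real (k choose i) * expectation (\<lambda>\<omega>. cos (\<theta> \<omega>) ^ (k - i)) *
         expectation (\<lambda>\<omega>. expectation (\<lambda>\<omega>'. G (U \<omega>, \<tau> \<omega>') * H (U \<omega>, \<tau> \<omega>') ^ (k - i)) * V \<omega> ^ i))"
proof -
  have K: "K \<ge> 0" using bound[of "(0,0)"] by linarith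
  define F where "F j p = G p * H p ^ j" for j p
  have [measurable]: "F j \<in> borel_measurable (borel \<Otimes>\<^sub>M borel)" for j
    unfolding F_def by measurable
  have Fb: "\<bar>F j (u, t)\<bar> \<le> K * \<bar>s\<bar> ^ j" for j u t
  proof (cases "G (u, t) = 0")
    case False
    then have "\<bar>H (u, t)\<bar> \<le> s" using supp by auto
    then have "\<bar>H (u, t)\<bar> ^ j \<le> \<bar>s\<bar> ^ j" by (intro power_mono) auto
    then show ?thesis unfolding F_def using bound K by (auto simp: abs_mult power_abs intro!: mult_mono)
  qed (use K in \<open>auto simp: F_def\<close>)
  have Fs: "F j (u, t) = 0" if "u > s" for j u t
    using supp[of u t] that unfolding F_def by force
  have ker: "expectation (\<lambda>\<omega>. F j (U \<omega>, \<tau> \<omega>) * V \<omega> ^ i)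
      = expectation (\<lambda>\<omega>. expectation (\<lambda>\<omega>'. F j (U \<omega>, \<tau> \<omega>')) * V \<omega> ^ i)"
    "integrable M (\<lambda>\<omega>. F j (U \<omega>, \<tau> \<omega>) * V \<omega> ^ i)" for i j
    by (rule expectation_indep_kernel[where U=U and V=V and \<tau>=\<tau> and F="F j" and K="K * \<bar>s\<bar> ^ j" and s=s and i=i];
        use ind' Fb Fs V in simp)+
  have t: "expectation (\<lambda>\<omega>. (F j (U \<omega>, \<tau> \<omega>) * V \<omega> ^ i) * cos (\<theta> \<omega>) ^ j) =
     expectation (\<lambda>\<omega>. F j (U \<omega>, \<tau> \<omega>) * V \<omega> ^ i) * expectation (\<lambda>\<omega>. cos (\<theta> \<omega>) ^ j)"
   and ti: "integrable M (\<lambda>\<omega>. (F j (U \<omega>, \<tau> \<omega>) * V \<omega> ^ i) * cos (\<theta> \<omega>) ^ j)" for i j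
  proof -
    have c: "integrable M (\<lambda>\<omega>. cos (\<theta> \<omega>) ^ j)"
      by (rule integrable_const_bound[of _ 1]) (auto simp: power_abs power_le_one)
    have iv: "indep_var borel (\<lambda>\<omega>. F j (U \<omega>, \<tau> \<omega>) * V \<omega> ^ i) borel (\<lambda>\<omega>. cos (\<theta> \<omega>) ^ j)"
      using ind[of "\<lambda>p. F j (fst (fst p), snd p) * snd (fst p) ^ i" "\<lambda>x. cos x ^ j"] by simp
    show "expectation (\<lambda>\<omega>. (F j (U \<omega>, \<tau> \<omega>) * V \<omega> ^ i) * cos (\<theta> \<omega>) ^ j) =
     expectation (\<lambda>\<omega>. F j (U \<omega>, \<tau> \<omega>) * V \<omega> ^ i) * expectation (\<lambda>\<omega>. cos (\<theta> \<omega>) ^ j)"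
      using indep_var_lebesgue_integral[OF iv] ker(2)[of j i] c by (simp add: comp_def)
    show "integrable M (\<lambda>\<omega>. (F j (U \<omega>, \<tau> \<omega>) * V \<omega> ^ i) * cos (\<theta> \<omega>) ^ j)"
      using indep_var_integrable[OF iv] ker(2)[of j i] c by (simp add: comp_def)
  qed
  have "(\<lambda>\<omega>. G (U \<omega>, \<tau> \<omega>) * (V \<omega> + H (U \<omega>, \<tau> \<omega>) * cos (\<theta> \<omega>)) ^ k) =
    (\<lambda>\<omega>. \<Sum>i\<le>k. real (k choose i) * ((F (k - i) (U \<omega>, \<tau> \<omega>) * V \<omega> ^ i) * cos (\<theta> \<omega>) ^ (k - i)))"
    unfolding F_def by (subst binomial_ring) (simp add: sum_distrib_left power_mult_distrib mult_ac)
  then have "expectation (\<lambda>\<omega>. G (U \<omega>, \<tau> \<omega>) * (V \<omega> + H (U \<omega>, \<tau> \<omega>) * cos (\<theta> \<omega>)) ^ k) =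
    (\<Sum>i\<le>k. real (k choose i) * expectation (\<lambda>\<omega>. (F (k - i) (U \<omega>, \<tau> \<omega>) * V \<omega> ^ i) * cos (\<theta> \<omega>) ^ (k - i)))"
    by (simp add: Bochner_Integration.integral_sum ti)
  then show ?thesis unfolding t ker(1) unfolding F_def by (simp add: mult_ac)
qed

section \<open>The flight expressed by independent gaps and angles\<close>

locale random_flight = prob_space M for M :: "'a measure" +
  fixes l :: real and m :: nat and S \<theta> :: "nat \<Rightarrow> 'a \<Rightarrow> real"
  assumes l_pos: "l > 0"
    and S: "poisson_event_times M l S"
    and \<theta>: "iid_angles M m \<theta>"
    and indep_angles_times: "indep_set (process_events M {1..} \<theta> borel) (process_events M UNIV S borel)"
begin

text \<open>Angles are numbered from 1 and gaps from 0, so displacement j has length gap j - 1 and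
  direction \<theta> j; \<open>position\<close> leaves out the speed c. As a sum of gaps,
  \<open>epoch\<close> starts at 0 everywhere, while S is known to do so only on the sample
  space.\<close>

definition gap :: "nat \<Rightarrow> 'a \<Rightarrow> real" where "gap k \<omega> = S (Suc k) \<omega> - S k \<omega>"
definition epoch :: "nat \<Rightarrow> 'a \<Rightarrow> real" where "epoch n \<omega> = (\<Sum>k<n. gap k \<omega>)"
definition position :: "nat \<Rightarrow> 'a \<Rightarrow> real" where "position n \<omega> = (\<Sum>j=1..n. gap (j - 1) \<omega> * cos (\<theta> j \<omega>))"

lemma gap_distributed: "distributed M lborel (gap k) (\<lambda>x. ennreal (exponential_density l x))"
  using S unfolding poisson_event_times_def gap_def by simp

lemma angle_distributed: "j \<ge> 1 \<Longrightarrow> distributed M lborel (\<theta> j) (\<lambda>x. ennreal (angle_density m x))"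
  using \<theta> unfolding iid_angles_def by simp

lemma gap_measurable [measurable]: "gap k \<in> borel_measurable M"
  using distributed_measurable[OF gap_distributed] by simp

lemma angle_measurable: "j \<ge> 1 \<Longrightarrow> \<theta> j \<in> borel_measurable M"
  using distributed_measurable[OF angle_distributed] by simp

lemma angle_Suc_measurable [measurable]: "\<theta> (Suc j) \<in> borel_measurable M"
  using angle_measurable by simp

lemma epoch_measurable [measurable]: "epoch n \<in> borel_measurable M"
  unfolding epoch_def by measurable

lemma epoch_0 [simp]: "epoch 0 \<omega> = 0" and epoch_Suc: "epoch (Suc n) \<omega> = epoch n \<omega> + gap n \<omega>"
  by (simp_all add: epoch_def)

lemma position_0 [simp]: "position 0 \<omega> = 0"
  and position_Suc: "position (Suc n) \<omega> = position n \<omega> + gap n \<omega> * cos (\<theta> (Suc n) \<omega>)"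
  by (simp_all add: position_def)

lemma position_measurable [measurable]: "position n \<in> borel_measurable M"
  by (induction n) (simp_all add: position_Suc[abs_def] position_0[abs_def])

lemma S_eq_epoch: "\<omega> \<in> space M \<Longrightarrow> S n \<omega> = epoch n \<omega>"
proof (induction n)
  case 0
  then show ?case using S unfolding poisson_event_times_def by simp
qed (simp add: epoch_Suc gap_def)

lemma AE_gap_pos: "AE \<omega> in M. \<forall>k. gap k \<omega> > 0"
  unfolding AE_all_countable
proof
  fix k
  have "prob {\<omega>\<in>space M. 0 < gap k \<omega>} = 1"
    using exponential_distributedD_gt[OF gap_distributed order_refl l_pos, of k] by simp
  then show "AE \<omega> in M. 0 < gap k \<omega>"
    by (subst (asm) prob_Collect_eq_1) auto
qed

text \<open>Without the factor c the path has speed one. This boundedness keeps all moments finite,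
  and it also records that epochs are nonnegative.\<close>

lemma AE_position_le: "AE \<omega> in M. \<bar>position n \<omega>\<bar> \<le> epoch n \<omega>"
  using AE_gap_pos
proof eventually_elim
  case (elim \<omega>)
  show ?case
  proof (induction n)
    case (Suc n)
    have "\<bar>gap n \<omega> * cos (\<theta> (Suc n) \<omega>)\<bar> \<le> gap n \<omega> * 1"
      using elim by (auto simp: abs_mult less_imp_le intro!: mult_mono)
    then show ?case using Suc unfolding position_Suc epoch_Suc by linarith
  qed simp
qed

text \<open>Gaps are differences of event times, hence measurable for the \<sigma>-algebra generated
  by S, which is independent of the angles.\<close>

lemma indep_angles_gaps: "indep_vars (\<lambda>_. borel) (case_sum \<theta> gap) ({1..} <+> UNIV)"
proof (rule indep_vars_case_sum)
  let ?V = "vimage_algebra (space M) (\<lambda>\<omega>. \<lambda>i\<in>{1..}. \<theta> i \<omega>) (Pi\<^sub>M {1..} (\<lambda>_. borel :: real measure))"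
  let ?W = "vimage_algebra (space M) (\<lambda>\<omega>. \<lambda>i\<in>UNIV. S i \<omega>) (Pi\<^sub>M UNIV (\<lambda>_. borel :: real measure))"
  show "indep_vars (\<lambda>_. borel) \<theta> {1..}" using \<theta> unfolding iid_angles_def by simp
  show "indep_vars (\<lambda>_. borel) gap UNIV"
    using S unfolding poisson_event_times_def gap_def[abs_def] by simp
  show "indep_set (sets ?V) (sets ?W)"
    using indep_angles_times unfolding process_events_def by simp
  show "\<theta> i \<in> measurable ?V borel" if "i \<in> {1..}" for i
  proof -
    have "(\<lambda>\<omega>. (\<lambda>f. f i) ((\<lambda>\<omega>. \<lambda>i\<in>{1..}. \<theta> i \<omega>) \<omega>)) \<in> measurable ?V borel"
      by (rule measurable_compose[OF measurable_vimage_algebra1 measurable_component_singleton])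
        (use that in \<open>auto simp: space_PiM split: if_splits\<close>)
    then show ?thesis using that by simp
  qed
  have S_W: "S i \<in> measurable ?W borel" for i
  proof -
    have "(\<lambda>\<omega>. (\<lambda>f. f i) ((\<lambda>\<omega>. \<lambda>i\<in>UNIV. S i \<omega>) \<omega>)) \<in> measurable ?W borel"
      by (rule measurable_compose[OF measurable_vimage_algebra1 measurable_component_singleton]) (auto simp: space_PiM)
    then show ?thesis by simp
  qed
  show "gap i \<in> measurable ?W borel" for i
    unfolding gap_def[abs_def] using S_W by measurable
qed simp_all

text \<open>Disjoint blocks of one independent family: the first n angles and gaps 0 to n against
  angle n + 1, and the first n angles and gaps 0 to n - 1 against gap n.\<close>

lemma angle_independence:
  "f \<in> borel_measurable ((borel \<Otimes>\<^sub>M borel) \<Otimes>\<^sub>M borel) \<Longrightarrow> g \<in> borel_measurable borel \<Longrightarrow>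
    indep_var borel (\<lambda>\<omega>. f ((epoch n \<omega>, position n \<omega>), gap n \<omega>) :: real) borel (\<lambda>\<omega>. g (\<theta> (Suc n) \<omega>))"
  and gap_independence:
  "distr M (borel \<Otimes>\<^sub>M borel) (\<lambda>\<omega>. (epoch n \<omega>, position n \<omega>)) \<Otimes>\<^sub>M distr M borel (gap n) =
      distr M ((borel \<Otimes>\<^sub>M borel) \<Otimes>\<^sub>M borel) (\<lambda>\<omega>. ((epoch n \<omega>, position n \<omega>), gap n \<omega>))"
proof -
  let ?Z = "case_sum \<theta> gap"
  \<comment> \<open>Epoch and position are rewritten as functions of coordinates, to be composed
    with the restriction of the family to a finite block.\<close>
  define ep where "ep f = (\<Sum>k<n. f (Inr k))" for f :: "nat + nat \<Rightarrow> real"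
  define po where "po f = (\<Sum>j=1..n. f (Inr (j - 1)) * cos (f (Inl j)))" for f :: "nat + nat \<Rightarrow> real"
  have idx: "Inr (j - 1) \<in> A \<and> Inl j \<in> A" if "j \<in> {1..n}" "{1..n} <+> {..<n} \<subseteq> A" for j and A :: "(nat + nat) set"
  proof -
    have "Inr (j - 1) \<in> {1..n} <+> {..<n}" "Inl j \<in> {1..n} <+> {..<n}" using that(1) by auto
    then show ?thesis using that(2) by blast
  qed
  have ep: "ep (restrict (\<lambda>i. ?Z i \<omega>) A) = epoch n \<omega>" if "{1..n} <+> {..<n} \<subseteq> A" for A \<omega>
    unfolding ep_def epoch_def using that by (intro sum.cong) auto
  have po: "po (restrict (\<lambda>i. ?Z i \<omega>) A) = position n \<omega>" if "{1..n} <+> {..<n} \<subseteq> A" for A \<omega>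
    unfolding po_def position_def using idx[OF _ that] by (intro sum.cong) auto
  have epm [measurable]: "ep \<in> borel_measurable (PiM A (\<lambda>_. borel))" if "{1..n} <+> {..<n} \<subseteq> A" for A
    unfolding ep_def using that by (intro borel_measurable_sum measurable_component_singleton) auto
  have pom [measurable]: "po \<in> borel_measurable (PiM A (\<lambda>_. borel))" if "{1..n} <+> {..<n} \<subseteq> A" for A
    unfolding po_def using idx[OF _ that]
    by (intro borel_measurable_sum borel_measurable_times measurable_component_singleton
        measurable_compose[OF measurable_component_singleton, where g=cos]) auto
  let ?A = "{1..n} <+> {..n} :: (nat + nat) set" and ?A' = "{1..n} <+> {..<n} :: (nat + nat) set"
  have A: "?A' \<subseteq> ?A" by auto
  show "indep_var borel (\<lambda>\<omega>. f ((epoch n \<omega>, position n \<omega>), gap n \<omega>) :: real) borel (\<lambda>\<omega>. g (\<theta> (Suc n) \<omega>))"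
    if [measurable]: "f \<in> borel_measurable ((borel \<Otimes>\<^sub>M borel) \<Otimes>\<^sub>M borel)" "g \<in> borel_measurable borel"
  proof -
    have "indep_var (PiM ?A (\<lambda>_. borel)) (\<lambda>\<omega>. restrict (\<lambda>i. ?Z i \<omega>) ?A) (PiM {Inl (Suc n)} (\<lambda>_. borel)) (\<lambda>\<omega>. restrict (\<lambda>i. ?Z i \<omega>) {Inl (Suc n)})"
      by (rule indep_var_restrict[OF indep_angles_gaps]) auto
    then have "indep_var borel ((\<lambda>x. f ((ep x, po x), x (Inr n))) \<circ> (\<lambda>\<omega>. restrict (\<lambda>i. ?Z i \<omega>) ?A)) borel
        ((\<lambda>x. g (x (Inl (Suc n)))) \<circ> (\<lambda>\<omega>. restrict (\<lambda>i. ?Z i \<omega>) {Inl (Suc n)}))"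
    proof (rule indep_var_compose)
      have [measurable]: "(\<lambda>x. x (Inr n)) \<in> borel_measurable (PiM ?A (\<lambda>_. borel))"
        "(\<lambda>x. x (Inl (Suc n))) \<in> borel_measurable (PiM {Inl (Suc n) :: nat + nat} (\<lambda>_. borel))"
        by (auto intro!: measurable_component_singleton)
      note [measurable] = epm[OF A] pom[OF A]
      show "(\<lambda>x. f ((ep x, po x), x (Inr n))) \<in> borel_measurable (PiM ?A (\<lambda>_. borel))" by measurable
      show "(\<lambda>x. g (x (Inl (Suc n)))) \<in> borel_measurable (PiM {Inl (Suc n) :: nat + nat} (\<lambda>_. borel))" by measurable
    qed
    moreover have "(\<lambda>x. f ((ep x, po x), x (Inr n))) \<circ> (\<lambda>\<omega>. restrict (\<lambda>i. ?Z i \<omega>) ?A) = (\<lambda>\<omega>. f ((epoch n \<omega>, position n \<omega>), gap n \<omega>))"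
      using ep[OF A] po[OF A] by (auto simp: fun_eq_iff)
    ultimately show ?thesis
      by (simp add: comp_def)
  qed
  have "indep_var (PiM ?A' (\<lambda>_. borel)) (\<lambda>\<omega>. restrict (\<lambda>i. ?Z i \<omega>) ?A') (PiM {Inr n} (\<lambda>_. borel)) (\<lambda>\<omega>. restrict (\<lambda>i. ?Z i \<omega>) {Inr n})"
    by (rule indep_var_restrict[OF indep_angles_gaps]) auto
  from indep_var_distr_pair[OF this, of "\<lambda>x. (ep x, po x)" "borel \<Otimes>\<^sub>M borel" "\<lambda>x. x (Inr n)" borel]
  show "distr M (borel \<Otimes>\<^sub>M borel) (\<lambda>\<omega>. (epoch n \<omega>, position n \<omega>)) \<Otimes>\<^sub>M distr M borel (gap n) =
      distr M ((borel \<Otimes>\<^sub>M borel) \<Otimes>\<^sub>M borel) (\<lambda>\<omega>. ((epoch n \<omega>, position n \<omega>), gap n \<omega>))"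
    using epm[OF order_refl] pom[OF order_refl] ep[OF order_refl] po[OF order_refl]
    by (simp add: measurable_component_singleton)
qed

definition cosine_fps :: "real fps" where "cosine_fps = Abs_fps (ultra_moment (real m))"

text \<open>For n \<ge> 1 this is the density in u of E (position^k; epoch in du). With k = 0 it is
  the Erlang density of the n-th epoch.\<close>

definition moment_density :: "nat \<Rightarrow> nat \<Rightarrow> real \<Rightarrow> real" where
  "moment_density n k u = l ^ n * exp (- l * u) * ((cosine_fps ^ n) $ k * fact k) * power_kernel (real (k + n)) u"

lemma cos_angle_moment: "expectation (\<lambda>\<omega>. cos (\<theta> (Suc n) \<omega>) ^ k) = cosine_fps $ k"
  using angle_density_moment[OF prob_space_axioms angle_distributed[of "Suc n"]] by (simp add: cosine_fps_def)

lemma expectation_step: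
  fixes G H :: "real \<times> real \<Rightarrow> real"
  assumes "G \<in> borel_measurable (borel \<Otimes>\<^sub>M borel)" "H \<in> borel_measurable (borel \<Otimes>\<^sub>M borel)"
    and "\<And>p. \<bar>G p\<bar> \<le> K" and "\<And>u t. G (u, t) \<noteq> 0 \<Longrightarrow> u \<le> s \<and> \<bar>H (u, t)\<bar> \<le> s"
    and h: "\<And>j u. h j u = expectation (\<lambda>\<omega>'. G (u, gap n \<omega>') * H (u, gap n \<omega>') ^ j)"
  shows "expectation (\<lambda>\<omega>. G (epoch n \<omega>, gap n \<omega>) * (position n \<omega> + H (epoch n \<omega>, gap n \<omega>) * cos (\<theta> (Suc n) \<omega>)) ^ k)
    = (\<Sum>i\<le>k. real (k choose i) * cosine_fps $ (k - i) * expectation (\<lambda>\<omega>. h (k - i) (epoch n \<omega>) * position n \<omega> ^ i))"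
  unfolding h cos_angle_moment[of n, symmetric]
  by (rule expectation_indep_step[where K=K and s=s])
     (use angle_independence[of _ _ n] gap_independence[of n] assms(1-4) AE_position_le[of n] in auto)

text \<open>Kernels of orders i + n and j + 1 convolve to order i + j + n + 1, which is k + n + 1 in
  every term of the binomial sum; so the time integral factors out and the rest is the k-th
  coefficient of \<open>A^(n+1)\<close>.\<close>

lemma epoch_position_moment:
  assumes "g \<in> borel_measurable borel" "\<And>z. \<bar>g z\<bar> \<le> K" "\<And>z. z > s \<Longrightarrow> g z = 0"
  shows "expectation (\<lambda>\<omega>. g (epoch (Suc n) \<omega>) * position (Suc n) \<omega> ^ k) = (LINT u|lborel. g u * moment_density (Suc n) k u)"
  using assms
proof (induction n arbitrary: g K s k)
  have step: "expectation (\<lambda>\<omega>. g (epoch (Suc n) \<omega>) * position (Suc n) \<omega> ^ k) = (LINT u|lborel. g u * moment_density (Suc n) k u)"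
    if [measurable]: "g \<in> borel_measurable borel" and g: "\<And>z. \<bar>g z\<bar> \<le> K" "\<And>z. z > s \<Longrightarrow> g z = 0"
    \<comment> \<open>The disjunct n = 0 stands in for an induction hypothesis that would be false
      there, the law of \<open>epoch 0\<close> being a point mass.\<close>
    and IH: "n = 0 \<or> (\<forall>h K k. h \<in> borel_measurable borel \<longrightarrow> (\<forall>z. \<bar>h z\<bar> \<le> K) \<longrightarrow> (\<forall>z>s. h z = 0) \<longrightarrow>
        expectation (\<lambda>\<omega>. h (epoch n \<omega>) * position n \<omega> ^ k) = (LINT u|lborel. h u * moment_density n k u))"
    for g K s k n
  proof -
    have K: "K \<ge> 0" using g(1)[of 0] by linarith
    \<comment> \<open>Restricting to nonnegative times changes nothing almost surely and turns u + t
      \<le> s into bounds on u and on t.\<close>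
    define G where "G p = g (fst p + snd p) * indicator {0..} (fst p) * indicator {0..} (snd p)" for p :: "real \<times> real"
    define h where "h j u = expectation (\<lambda>\<omega>'. G (u, gap n \<omega>') * snd (u, gap n \<omega>') ^ j)" for j u
    define gt where "gt z = g z * exp (- l * z) * indicator {0..} z" for z
    \<comment> \<open>The whole time dependence of a summand: it sees only i + j, not how the degree
      is split.\<close>
    define Q where "Q k = (LINT z|lborel. gt z * power_kernel (real (k + Suc n)) z)" for k
    have [measurable]: "G \<in> borel_measurable (borel \<Otimes>\<^sub>M borel)" "gt \<in> borel_measurable borel"
      unfolding G_def gt_def by measurable
    have Gb: "\<bar>G p\<bar> \<le> K" for p using g(1) K by (auto simp: G_def split: split_indicator)
    have Gs: "0 \<le> u \<and> 0 \<le> t \<and> u + t \<le> s" if "G (u, t) \<noteq> 0" for u t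
      using that g(2)[of "u + t"] by (auto simp: G_def not_less[symmetric] split: split_indicator_asm)
    have gtb: "\<bar>gt z\<bar> \<le> K" for z
    proof (cases "z \<ge> 0")
      case True
      then have "\<bar>g z\<bar> * exp (- l * z) \<le> K * 1" using g(1) K l_pos by (intro mult_mono) auto
      then show ?thesis using K by (auto simp: gt_def abs_mult split: split_indicator)
    next
      case False
      then show ?thesis using K by (simp add: gt_def)
    qed
    have gts: "gt z = 0" if "z > s" for z using g(2)[OF that] by (simp add: gt_def)
    have hm: "h j \<in> borel_measurable borel" for j unfolding h_def by measurable
    have hb: "\<bar>h j u\<bar> \<le> K * \<bar>s\<bar> ^ j" for j u unfolding h_def
    proof (rule expectation_bound)
      fix \<omega>
      show "\<bar>G (u, gap n \<omega>) * snd (u, gap n \<omega>) ^ j\<bar> \<le> K * \<bar>s\<bar> ^ j"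
      proof (cases "G (u, gap n \<omega>) = 0")
        case False
        then have "\<bar>gap n \<omega>\<bar> ^ j \<le> \<bar>s\<bar> ^ j" using Gs by (intro power_mono) force+
        then show ?thesis using Gb K by (auto simp: abs_mult power_abs intro!: mult_mono)
      qed (use K in simp)
    qed
    have hs: "h j u = 0" if "u > s" for j u
    proof -
      have "G (u, t) = 0" for t using Gs[of u t] that by force
      then show ?thesis by (simp add: h_def)
    qed
    \<comment> \<open>The factor exp (- l u) from the density at u joins that of the gap to exp (- l
      (u + t)), which \<open>gt\<close> absorbs; t^j is j! times the kernel of order j + 1.\<close>
    have h_eq: "h j u * exp (- l * u) = l * fact j * (LINT t|lborel. gt (u + t) * power_kernel (real (Suc j)) t)" if "u \<ge> 0" for j u
    proof -
      have "h j u = (LINT t|lborel. exponential_density l t * (G (u, t) * t ^ j))"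
        unfolding h_def snd_conv
        by (rule distributed_integral[OF gap_distributed, symmetric]) (use l_pos in \<open>auto simp: exponential_density_def\<close>)
      then have "h j u * exp (- l * u) = (LINT t|lborel. exponential_density l t * (G (u, t) * t ^ j) * exp (- l * u))" by simp
      also have "\<dots> = (LINT t|lborel. l * fact j * (gt (u + t) * power_kernel (real (Suc j)) t))"
      proof (rule integral_cong_AE)
        show "AE t in lborel. exponential_density l t * (G (u, t) * t ^ j) * exp (- l * u) = l * fact j * (gt (u + t) * power_kernel (real (Suc j)) t)"
          using AE_lborel_singleton[of 0]
        proof eventually_elim
          case (elim t)
          show ?case
          proof (cases "t > 0")
            case True
            then show ?thesis using \<open>u \<ge> 0\<close> unfolding power_kernel_Suc[OF True]
              by (simp add: exponential_density_def G_def gt_def algebra_simps exp_add[symmetric])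
          next
            case False
            then have "t < 0" using elim by simp
            then show ?thesis by (simp add: exponential_density_def power_kernel_def)
          qed
        qed
      qed (auto simp: exponential_density_def)
      finally show ?thesis by simp
    qed
    have summand: "expectation (\<lambda>\<omega>. h j (epoch n \<omega>) * position n \<omega> ^ i) = fact j * fact i * (cosine_fps ^ n) $ i * (l ^ Suc n * Q (i + j))" for i j
    proof (cases "n = 0")
      \<comment> \<open>Epoch and position are 0 at the start, so only i = 0 contributes; the
        coefficients of \<open>A^0\<close> agree with this.\<close>
      case True
      have "h j 0 = l * fact j * Q j" using h_eq[of 0 j] True by (simp add: Q_def)
      then show ?thesis using True by (cases i) (auto simp: prob_space)
    next
      case False
      with IH hm hb hs have "expectation (\<lambda>\<omega>. h j (epoch n \<omega>) * position n \<omega> ^ i) = (LINT u|lborel. h j u * moment_density n i u)"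
        by blast
      also have "\<dots> = (LINT u|lborel. l ^ Suc n * (fact j * fact i * (cosine_fps ^ n) $ i) *
          ((LINT t|lborel. gt (u + t) * power_kernel (real (Suc j)) t) * power_kernel (real (i + n)) u))"
      proof (rule Bochner_Integration.integral_cong[OF refl])
        fix u
        show "h j u * moment_density n i u = l ^ Suc n * (fact j * fact i * (cosine_fps ^ n) $ i) *
          ((LINT t|lborel. gt (u + t) * power_kernel (real (Suc j)) t) * power_kernel (real (i + n)) u)"
        proof (cases "u > 0")
          case True
          have "h j u * moment_density n i u = (h j u * exp (- l * u)) * (l ^ n * ((cosine_fps ^ n) $ i * fact i) * power_kernel (real (i + n)) u)"
            by (simp add: moment_density_def)
          then show ?thesis using True by (subst (asm) h_eq) (auto simp: mult_ac)
        qed (simp add: moment_density_def power_kernel_def)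
      qed
      also have "\<dots> = l ^ Suc n * (fact j * fact i * (cosine_fps ^ n) $ i) *
          (LINT z|lborel. gt z * power_kernel (real (i + n) + real (Suc j)) z)"
      proof -
        have "(LINT u|lborel. (LINT t|lborel. gt (u + t) * power_kernel (real (Suc j)) t) * power_kernel (real (i + n)) u) =
            (LINT z|lborel. gt z * power_kernel (real (i + n) + real (Suc j)) z)"
          by (rule power_kernel_convolution_integral[where K=K and s=s]) (use gtb gts False in auto)
        then show ?thesis by (simp only: integral_mult_right_zero)
      qed
      also have "real (i + n) + real (Suc j) = real (i + j + Suc n)" by simp
      finally show ?thesis unfolding Q_def by (simp add: mult_ac)
    qed
    have "expectation (\<lambda>\<omega>. g (epoch (Suc n) \<omega>) * position (Suc n) \<omega> ^ k) =
      expectation (\<lambda>\<omega>. G (epoch n \<omega>, gap n \<omega>) * (position n \<omega> + snd (epoch n \<omega>, gap n \<omega>) * cos (\<theta> (Suc n) \<omega>)) ^ k)"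
    proof (rule integral_cong_AE)
      show "AE \<omega> in M. g (epoch (Suc n) \<omega>) * position (Suc n) \<omega> ^ k =
        G (epoch n \<omega>, gap n \<omega>) * (position n \<omega> + snd (epoch n \<omega>, gap n \<omega>) * cos (\<theta> (Suc n) \<omega>)) ^ k"
        using AE_gap_pos AE_position_le[of n]
      proof eventually_elim
        case (elim \<omega>)
        then have "gap n \<omega> > 0" "epoch n \<omega> \<ge> 0" by auto
        then show ?case by (simp add: G_def epoch_Suc position_Suc)
      qed
    qed measurable
    also have "\<dots> = (\<Sum>i\<le>k. real (k choose i) * cosine_fps $ (k - i) * expectation (\<lambda>\<omega>. h (k - i) (epoch n \<omega>) * position n \<omega> ^ i))"
    proof (rule expectation_step[where K=K and s=s])
      show "G (u, t) \<noteq> 0 \<Longrightarrow> u \<le> s \<and> \<bar>snd (u, t)\<bar> \<le> s" for u t using Gs[of u t] by auto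
    qed (use Gb in \<open>auto simp: h_def\<close>)
    also have "\<dots> = (\<Sum>i\<le>k. real (k choose i) * cosine_fps $ (k - i) * (fact (k - i) * fact i * (cosine_fps ^ n) $ i * (l ^ Suc n * Q k)))"
      unfolding summand by (intro sum.cong) auto
    also have "\<dots> = fact k * (cosine_fps ^ Suc n) $ k * (l ^ Suc n * Q k)" by (rule fps_power_binomial_sum)
    also have "\<dots> = (LINT u|lborel. fact k * (cosine_fps ^ Suc n) $ k * (l ^ Suc n * (gt u * power_kernel (real (k + Suc n)) u)))"
      unfolding Q_def by (simp del: power_Suc)
    also have "\<dots> = (LINT u|lborel. g u * moment_density (Suc n) k u)"
      by (rule Bochner_Integration.integral_cong[OF refl])
        (simp add: gt_def moment_density_def power_kernel_def del: power_Suc)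
    finally show ?thesis .
  qed
  { case 0 then show ?case by (rule step) simp_all }
  { case (Suc n) 
    show ?case by (rule step[OF Suc.prems]) (use Suc.IH in \<open>auto simp del: power_Suc\<close>) }
qed

text \<open>The final gap only has to exceed s - u, with probability exp (- l (s - u)) and no factor
  l; hence l^n although \<open>A\<close> has exponent n + 1. The cut-off displacement has length s -
  u, and (s - u)^j is j! times the kernel of order j + 1, so the convolution is evaluated at the
  fixed time s. For k = 0 this is the Poisson probability of n events.\<close>

lemma flight_moment_gaps:
  assumes s: "s > 0" and n: "n \<ge> 1"
  shows "expectation (\<lambda>\<omega>. indicator {\<omega>. epoch n \<omega> \<le> s \<and> s < epoch (Suc n) \<omega>} \<omega> * (position n \<omega> + (s - epoch n \<omega>) * cos (\<theta> (Suc n) \<omega>)) ^ k)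
     = l ^ n * exp (- l * s) * (fact k * (cosine_fps ^ Suc n) $ k * (s ^ (k + n) / fact (k + n)))"
proof -
  define G :: "real \<times> real \<Rightarrow> real" where "G p = indicator {0..s} (fst p) * indicator {0<..} (fst p + snd p - s)" for p :: "real \<times> real"
  define H where "H p = s - fst p" for p :: "real \<times> real"
  define h where "h j u = expectation (\<lambda>\<omega>'. G (u, gap n \<omega>') * H (u, gap n \<omega>') ^ j)" for j u
  have [measurable]: "G \<in> borel_measurable (borel \<Otimes>\<^sub>M borel)" "H \<in> borel_measurable (borel \<Otimes>\<^sub>M borel)"
    unfolding G_def H_def by measurable
  have h: "h j u = indicator {0..s} u * (s - u) ^ j * exp (- (s - u) * l)" for j u
  proof (cases "u \<in> {0..s}")
    case True
    have "h j u = expectation (\<lambda>\<omega>'. (s - u) ^ j * indicator {\<omega>'\<in>space M. s - u < gap n \<omega>'} \<omega>')"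
      unfolding h_def G_def H_def using True
      by (intro Bochner_Integration.integral_cong) (auto split: split_indicator)
    also have "\<dots> = (s - u) ^ j * prob {\<omega>'\<in>space M. s - u < gap n \<omega>'}" by simp
    also have "prob {\<omega>'\<in>space M. s - u < gap n \<omega>'} = exp (- (s - u) * l)"
      using True by (intro exponential_distributedD_gt[OF gap_distributed _ l_pos]) auto
    finally show ?thesis using True by simp
  qed (simp add: h_def G_def)
  have hm: "h j \<in> borel_measurable borel" for j unfolding h[abs_def] by measurable
  have hb: "\<bar>h j u\<bar> \<le> s ^ j * 1" for j u
  proof (cases "u \<in> {0..s}")
    case True
    then have "(s - u) ^ j * exp (- (s - u) * l) \<le> s ^ j * 1"
      using l_pos by (intro mult_mono power_mono) (auto intro: mult_nonpos_nonneg)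
    then show ?thesis using True by (simp add: h abs_mult power_abs)
  qed (use s in \<open>simp add: h\<close>)
  have hs: "h j u = 0" if "u > s" for j u using that by (simp add: h)
  obtain n' where n': "n = Suc n'" using n by (cases n) auto
  have summand: "expectation (\<lambda>\<omega>. h j (epoch n \<omega>) * position n \<omega> ^ i) =
      fact j * fact i * (cosine_fps ^ n) $ i * (l ^ n * exp (- l * s) * power_kernel (real (i + j + Suc n)) s)" for i j
  proof -
    have "expectation (\<lambda>\<omega>. h j (epoch n \<omega>) * position n \<omega> ^ i) = (LINT u|lborel. h j u * moment_density n i u)"
      unfolding n' by (rule epoch_position_moment[OF hm hb hs])
    also have "\<dots> = (LINT u|lborel. (fact j * fact i * (cosine_fps ^ n) $ i * (l ^ n * exp (- l * s))) *
        (power_kernel (real (i + n)) u * power_kernel (real (Suc j)) (s - u)))"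
    proof (rule integral_cong_AE)
      show "AE u in lborel. h j u * moment_density n i u = (fact j * fact i * (cosine_fps ^ n) $ i * (l ^ n * exp (- l * s))) *
        (power_kernel (real (i + n)) u * power_kernel (real (Suc j)) (s - u))"
        using AE_lborel_singleton[of s]
      proof eventually_elim
        case (elim u)
        show ?case
        proof (cases "0 < u \<and> u < s")
          case True
          then have "power_kernel (real (Suc j)) (s - u) = (s - u) ^ j / fact j" by (intro power_kernel_Suc) simp
          moreover have "exp (- (s - u) * l) * exp (- l * u) = exp (- l * s)" by (simp add: exp_add[symmetric] algebra_simps)
          ultimately show ?thesis using True by (simp add: h moment_density_def)
        next
          case False
          then have "u \<le> 0 \<or> u > s" using elim by auto
          then show ?thesis by (auto simp: h moment_density_def power_kernel_def)
        qed
      qed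
    qed (use hm in \<open>auto simp: moment_density_def[abs_def]\<close>)
    also have "\<dots> = (fact j * fact i * (cosine_fps ^ n) $ i * (l ^ n * exp (- l * s))) *
       (LINT u|lborel. power_kernel (real (i + n)) u * power_kernel (real (Suc j)) (s - u))"
      by (simp del: of_nat_Suc of_nat_add)
    also have "(LINT u|lborel. power_kernel (real (i + n)) u * power_kernel (real (Suc j)) (s - u)) = power_kernel (real (i + j + Suc n)) s"
    proof -
      have p: "real (i + n) > 0" "real (Suc j) > 0" using n by auto
      have e: "real (i + n) + real (Suc j) = real (i + j + Suc n)" by simp
      have "(\<integral>\<^sup>+u. ennreal (power_kernel (real (i + n)) u * power_kernel (real (Suc j)) (s - u)) \<partial>lborel) = ennreal (power_kernel (real (i + j + Suc n)) s)"
        using power_kernel_convolution[OF p, of s] power_kernel_nonneg[OF p(1)] power_kernel_nonneg[OF p(2)] unfolding e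
        by (simp add: ennreal_mult del: of_nat_Suc of_nat_add)
      then show ?thesis using power_kernel_nonneg[OF p(1)] power_kernel_nonneg[OF p(2)]
          power_kernel_nonneg[of "real (i + j + Suc n)" s]
        by (subst integral_eq_nn_integral) (auto simp del: of_nat_Suc of_nat_add)
    qed
    finally show ?thesis by (simp add: mult_ac)
  qed
  have "expectation (\<lambda>\<omega>. indicator {\<omega>. epoch n \<omega> \<le> s \<and> s < epoch (Suc n) \<omega>} \<omega> * (position n \<omega> + (s - epoch n \<omega>) * cos (\<theta> (Suc n) \<omega>)) ^ k)
     = expectation (\<lambda>\<omega>. G (epoch n \<omega>, gap n \<omega>) * (position n \<omega> + H (epoch n \<omega>, gap n \<omega>) * cos (\<theta> (Suc n) \<omega>)) ^ k)"
  proof (rule integral_cong_AE)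
    show "AE \<omega> in M. indicator {\<omega>. epoch n \<omega> \<le> s \<and> s < epoch (Suc n) \<omega>} \<omega> * (position n \<omega> + (s - epoch n \<omega>) * cos (\<theta> (Suc n) \<omega>)) ^ k
      = G (epoch n \<omega>, gap n \<omega>) * (position n \<omega> + H (epoch n \<omega>, gap n \<omega>) * cos (\<theta> (Suc n) \<omega>)) ^ k"
      using AE_position_le[of n]
    proof eventually_elim
      case (elim \<omega>)
      then have "epoch n \<omega> \<ge> 0" by auto
      then show ?case by (auto simp: G_def H_def epoch_Suc split: split_indicator)
    qed
  qed measurable
  also have "\<dots> = (\<Sum>i\<le>k. real (k choose i) * cosine_fps $ (k - i) * expectation (\<lambda>\<omega>. h (k - i) (epoch n \<omega>) * position n \<omega> ^ i))"
    by (rule expectation_step[where K=1 and s=s]) (auto simp: G_def H_def h_def split: split_indicator_asm split_indicator)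
  also have "\<dots> = (\<Sum>i\<le>k. real (k choose i) * cosine_fps $ (k - i) * (fact (k - i) * fact i * (cosine_fps ^ n) $ i *
      (l ^ n * exp (- l * s) * power_kernel (real (Suc (k + n))) s)))"
    unfolding summand by (intro sum.cong) auto
  also have "\<dots> = fact k * (cosine_fps ^ Suc n) $ k * (l ^ n * exp (- l * s) * power_kernel (real (Suc (k + n))) s)"
    by (rule fps_power_binomial_sum)
  also have "power_kernel (real (Suc (k + n))) s = s ^ (k + n) / fact (k + n)" by (rule power_kernel_Suc[OF s])
  finally show ?thesis by (simp add: mult_ac)
qed

section \<open>Conditional law at a fixed time, given the number of events\<close>

lemma S_measurable [measurable]: "S n \<in> borel_measurable M"
  using epoch_measurable[of n] by (rule measurable_cong[THEN iffD2, rotated]) (rule S_eq_epoch)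

lemma event_count_measurable [measurable]: "event_count S s \<in> measurable M (count_space UNIV)"
  unfolding event_count_def[abs_def] by measurable

text \<open>Positive gaps make the epochs strictly increasing, so the indices of the events up to
  time s form an initial segment.\<close>

lemma AE_event_count_iff:
  assumes "n \<ge> 1"
  shows "AE \<omega> in M. event_count S s \<omega> = n \<longleftrightarrow> epoch n \<omega> \<le> s \<and> s < epoch (Suc n) \<omega>"
  using AE_gap_pos AE_space
proof eventually_elim
  case (elim \<omega>)
  have mono: "strict_mono (\<lambda>k. epoch k \<omega>)"
    using elim(1) by (simp add: strict_mono_Suc_iff epoch_Suc)
  define D where "D = {k. 1 \<le> k \<and> epoch k \<omega> \<le> s}"
  have ec: "event_count S s \<omega> = card D"
    unfolding event_count_def D_def using S_eq_epoch[OF elim(2)] by simp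
  show ?case
  proof
    assume "event_count S s \<omega> = n"
    then have card: "card D = n" using ec by simp
    \<comment> \<open>An infinite set has \<open>card\<close> 0, so n \<ge> 1 gives finiteness as
      well as nonemptiness.\<close>
    then have fin: "finite D" "D \<noteq> {}" using assms card_ge_0_finite[of D] by auto
    have "D = {1..Max D}"
    proof (intro equalityI subsetI)
      fix k assume "k \<in> {1..Max D}"
      moreover have "epoch (Max D) \<omega> \<le> s" using Max_in[OF fin] by (simp add: D_def)
      moreover have "epoch k \<omega> \<le> epoch (Max D) \<omega>" if "k \<le> Max D"
        using monoD[OF strict_mono_mono[OF mono] that] .
      ultimately show "k \<in> D" by (auto simp: D_def)
    qed (use fin in \<open>auto simp: D_def\<close>)
    then have "Max D = n" using card by (metis card_atLeastAtMost diff_Suc_1)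
    with \<open>D = {1..Max D}\<close> have "D = {1..n}" by simp
    then have "n \<in> D" "Suc n \<notin> D" using assms by auto
    then show "epoch n \<omega> \<le> s \<and> s < epoch (Suc n) \<omega>" by (auto simp: D_def)
  next
    assume a: "epoch n \<omega> \<le> s \<and> s < epoch (Suc n) \<omega>"
    have "D = {1..n}"
    proof (intro equalityI subsetI)
      fix k assume "k \<in> D"
      then have "epoch k \<omega> < epoch (Suc n) \<omega>" "1 \<le> k" using a by (auto simp: D_def)
      then show "k \<in> {1..n}" using strict_mono_less[OF mono, of k "Suc n"] by simp
    next
      fix k assume k: "k \<in> {1..n}"
      then have "epoch k \<omega> \<le> epoch n \<omega>" using monoD[OF strict_mono_mono[OF mono], of k n] by simp
      then show "k \<in> D" using a k by (auto simp: D_def)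
    qed
    then show "event_count S s \<omega> = n" using ec by simp
  qed
qed

lemma flight_eq:
  assumes "\<omega> \<in> space M" "event_count S s \<omega> = n"
  shows "flight c S \<theta> s \<omega> = c * (position n \<omega> + (s - epoch n \<omega>) * cos (\<theta> (Suc n) \<omega>))"
proof -
  have "(\<Sum>j=1..n. (S j \<omega> - S (j - 1) \<omega>) * cos (\<theta> j \<omega>)) = position n \<omega>"
    unfolding position_def gap_def by (intro sum.cong) auto
  moreover have "(\<Sum>j=1..n. ((if j = Suc n then s else S j \<omega>) - (if j - 1 = Suc n then s else S (j - 1) \<omega>)) * cos (\<theta> j \<omega>)) =
     (\<Sum>j=1..n. (S j \<omega> - S (j - 1) \<omega>) * cos (\<theta> j \<omega>))"
    by (intro sum.cong) auto
  ultimately show ?thesis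
    unfolding flight_def assms(2) Let_def by (simp add: S_eq_epoch[OF assms(1)])
qed

text \<open>Here m in {0, 1} enters: for these two angle laws the powers of the moment series again
  have ultraspherical coefficients, and the index v_m is read off.\<close>

lemma cosine_power_nth:
  assumes "m \<in> {0, 1}"
  shows "(cosine_fps ^ Suc n) $ k * fact k * fact n / fact (k + n) = ultra_moment (v_index m n) k"
proof (cases "m = 0")
  case True
  then have "cosine_fps = arcsine_fps" unfolding cosine_fps_def arcsine_fps_def by simp
  then show ?thesis using True arcsine_power_nth by (simp add: v_index_def del: power_Suc)
next
  case False
  then have "cosine_fps = semicircle_fps" using assms unfolding cosine_fps_def semicircle_fps_def by simp
  then show ?thesis using False semicircle_power_nth by (simp add: v_index_def del: power_Suc)
qed

text \<open>Dividing the joint moments by the Poisson probability leaves (c s)^k k! n! / (k + n)!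
  times a coefficient of \<open>A^(n+1)\<close>, which is an ultraspherical moment. Both laws live
  on [-c s, c s], so equality of moments suffices.\<close>

lemma conditional_flight_law:
  assumes m: "m \<in> {0, 1}" and n: "n \<ge> 1" and s: "s > 0" and c: "c > 0"
    and X [measurable]: "flight c S \<theta> s \<in> borel_measurable M"
  shows "distr (uniform_measure M {\<omega> \<in> space M. event_count S s \<omega> = n}) borel (flight c S \<theta> s)
     = density lborel (\<lambda>x. ennreal (ultraspherical_density (v_index m n) (c * s) x))"
proof -
  define A where "A = {\<omega> \<in> space M. event_count S s \<omega> = n}"
  let ?X = "flight c S \<theta> s" and ?U = "uniform_measure M A" and ?v = "v_index m n"
  have [measurable]: "A \<in> sets M" unfolding A_def by measurable
  have v: "?v > - 1/2" using n by (auto simp: v_index_def)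
  have a: "c * s > 0" using c s by simp
  define Y where "Y \<omega> = position n \<omega> + (s - epoch n \<omega>) * cos (\<theta> (Suc n) \<omega>)" for \<omega>
  have AE: "AE \<omega> in M. indicator A \<omega> * ?X \<omega> ^ k =
     c ^ k * (indicator {\<omega>. epoch n \<omega> \<le> s \<and> s < epoch (Suc n) \<omega>} \<omega> * Y \<omega> ^ k)" for k
    using AE_event_count_iff[OF n, of s] AE_space
  proof eventually_elim
    case (elim \<omega>)
    then show ?case using flight_eq[of \<omega> s n c]
      by (auto simp: A_def Y_def power_mult_distrib split: split_indicator)
  qed
  have E: "expectation (\<lambda>\<omega>. indicator A \<omega> * ?X \<omega> ^ k) =
      c ^ k * (l ^ n * exp (- l * s) * (fact k * (cosine_fps ^ Suc n) $ k * (s ^ (k + n) / fact (k + n))))" for k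
  proof -
    have "expectation (\<lambda>\<omega>. indicator A \<omega> * ?X \<omega> ^ k) =
       expectation (\<lambda>\<omega>. c ^ k * (indicator {\<omega>. epoch n \<omega> \<le> s \<and> s < epoch (Suc n) \<omega>} \<omega> * Y \<omega> ^ k))"
      by (rule integral_cong_AE[OF _ _ AE]) (auto simp: Y_def)
    then show ?thesis unfolding Y_def by (simp add: flight_moment_gaps[OF s n] del: power_Suc)
  qed
  have pA: "prob A = l ^ n * exp (- l * s) * (s ^ n / fact n)"
    using E[of 0] by (simp add: cosine_fps_def fps_nth_power_0 del: power_Suc)
  then have pA0: "prob A > 0" using l_pos s by simp
  interpret U: prob_space ?U
    by (rule prob_space_uniform_measure) (use pA0 in \<open>auto simp: emeasure_eq_measure\<close>)
  have U_dens: "?U = density M (\<lambda>\<omega>. ennreal (indicator A \<omega> / prob A))"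
    unfolding uniform_measure_def using pA0
    by (intro density_cong) (auto simp: emeasure_eq_measure ennreal_indicator[symmetric] divide_ennreal)
  have XU [measurable]: "?X \<in> borel_measurable ?U" by simp
  have moment: "(LINT x|distr ?U borel ?X. x ^ k) = (c * s) ^ k * ultra_moment ?v k" for k
  proof -
    have "(LINT x|distr ?U borel ?X. x ^ k) = (LINT \<omega>|?U. ?X \<omega> ^ k)"
      by (rule integral_distr) auto
    also have "\<dots> = expectation (\<lambda>\<omega>. (indicator A \<omega> / prob A) *\<^sub>R ?X \<omega> ^ k)"
      unfolding U_dens by (rule integral_density) auto
    also have "\<dots> = expectation (\<lambda>\<omega>. indicator A \<omega> * ?X \<omega> ^ k) / prob A" by simp
    also have "\<dots> = (c * s) ^ k * ((cosine_fps ^ Suc n) $ k * fact k * fact n / fact (k + n))"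
      unfolding E pA using l_pos s by (simp add: field_simps power_add power_mult_distrib del: power_Suc)
    finally show ?thesis unfolding cosine_power_nth[OF m] .
  qed
  have "distr ?U borel ?X = density lborel (\<lambda>x. ennreal (ultraspherical_density ?v (c * s) x))"
  proof (rule real_distribution_eqI_moments[where a="c * s"])
    show "real_distribution (distr ?U borel ?X)"
      using XU by (rule U.real_distribution_distr)
    show "real_distribution (density lborel (\<lambda>x. ennreal (ultraspherical_density ?v (c * s) x)))"
      by (auto simp: real_distribution_def real_distribution_axioms_def emeasure_density
          nn_integral_ultraspherical_density[OF a v] intro!: prob_spaceI)
    show "AE x in distr ?U borel ?X. \<bar>x\<bar> \<le> c * s"
    proof (subst AE_distr_iff)
      show "AE \<omega> in ?U. \<bar>?X \<omega>\<bar> \<le> c * s"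
      proof (rule AE_uniform_measureI)
        have tri: "\<bar>b\<bar> \<le> (s - e) * 1 \<Longrightarrow> \<bar>a\<bar> \<le> e \<Longrightarrow> \<bar>a + b\<bar> \<le> s" for a b e :: real
          using abs_triangle_ineq[of a b] by simp
        show "AE \<omega> in M. \<omega> \<in> A \<longrightarrow> \<bar>?X \<omega>\<bar> \<le> c * s"
          using AE_event_count_iff[OF n, of s] AE_space AE_position_le[of n]
        proof eventually_elim
          case (elim \<omega>)
          show ?case
          proof
            assume "\<omega> \<in> A"
            then have e: "event_count S s \<omega> = n" by (simp add: A_def)
            then have le: "epoch n \<omega> \<le> s" using elim by simp
            have "\<bar>(s - epoch n \<omega>) * cos (\<theta> (Suc n) \<omega>)\<bar> \<le> (s - epoch n \<omega>) * 1"
              unfolding abs_mult using le by (intro mult_mono) auto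
            then have "\<bar>position n \<omega> + (s - epoch n \<omega>) * cos (\<theta> (Suc n) \<omega>)\<bar> \<le> s"
              using elim(3) tri by blast
            then show "\<bar>?X \<omega>\<bar> \<le> c * s"
              unfolding flight_eq[OF elim(2) e] using c by (simp add: abs_mult)
          qed
        qed
      qed simp
    qed auto
    show "AE x in density lborel (\<lambda>x. ennreal (ultraspherical_density ?v (c * s) x)). \<bar>x\<bar> \<le> c * s"
    proof (subst AE_density, simp, rule AE_I2, rule impI, rule ccontr)
      fix x assume "0 < ennreal (ultraspherical_density ?v (c * s) x)" "\<not> \<bar>x\<bar> \<le> c * s"
      moreover then have "(c * s)\<^sup>2 \<le> x\<^sup>2" using a by (simp add: abs_le_square_iff[symmetric])
      ultimately show False by (simp add: ultraspherical_density_def power_kernel_def)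
    qed
    show "(LINT x|distr ?U borel ?X. x ^ k) = (LINT x|density lborel (\<lambda>x. ennreal (ultraspherical_density ?v (c * s) x)). x ^ k)" for k
    proof -
      have "(LINT x|density lborel (\<lambda>x. ennreal (ultraspherical_density ?v (c * s) x)). x ^ k) =
         (LINT x|lborel. ultraspherical_density ?v (c * s) x *\<^sub>R x ^ k)"
        by (rule integral_density) (use ultraspherical_density_nonneg[OF v] in auto)
      then show ?thesis unfolding moment by (simp add: ultraspherical_moment[OF a v])
    qed
  qed
  then show ?thesis by (simp add: A_def)
qed

text \<open>Any admissible p is a version of the same density at each fixed time. The exceptional
  set of x depends on s, an issue settled when the time is averaged.\<close>

lemma conditional_density_unique:
  assumes m: "m \<in> {0, 1}" and n: "n \<ge> 1" and c: "c > 0" and s: "s > 0"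
    and p: "conditional_density M (flight c S \<theta>) (event_count S) n p"
  shows "AE x in lborel. p x s = ultraspherical_density (v_index m n) (c * s) x"
proof -
  let ?U = "uniform_measure M {\<omega> \<in> space M. event_count S s \<omega> = n}"
  have D: "distributed ?U lborel (flight c S \<theta> s) (\<lambda>x. ennreal (p x s))"
    and nn: "\<And>x. 0 \<le> p x s"
    using p s unfolding conditional_density_def by auto
  have X: "flight c S \<theta> s \<in> borel_measurable M"
    using distributed_measurable[OF D] by simp
  have v: "v_index m n > - 1/2" using n by (auto simp: v_index_def)
  have "density lborel (\<lambda>x. ennreal (p x s)) = distr ?U lborel (flight c S \<theta> s)"
    using distributed_distr_eq_density[OF D] by simp
  also have "\<dots> = distr ?U borel (flight c S \<theta> s)" by (rule distr_cong) auto
  also have "\<dots> = density lborel (\<lambda>x. ennreal (ultraspherical_density (v_index m n) (c * s) x))"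
    by (rule conditional_flight_law[OF m n s c X])
  finally have "AE x in lborel. ennreal (p x s) = ennreal (ultraspherical_density (v_index m n) (c * s) x)"
    by (subst (asm) sigma_finite_measure.density_unique_iff[OF sigma_finite_lborel]) (use distributed_borel_measurable[OF D] in auto)
  then show ?thesis
    by eventually_elim (use nn ultraspherical_density_nonneg[OF v] in \<open>auto simp: ennreal_inj\<close>)
qed

end

section \<open>Bessel times\<close>

definition gamma_density :: "real \<Rightarrow> real \<Rightarrow> real" where
  "gamma_density a u = power_kernel a u * exp (- u)"

lemma gamma_density_measurable [measurable]: "gamma_density a \<in> borel_measurable borel"
  unfolding gamma_density_def by measurable

lemma gamma_density_nonneg: "a > 0 \<Longrightarrow> 0 \<le> gamma_density a u"
  by (simp add: gamma_density_def power_kernel_nonneg)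

text \<open>The product exp (- (z - u)) exp (- u) does not depend on u, so Gamma laws inherit the
  semigroup property of the power kernels.\<close>

lemma gamma_density_convolution:
  assumes a: "a > 0" and b: "b > 0"
  shows "(\<integral>\<^sup>+u. ennreal (gamma_density a (z - u)) * ennreal (gamma_density b u) \<partial>lborel) = ennreal (gamma_density (b + a) z)"
proof -
  have "(\<integral>\<^sup>+u. ennreal (gamma_density a (z - u)) * ennreal (gamma_density b u) \<partial>lborel) =
      (\<integral>\<^sup>+u. ennreal (exp (- z)) * (ennreal (power_kernel b u) * ennreal (power_kernel a (z - u))) \<partial>lborel)"
  proof (rule nn_integral_cong)
    fix u
    have "gamma_density a (z - u) * gamma_density b u = exp (- z) * (power_kernel b u * power_kernel a (z - u))"
      by (simp add: gamma_density_def mult_exp_exp)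
    then show "ennreal (gamma_density a (z - u)) * ennreal (gamma_density b u) =
       ennreal (exp (- z)) * (ennreal (power_kernel b u) * ennreal (power_kernel a (z - u)))"
      by (simp add: ennreal_mult[symmetric] gamma_density_nonneg power_kernel_nonneg a b)
  qed
  also have "\<dots> = ennreal (exp (- z)) * ennreal (power_kernel (b + a) z)"
    by (subst nn_integral_cmult) (auto simp: power_kernel_convolution a b)
  finally show ?thesis using a b
    by (simp add: gamma_density_def ennreal_mult[symmetric] power_kernel_nonneg mult.commute)
qed

lemma distributedI_nn_integral:
  assumes [measurable]: "X \<in> borel_measurable M" "f \<in> borel_measurable borel"
    and eq: "\<And>g. g \<in> borel_measurable borel \<Longrightarrow> (\<integral>\<^sup>+\<omega>. g (X \<omega>) \<partial>M) = (\<integral>\<^sup>+x. ennreal (f x) * g x \<partial>lborel)"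
  shows "distributed M lborel X (\<lambda>x. ennreal (f x))"
  unfolding distributed_def
proof (intro conjI)
  show "distr M lborel X = density lborel (\<lambda>x. ennreal (f x))"
  proof (rule measure_eqI)
    fix A assume "A \<in> sets (distr M lborel X)"
    then have [measurable]: "A \<in> sets borel" by simp
    have "emeasure (distr M lborel X) A = (\<integral>\<^sup>+x. indicator A x \<partial>distr M lborel X)" by simp
    also have "\<dots> = (\<integral>\<^sup>+\<omega>. indicator A (X \<omega>) \<partial>M)" by (rule nn_integral_distr) auto
    also have "\<dots> = (\<integral>\<^sup>+x. ennreal (f x) * indicator A x \<partial>lborel)" by (rule eq) measurable
    also have "\<dots> = emeasure (density lborel (\<lambda>x. ennreal (f x))) A" by (subst emeasure_density) auto
    finally show "emeasure (distr M lborel X) A = emeasure (density lborel (\<lambda>x. ennreal (f x))) A" .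
  qed simp
qed simp_all

text \<open>After X = \<sigma> sqrt 2 y the density is exp (- y^2) / sqrt pi. Under u = y^2 the two
  signs of y give twice this, which by \<open>power_kernel_half_square\<close> is the Gamma density
  of order 1/2 times the Jacobian 2 y.\<close>

lemma normal_square_distributed:
  assumes \<sigma>: "\<sigma> > 0" and D: "distributed M lborel X (\<lambda>x. ennreal (normal_density 0 \<sigma> x))"
  shows "distributed M lborel (\<lambda>\<omega>. (X \<omega>)\<^sup>2 / (2 * \<sigma>\<^sup>2)) (\<lambda>u. ennreal (gamma_density (1/2) u))"
proof (rule distributedI_nn_integral)
  have [measurable]: "X \<in> borel_measurable M" using distributed_measurable[OF D] by simp
  show "(\<lambda>\<omega>. (X \<omega>)\<^sup>2 / (2 * \<sigma>\<^sup>2)) \<in> borel_measurable M" by measurable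
  fix g :: "real \<Rightarrow> ennreal" assume [measurable]: "g \<in> borel_measurable borel"
  define r where "r = \<sigma> * sqrt 2"
  have r: "r > 0" "r\<^sup>2 = 2 * \<sigma>\<^sup>2" using \<sigma> by (auto simp: r_def power_mult_distrib)
  define h where "h y = ennreal (exp (- y\<^sup>2) / sqrt pi) * g (y\<^sup>2)" for y
  have [measurable]: "h \<in> borel_measurable borel" unfolding h_def by measurable
  have "(\<integral>\<^sup>+\<omega>. g ((X \<omega>)\<^sup>2 / (2 * \<sigma>\<^sup>2)) \<partial>M) = (\<integral>\<^sup>+x. ennreal (normal_density 0 \<sigma> x) * g (x\<^sup>2 / (2 * \<sigma>\<^sup>2)) \<partial>lborel)"
    by (rule distributed_nn_integral[OF D, symmetric]) measurable
  also have "\<dots> = ennreal \<bar>r\<bar> * (\<integral>\<^sup>+y. ennreal (normal_density 0 \<sigma> (0 + r * y)) * g ((0 + r * y)\<^sup>2 / (2 * \<sigma>\<^sup>2)) \<partial>lborel)"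
    by (rule nn_integral_real_affine) (use r in auto)
  also have "\<dots> = (\<integral>\<^sup>+y. ennreal r * (ennreal (normal_density 0 \<sigma> (0 + r * y)) * g ((0 + r * y)\<^sup>2 / (2 * \<sigma>\<^sup>2))) \<partial>lborel)"
    using r by (subst nn_integral_cmult) auto
  also have "\<dots> = (\<integral>\<^sup>+y. h y \<partial>lborel)"
  proof (rule nn_integral_cong)
    fix y
    have "(r * y)\<^sup>2 / (2 * \<sigma>\<^sup>2) = y\<^sup>2" using \<sigma> r by (simp add: power_mult_distrib)
    moreover have "r * normal_density 0 \<sigma> (r * y) = exp (- y\<^sup>2) / sqrt pi"
      using \<sigma> r(1) calculation by (simp add: normal_density_def r_def real_sqrt_mult)
    ultimately show "ennreal r * (ennreal (normal_density 0 \<sigma> (0 + r * y)) * g ((0 + r * y)\<^sup>2 / (2 * \<sigma>\<^sup>2))) = h y"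
      using r by (simp add: h_def mult.assoc[symmetric] ennreal_mult[symmetric])
  qed
  also have "\<dots> = 2 * (\<integral>\<^sup>+y. h y * indicator {0<..} y \<partial>lborel)"
    by (rule nn_integral_even) (auto simp: h_def)
  also have "\<dots> = (\<integral>\<^sup>+y. 2 * (h y * indicator {0<..} y) \<partial>lborel)"
    by (subst nn_integral_cmult) auto
  also have "\<dots> = (\<integral>\<^sup>+y. (ennreal (gamma_density (1/2) (y\<^sup>2)) * g (y\<^sup>2)) * ennreal (2 * y) * indicator {0<..} y \<partial>lborel)"
  proof (rule nn_integral_cong)
    fix y :: real
    show "2 * (h y * indicator {0<..} y) = (ennreal (gamma_density (1/2) (y\<^sup>2)) * g (y\<^sup>2)) * ennreal (2 * y) * indicator {0<..} y"
    proof (cases "y > 0")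
      case True
      have "gamma_density (1/2) (y\<^sup>2) * (2 * y) = 2 * (exp (- y\<^sup>2) / sqrt pi)"
      proof -
        have "gamma_density (1/2) (y\<^sup>2) * (2 * y) = exp (- y\<^sup>2) * (power_kernel (1/2) (y\<^sup>2) * (2 * y))"
          by (simp add: gamma_density_def)
        then show ?thesis unfolding power_kernel_half_square[OF True] by simp
      qed
      then have "ennreal (gamma_density (1/2) (y\<^sup>2)) * ennreal (2 * y) = 2 * ennreal (exp (- y\<^sup>2) / sqrt pi)"
        using True ennreal_mult[of 2 "exp (- y\<^sup>2) / sqrt pi"]
        by (simp add: ennreal_mult[symmetric] gamma_density_nonneg)
      then have "2 * (ennreal (exp (- y\<^sup>2) / sqrt pi) * z) = ennreal (gamma_density (1/2) (y\<^sup>2)) * z * ennreal (2 * y)" for z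
        by (metis mult.assoc mult.commute)
      then show ?thesis using True by (simp add: h_def)
    qed simp
  qed
  also have "\<dots> = (\<integral>\<^sup>+u. (ennreal (gamma_density (1/2) u) * g u) * indicator {0<..} u \<partial>lborel)"
    by (rule nn_integral_substitution_square[symmetric]) measurable
  also have "\<dots> = (\<integral>\<^sup>+u. ennreal (gamma_density (1/2) u) * g u \<partial>lborel)"
    by (intro nn_integral_cong) (auto simp: gamma_density_def power_kernel_def split: split_indicator)
  finally show "(\<integral>\<^sup>+\<omega>. g ((X \<omega>)\<^sup>2 / (2 * \<sigma>\<^sup>2)) \<partial>M) = (\<integral>\<^sup>+u. ennreal (gamma_density (1/2) u) * g u \<partial>lborel)" .
qed simp

lemma (in prob_space) sum_gamma_distributed:
  fixes Z :: "nat \<Rightarrow> 'a \<Rightarrow> real"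
  assumes "indep_vars (\<lambda>_. borel) Z {1..d}" and d: "d \<ge> 1" and a: "a > 0"
    and "\<And>i. i \<in> {1..d} \<Longrightarrow> distributed M lborel (Z i) (\<lambda>u. ennreal (gamma_density a u))"
  shows "distributed M lborel (\<lambda>\<omega>. \<Sum>i=1..d. Z i \<omega>) (\<lambda>u. ennreal (gamma_density (real d * a) u))"
  using d assms(1,4)
proof (induction d rule: dec_induct)
  case base
  then show ?case by simp
next
  case (step d)
  have "indep_vars (\<lambda>_. borel) Z {1..d}" by (rule indep_vars_subset[OF step.prems(1)]) auto
  then have IH: "distributed M lborel (\<lambda>\<omega>. \<Sum>i=1..d. Z i \<omega>) (\<lambda>u. ennreal (gamma_density (real d * a) u))"
    using step by auto
  have "{1..Suc d} = insert (Suc d) {1..d}" by auto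
  then have "indep_vars (\<lambda>_. borel) Z (insert (Suc d) {1..d})" using step.prems(1) by simp
  then have ind: "indep_var borel (Z (Suc d)) borel (\<lambda>\<omega>. \<Sum>i=1..d. Z i \<omega>)"
    by (intro indep_vars_sum) auto
  have "distributed M lborel (\<lambda>\<omega>. Z (Suc d) \<omega> + (\<Sum>i=1..d. Z i \<omega>))
     (\<lambda>x. \<integral>\<^sup>+y. ennreal (gamma_density a (x - y)) * ennreal (gamma_density (real d * a) y) \<partial>lborel)"
    by (rule distributed_convolution[OF ind _ IH]) (use step.prems(2) in auto)
  moreover have "real d * a > 0" "real d * a + a = real (Suc d) * a" using step a by (auto simp: algebra_simps)
  ultimately show ?case by (simp add: gamma_density_convolution a add.commute del: of_nat_Suc)
qed

text \<open>The squared norm divided by 2 t is a sum of d independent Gamma variables of order 1/2.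
  The law is kept in this variable rather than in the radius, since the mixture then has the weight
  exp (- g) times a power of g that Kummer's transformation expects.\<close>

lemma (in prob_space) bessel_law:
  assumes t: "t > 0" and d: "d \<ge> 1"
    and B: "\<forall>i\<in>{1..d}. standard_brownian_motion M (B i)"
    and ind: "indep_sets (\<lambda>i. process_events M {0..} (B i) borel) {1..d}"
  shows "bessel_process d B t \<in> borel_measurable M"
    and "F \<in> borel_measurable borel \<Longrightarrow>
      (\<integral>\<^sup>+\<omega>. F (bessel_process d B t \<omega>) \<partial>M) = (\<integral>\<^sup>+g. ennreal (gamma_density (real d / 2) g) * F (sqrt (2 * t * g)) \<partial>lborel)"
proof -
  have Bm: "B i t \<in> borel_measurable M" if "i \<in> {1..d}" for i
    using B that t unfolding standard_brownian_motion_def by auto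
  have Bn: "distributed M lborel (B i t) (\<lambda>x. ennreal (normal_density 0 (sqrt t) x))" if i: "i \<in> {1..d}" for i
  proof -
    have "\<forall>s u. 0 \<le> s \<and> s < u \<longrightarrow>
        distributed M lborel (\<lambda>\<omega>. B i u \<omega> - B i s \<omega>) (\<lambda>x. ennreal (normal_density 0 (sqrt (u - s)) x))"
      and z: "AE \<omega> in M. B i 0 \<omega> = 0"
      using B i unfolding standard_brownian_motion_def by blast+
    \<comment> \<open>Only increments have a prescribed law; the one from time 0 is
      \<open>B i t\<close> itself up to a null set, since \<open>B i 0\<close> vanishes almost
      surely.\<close>
    then have D: "distributed M lborel (\<lambda>\<omega>. B i t \<omega> - B i 0 \<omega>) (\<lambda>x. ennreal (normal_density 0 (sqrt (t - 0)) x))"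
      using t by blast
    have [measurable]: "B i t \<in> borel_measurable M" "(\<lambda>\<omega>. B i t \<omega> - B i 0 \<omega>) \<in> borel_measurable M"
      using Bm[OF i] distributed_measurable[OF D] by auto
    show ?thesis
    proof (rule distributedI_nn_integral)
      fix g :: "real \<Rightarrow> ennreal" assume [measurable]: "g \<in> borel_measurable borel"
      have "(\<integral>\<^sup>+\<omega>. g (B i t \<omega>) \<partial>M) = (\<integral>\<^sup>+\<omega>. g (B i t \<omega> - B i 0 \<omega>) \<partial>M)"
        by (rule nn_integral_cong_AE) (use z in eventually_elim, simp)
      then show "(\<integral>\<^sup>+\<omega>. g (B i t \<omega>) \<partial>M) = (\<integral>\<^sup>+x. ennreal (normal_density 0 (sqrt t) x) * g x \<partial>lborel)"
        using distributed_nn_integral[OF D, of g] by simp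
    qed auto
  qed
  define Z where "Z i \<omega> = (B i t \<omega>)\<^sup>2 / (2 * t)" for i \<omega>
  have "indep_vars (\<lambda>_. borel) (\<lambda>i. B i t) {1..d}"
    unfolding indep_vars_def2
  proof (intro conjI ballI Bm)
    show "indep_sets (\<lambda>i. {B i t -` A \<inter> space M |A. A \<in> sets borel}) {1..d}"
    proof (rule indep_sets_mono_sets[OF ind])
      fix i assume "i \<in> {1..d}"
      let ?V = "vimage_algebra (space M) (\<lambda>\<omega>. \<lambda>s\<in>{0..}. B i s \<omega>) (Pi\<^sub>M {0..} (\<lambda>_. borel :: real measure))"
      have "(\<lambda>\<omega>. (\<lambda>f. f t) ((\<lambda>\<omega>. \<lambda>s\<in>{0..}. B i s \<omega>) \<omega>)) \<in> measurable ?V borel"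
        by (rule measurable_compose[OF measurable_vimage_algebra1 measurable_component_singleton])
          (use t in \<open>auto simp: space_PiM split: if_splits\<close>)
      then have "B i t \<in> measurable ?V borel" using t by simp
      then have "B i t -` A \<inter> space ?V \<in> sets ?V" if "A \<in> sets borel" for A
        using that by (rule measurable_sets)
      then show "{B i t -` A \<inter> space M |A. A \<in> sets borel} \<subseteq> process_events M {0..} (B i) borel"
        unfolding process_events_def by auto
    qed
  qed
  then have iZ: "indep_vars (\<lambda>_. borel) Z {1..d}"
    unfolding Z_def[abs_def] by (rule indep_vars_compose2) measurable
  have "distributed M lborel (Z i) (\<lambda>u. ennreal (gamma_density (1/2) u))" if "i \<in> {1..d}" for i
    using normal_square_distributed[OF _ Bn[OF that]] t unfolding Z_def[abs_def] by simp
  then have G: "distributed M lborel (\<lambda>\<omega>. \<Sum>i=1..d. Z i \<omega>) (\<lambda>u. ennreal (gamma_density (real d * (1/2)) u))"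
    by (intro sum_gamma_distributed[OF iZ d]) auto
  have eq: "bessel_process d B t \<omega> = sqrt (2 * t * (\<Sum>i=1..d. Z i \<omega>))" for \<omega>
    using t by (simp add: bessel_process_def Z_def sum_divide_distrib[symmetric])
  have [measurable]: "(\<lambda>\<omega>. \<Sum>i=1..d. Z i \<omega>) \<in> borel_measurable M"
    using distributed_measurable[OF G] by simp
  show "bessel_process d B t \<in> borel_measurable M" unfolding eq[abs_def] by measurable
  assume [measurable]: "F \<in> borel_measurable borel"
  show "(\<integral>\<^sup>+\<omega>. F (bessel_process d B t \<omega>) \<partial>M) = (\<integral>\<^sup>+g. ennreal (gamma_density (real d / 2) g) * F (sqrt (2 * t * g)) \<partial>lborel)"
    unfolding eq using distributed_nn_integral[OF G, of "\<lambda>g. F (sqrt (2 * t * g))"] by simp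
qed

text \<open>Kummer's transformation of the confluent hypergeometric function of the second kind: insert
  \<open>\<Gamma>(b) g\<^sup>-\<^sup>b = \<integral> q\<^sup>b\<^sup>-\<^sup>1 e\<^sup>-\<^sup>g\<^sup>q dq\<close>, exchange the integrals and substitute \<open>q = (1 - w) / w\<close>.\<close>

lemma nn_integral_Kummer:
  assumes \<alpha>: "\<alpha> > 0" and b: "b > 0" and y: "y \<ge> 0"
  shows "(\<integral>\<^sup>+g. ennreal (power_kernel \<alpha> (g - y) * exp (- g) * g powr (- b)) \<partial>lborel) =
    (\<integral>\<^sup>+w. ennreal ((1 - w) powr (b - 1) * w powr (\<alpha> - b - 1) * exp (- y / w) / Gamma b) * indicator {0<..<1} w \<partial>lborel)"
proof -
  have Gb: "Gamma b > 0" "Gamma \<alpha> > 0" using b \<alpha> by (auto intro: Gamma_real_pos)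
  note nn = power_kernel_nonneg[OF \<alpha>]
  define f where "f q = ennreal (q powr (b - 1) / Gamma b * (exp (- y * (1 + q)) * (1 + q) powr (- \<alpha>)))" for q
  have [measurable]: "f \<in> borel_measurable borel" unfolding f_def by measurable
  have "(\<integral>\<^sup>+g. ennreal (power_kernel \<alpha> (g - y) * exp (- g) * g powr (- b)) \<partial>lborel) =
    (\<integral>\<^sup>+g. (\<integral>\<^sup>+q. ennreal (power_kernel \<alpha> (g - y) * exp (- g) / Gamma b) * (ennreal (q powr (b - 1) * exp (- g * q)) * indicator {0<..} q) \<partial>lborel) \<partial>lborel)"
  proof (rule nn_integral_cong)
    fix g
    show "ennreal (power_kernel \<alpha> (g - y) * exp (- g) * g powr (- b)) =
      (\<integral>\<^sup>+q. ennreal (power_kernel \<alpha> (g - y) * exp (- g) / Gamma b) * (ennreal (q powr (b - 1) * exp (- g * q)) * indicator {0<..} q) \<partial>lborel)"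
    proof (cases "g > y")
      case True
      \<comment> \<open>The kernel confines g to g > y \<ge> 0, where the Laplace representation of
        g^(-b) is valid.\<close>
      then have "g > 0" using y by simp
      have "(\<integral>\<^sup>+q. ennreal (power_kernel \<alpha> (g - y) * exp (- g) / Gamma b) * (ennreal (q powr (b - 1) * exp (- g * q)) * indicator {0<..} q) \<partial>lborel)
        = ennreal (power_kernel \<alpha> (g - y) * exp (- g) / Gamma b) * ennreal (Gamma b * g powr (- b))"
        unfolding nn_integral_Gamma_scaled[OF b \<open>g > 0\<close>, symmetric] by (rule nn_integral_cmult) measurable
      also have "\<dots> = ennreal (power_kernel \<alpha> (g - y) * exp (- g) * g powr (- b))"
        using Gb nn[of "g - y"] by (simp add: ennreal_mult[symmetric])
      finally show ?thesis by simp
    qed (simp add: power_kernel_def)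
  qed
  also have "\<dots> = (\<integral>\<^sup>+q. (\<integral>\<^sup>+g. ennreal (power_kernel \<alpha> (g - y) * exp (- g) / Gamma b) * (ennreal (q powr (b - 1) * exp (- g * q)) * indicator {0<..} q) \<partial>lborel) \<partial>lborel)"
    by (rule lborel_pair.Fubini') measurable
  also have "\<dots> = (\<integral>\<^sup>+q. f q * indicator {0<..} q \<partial>lborel)"
  proof (rule nn_integral_cong)
    fix q :: real
    show "(\<integral>\<^sup>+g. ennreal (power_kernel \<alpha> (g - y) * exp (- g) / Gamma b) * (ennreal (q powr (b - 1) * exp (- g * q)) * indicator {0<..} q) \<partial>lborel) = f q * indicator {0<..} q"
    proof (cases "q > 0")
      case True
      \<comment> \<open>After the shift g = y + z the inner integral is a Gamma integral with rate 1
        + q; C collects what is free of z.\<close>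
      define C where "C = q powr (b - 1) / Gamma b * exp (- y * (1 + q)) / Gamma \<alpha>"
      have C: "C \<ge> 0" using Gb by (simp add: C_def)
      have "(\<integral>\<^sup>+g. ennreal (power_kernel \<alpha> (g - y) * exp (- g) / Gamma b) * (ennreal (q powr (b - 1) * exp (- g * q)) * indicator {0<..} q) \<partial>lborel)
        = ennreal \<bar>1\<bar> * (\<integral>\<^sup>+z. ennreal (power_kernel \<alpha> ((y + 1 * z) - y) * exp (- (y + 1 * z)) / Gamma b) * (ennreal (q powr (b - 1) * exp (- (y + 1 * z) * q)) * indicator {0<..} q) \<partial>lborel)"
        by (rule nn_integral_real_affine) auto
      also have "\<dots> = (\<integral>\<^sup>+z. ennreal C * (ennreal (z powr (\<alpha> - 1) * exp (- (1 + q) * z)) * indicator {0<..} z) \<partial>lborel)"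
      proof -
        have "power_kernel \<alpha> z * exp (- (y + z)) / Gamma b * (q powr (b - 1) * exp (- (y + z) * q)) = C * (z powr (\<alpha> - 1) * exp (- (1 + q) * z)) * indicator {0<..} z" for z
        proof -
          have "exp (- (y + z)) * exp (- (y + z) * q) = exp (- y * (1 + q)) * exp (- (1 + q) * z)"
            by (simp add: exp_add[symmetric] algebra_simps)
          note e = this
          have "power_kernel \<alpha> z * exp (- (y + z)) / Gamma b * (q powr (b - 1) * exp (- (y + z) * q)) =
             power_kernel \<alpha> z / Gamma b * q powr (b - 1) * (exp (- (y + z)) * exp (- (y + z) * q))" by simp
          also have "\<dots> = C * (z powr (\<alpha> - 1) * exp (- (1 + q) * z)) * indicator {0<..} z"
            unfolding e by (auto simp: C_def power_kernel_def mult_ac split: split_indicator)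
          finally show ?thesis .
        qed
        then have "ennreal (power_kernel \<alpha> z * exp (- (y + z)) / Gamma b) * ennreal (q powr (b - 1) * exp (- (y + z) * q)) =
            ennreal (C * (z powr (\<alpha> - 1) * exp (- (1 + q) * z)) * indicator {0<..} z)" for z
          using nn Gb by (subst ennreal_mult[symmetric]) auto
        then show ?thesis using True C by (auto simp: ennreal_mult intro!: nn_integral_cong split: split_indicator)
      qed
      also have "\<dots> = ennreal C * ennreal (Gamma \<alpha> * (1 + q) powr (- \<alpha>))"
        using nn_integral_Gamma_scaled[OF \<alpha>, of "1 + q"] True by (subst nn_integral_cmult) auto
      also have "\<dots> = f q" using C Gb by (simp add: ennreal_mult[symmetric] f_def C_def)
      finally show ?thesis using True by simp
    qed simp
  qed
  also have "\<dots> = (\<integral>\<^sup>+w. f ((1 - w) / w) * ennreal (1 / w\<^sup>2) * indicator {0<..<1} w \<partial>lborel)"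
    by (rule nn_integral_substitution_odds) measurable
  also have "\<dots> = (\<integral>\<^sup>+w. ennreal ((1 - w) powr (b - 1) * w powr (\<alpha> - b - 1) * exp (- y / w) / Gamma b) * indicator {0<..<1} w \<partial>lborel)"
  proof (rule nn_integral_cong)
    fix w :: real
    show "f ((1 - w) / w) * ennreal (1 / w\<^sup>2) * indicator {0<..<1} w =
       ennreal ((1 - w) powr (b - 1) * w powr (\<alpha> - b - 1) * exp (- y / w) / Gamma b) * indicator {0<..<1} w"
    proof (cases "w \<in> {0<..<1}")
      case True
      then have w: "0 < w" "w < 1" by auto
      \<comment> \<open>This makes the odds the right variable: 1 + q, which carries both the
        exponential and the power -\<alpha>, becomes 1 / w.\<close>
      have e: "1 + (1 - w) / w = 1 / w" using w by (simp add: field_simps)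
      have p: "((1 - w) / w) powr (b - 1) * (1 / w) powr (- \<alpha>) * (1 / w\<^sup>2) = (1 - w) powr (b - 1) * w powr (\<alpha> - b - 1)"
      proof -
        have "w powr (\<alpha> - b - 1) = w powr (- (b - 1)) * w powr \<alpha> * w powr (- 2)"
          by (simp add: powr_add[symmetric])
        moreover have "w powr (- 2) = 1 / w\<^sup>2" using w by (simp add: powr_minus_divide powr_numeral)
        moreover have "((1 - w) / w) powr (b - 1) = (1 - w) powr (b - 1) * w powr (- (b - 1))"
          unfolding powr_minus_divide using w by (simp add: powr_divide)
        moreover have "(1 / w) powr (- \<alpha>) = w powr \<alpha>" using w by (simp add: powr_divide powr_minus_divide)
        ultimately show ?thesis by simp
      qed
      have "((1 - w) / w) powr (b - 1) / Gamma b * (exp (- y * (1 / w)) * (1 / w) powr (- \<alpha>)) * (1 / w\<^sup>2) =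
         (((1 - w) / w) powr (b - 1) * (1 / w) powr (- \<alpha>) * (1 / w\<^sup>2)) * exp (- y / w) / Gamma b" by (simp add: mult_ac)
      also have "\<dots> = (1 - w) powr (b - 1) * w powr (\<alpha> - b - 1) * exp (- y / w) / Gamma b" unfolding p ..
      finally show ?thesis using True Gb unfolding f_def e
        by (simp add: ennreal_mult[symmetric] del: times_divide_eq_right times_divide_eq_left)
    qed simp
  qed
  finally show ?thesis .
qed

section \<open>Mixing the fixed-time densities over the Bessel time\<close>

lemma power_kernel_scale: "r > 0 \<Longrightarrow> power_kernel a (r * z) = r powr (a - 1) * power_kernel a z"
  by (auto simp: power_kernel_def powr_mult zero_less_mult_iff)

text \<open>With a^2 = r g one has a^2 - x^2 = r (g - y), and the powers of g from the Gamma density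
  and from a^(-2v) combine to g^(-b); Kummer's transformation then applies with order v + 1/2. The
  right side is a real integral, so integrability has to be shown: for \<delta> = 1/2 the integrand
  at x = 0 behaves like 1 / w near 0, hence x \<noteq> 0.\<close>

lemma nn_integral_ultraspherical_gamma_mixture:
  assumes c: "c > 0" and t: "t > 0" and \<delta>: "\<delta> > 0" and v: "v > - 1/2" and b: "v > \<delta> - 1" and x: "x \<noteq> 0"
  shows "(\<integral>\<^sup>+g. ennreal (gamma_density \<delta> g) * (ennreal (ultraspherical_density v (c * sqrt (2 * t * g)) x) * indicator {0<..} (sqrt (2 * t * g))) \<partial>lborel)
    = ennreal (1 / Beta \<delta> (v - \<delta> + 1) * (LBINT w:{0<..<1}. w powr (\<delta> - 1) * (1 - w) powr (v - \<delta>) *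
                (exp (- x\<^sup>2 / (2 * c\<^sup>2 * t * w)) / (sqrt (2 * pi * t * w) * c))))"
proof -
  define y where "y = x\<^sup>2 / (2 * c\<^sup>2 * t)"
  define b where "b = v - \<delta> + 1"
  define r where "r = 2 * t * c\<^sup>2"
  \<comment> \<open>The factor 1 / (c sqrt (2 t)) is r^(-1/2), what is left of the powers of
    r.\<close>
  define K where "K = Gamma (v + 1) / (sqrt pi * Gamma \<delta> * (c * sqrt (2 * t)))"
  define F where "F w = w powr (\<delta> - 1) * (1 - w) powr (v - \<delta>) * (exp (- x\<^sup>2 / (2 * c\<^sup>2 * t * w)) / (sqrt (2 * pi * t * w) * c))" for w
  have [measurable]: "F \<in> borel_measurable borel" unfolding F_def by measurable
  have G: "Gamma (v + 1) > 0" "Gamma \<delta> > 0" "Gamma b > 0" using v b \<delta> by (auto simp: b_def intro!: Gamma_real_pos)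
  have K: "K > 0" using G c t by (simp add: K_def)
  have r: "r > 0" using c t by (simp add: r_def)
  have y: "y > 0" using x c t by (simp add: y_def)
  have b0: "b > 0" using assms(5) by (simp add: b_def)
  have \<alpha>: "v + 1/2 > 0" using v by simp
  have F0: "0 \<le> F w" if "0 < w" for w using that c t by (simp add: F_def)
  have Beta: "Beta \<delta> b = Gamma \<delta> * Gamma b / Gamma (v + 1)" by (simp add: Beta_def b_def)
  have B0: "Beta \<delta> b > 0" unfolding Beta using G by simp
  have "(\<integral>\<^sup>+g. ennreal (gamma_density \<delta> g) * (ennreal (ultraspherical_density v (c * sqrt (2 * t * g)) x) * indicator {0<..} (sqrt (2 * t * g))) \<partial>lborel)
     = (\<integral>\<^sup>+g. ennreal K * ennreal (power_kernel (v + 1/2) (g - y) * exp (- g) * g powr (- b)) \<partial>lborel)"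
  proof (rule nn_integral_cong)
    fix g
    show "ennreal (gamma_density \<delta> g) * (ennreal (ultraspherical_density v (c * sqrt (2 * t * g)) x) * indicator {0<..} (sqrt (2 * t * g)))
      = ennreal K * ennreal (power_kernel (v + 1/2) (g - y) * exp (- g) * g powr (- b))"
    proof (cases "g > 0")
      case True
      define a where "a = c * sqrt (2 * t * g)"
      have a: "a > 0" "a\<^sup>2 = r * g" using c t True by (auto simp: a_def r_def power_mult_distrib)
      have "a powr (2 * v) = (a\<^sup>2) powr v" using a(1) by (subst powr_powr[symmetric]) (simp add: powr_numeral)
      then have av: "a powr (2 * v) = r powr v * g powr v" using a r True by (simp add: powr_mult)
      have "a\<^sup>2 - x\<^sup>2 = r * (g - y)" using a c t by (simp add: r_def y_def field_simps)
      then have k: "power_kernel (v + 1/2) (a\<^sup>2 - x\<^sup>2) = r powr (v - 1/2) * power_kernel (v + 1/2) (g - y)"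
        using power_kernel_scale[OF r, of "v + 1/2"] by simp
      have rr: "r powr (v - 1/2) / r powr v = 1 / (c * sqrt (2 * t))"
      proof -
        have "r powr (v - 1/2) / r powr v = r powr (- (1/2))" by (simp add: powr_diff[symmetric])
        also have "\<dots> = 1 / sqrt r" using r by (simp add: powr_minus_divide powr_half_sqrt)
        also have "sqrt r = c * sqrt (2 * t)" using c by (simp add: r_def real_sqrt_mult)
        finally show ?thesis .
      qed
      have gg: "g powr (\<delta> - 1) / g powr v = g powr (- b)"
      proof -
        have "\<delta> - 1 - v = - b" by (simp add: b_def)
        then show ?thesis by (simp add: powr_diff[symmetric])
      qed
      have "gamma_density \<delta> g * ultraspherical_density v a x =
         Gamma (v + 1) / (sqrt pi * Gamma \<delta>) * (r powr (v - 1/2) / r powr v) * (g powr (\<delta> - 1) / g powr v) * (power_kernel (v + 1/2) (g - y) * exp (- g))"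
      proof -
        have "power_kernel \<delta> g = g powr (\<delta> - 1) / Gamma \<delta>" using True by (simp add: power_kernel_def)
        then show ?thesis unfolding ultraspherical_density_def k av gamma_density_def by (simp add: mult_ac)
      qed
      also have "\<dots> = K * (power_kernel (v + 1/2) (g - y) * exp (- g) * g powr (- b))"
        unfolding rr gg K_def by simp
      finally have "gamma_density \<delta> g * ultraspherical_density v a x = K * (power_kernel (v + 1/2) (g - y) * exp (- g) * g powr (- b))" .
      moreover have "sqrt (2 * t * g) > 0" using True t by simp
      ultimately show ?thesis unfolding a_def[symmetric]
        using \<delta> v K \<alpha> by (simp add: ennreal_mult[symmetric] gamma_density_nonneg ultraspherical_density_nonneg power_kernel_nonneg)
    next
      case False
      then show ?thesis using y by (simp add: gamma_density_def power_kernel_def)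
    qed
  qed
  also have "\<dots> = ennreal K * (\<integral>\<^sup>+g. ennreal (power_kernel (v + 1/2) (g - y) * exp (- g) * g powr (- b)) \<partial>lborel)"
    by (rule nn_integral_cmult) measurable
  also have "\<dots> = ennreal K * (\<integral>\<^sup>+w. ennreal ((1 - w) powr (b - 1) * w powr (v + 1/2 - b - 1) * exp (- y / w) / Gamma b) * indicator {0<..<1} w \<partial>lborel)"
    using nn_integral_Kummer[OF \<alpha> b0, of y] y by simp
  also have "\<dots> = (\<integral>\<^sup>+w. ennreal K * (ennreal ((1 - w) powr (b - 1) * w powr (v + 1/2 - b - 1) * exp (- y / w) / Gamma b) * indicator {0<..<1} w) \<partial>lborel)"
    by (rule nn_integral_cmult[symmetric]) measurable
  also have "\<dots> = (\<integral>\<^sup>+w. ennreal (1 / Beta \<delta> b) * (ennreal (F w) * indicator {0<..<1} w) \<partial>lborel)"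
  proof (rule nn_integral_cong)
    fix w :: real
    show "ennreal K * (ennreal ((1 - w) powr (b - 1) * w powr (v + 1/2 - b - 1) * exp (- y / w) / Gamma b) * indicator {0<..<1} w) =
       ennreal (1 / Beta \<delta> b) * (ennreal (F w) * indicator {0<..<1} w)"
    proof (cases "w \<in> {0<..<1}")
      case True
      then have w: "0 < w" by simp
      have "w powr (v + 1/2 - b - 1) = w powr (\<delta> - 1) * w powr (- (1/2))"
        by (simp add: powr_add[symmetric] b_def)
      also have "w powr (- (1/2)) = 1 / sqrt w" using w by (simp add: powr_minus_divide powr_half_sqrt)
      finally have p: "w powr (v + 1/2 - b - 1) = w powr (\<delta> - 1) * (1 / sqrt w)" .
      have q: "sqrt (2 * pi * t * w) * c = sqrt pi * (c * sqrt (2 * t)) * sqrt w"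
        by (simp add: real_sqrt_mult)
      have e: "- y / w = - x\<^sup>2 / (2 * c\<^sup>2 * t * w)" by (simp add: y_def)
      have b1: "b - 1 = v - \<delta>" by (simp add: b_def)
      \<comment> \<open>K / Gamma b is 1 / B(\<delta>, b) times 1 / (sqrt pi c sqrt (2 t)), and
        w^(-1/2) completes the Gaussian normalisation.\<close>
      have "K * ((1 - w) powr (b - 1) * w powr (v + 1/2 - b - 1) * exp (- y / w) / Gamma b) = 1 / Beta \<delta> b * F w"
        unfolding p F_def q e b1 K_def Beta using G by (simp add: mult_ac)
      then show ?thesis using True K B0 F0[OF w] G
        by (simp add: ennreal_mult[symmetric] del: times_divide_eq_right times_divide_eq_left)
    qed simp
  qed
  also have "\<dots> = ennreal (1 / Beta \<delta> b) * (\<integral>\<^sup>+w. ennreal (F w) * indicator {0<..<1} w \<partial>lborel)"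
    by (rule nn_integral_cmult) measurable
  also have "(\<integral>\<^sup>+w. ennreal (F w) * indicator {0<..<1} w \<partial>lborel) = (\<integral>\<^sup>+w. ennreal (indicator {0<..<1} w *\<^sub>R F w) \<partial>lborel)"
    by (intro nn_integral_cong) (auto split: split_indicator)
  also have "\<dots> = ennreal (LINT w|lborel. indicator {0<..<1} w *\<^sub>R F w)"
  proof (rule nn_integral_eq_integral)
    show "AE w in lborel. 0 \<le> indicator {0<..<1} w *\<^sub>R F w"
      using F0 by (auto split: split_indicator)
    show "integrable lborel (\<lambda>w. indicator {0<..<1} w *\<^sub>R F w)"
    proof (rule integrableI_bounded)
      \<comment> \<open>From exp z \<ge> z follows exp (- y / w) \<le> w / y \<le> sqrt w / y; this
        cancels the sqrt w in the denominator and leaves a Beta integrand with constant C.\<close>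
      define C where "C = 1 / (y * (sqrt pi * (c * sqrt (2 * t))))"
      have C: "C \<ge> 0" using y c t by (simp add: C_def)
      have "(\<integral>\<^sup>+w. ennreal (norm (indicator {0<..<1} w *\<^sub>R F w)) \<partial>lborel) \<le>
         (\<integral>\<^sup>+w. ennreal C * (ennreal (w powr (\<delta> - 1) * (1 - w) powr (b - 1)) * indicator {0<..<1} w) \<partial>lborel)"
      proof (rule nn_integral_mono)
        fix w :: real
        show "ennreal (norm (indicator {0<..<1} w *\<^sub>R F w)) \<le> ennreal C * (ennreal (w powr (\<delta> - 1) * (1 - w) powr (b - 1)) * indicator {0<..<1} w)"
        proof (cases "w \<in> {0<..<1}")
          case True
          then have w: "0 < w" "w < 1" by auto
          have q: "sqrt (2 * pi * t * w) * c = sqrt pi * (c * sqrt (2 * t)) * sqrt w"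
            by (simp add: real_sqrt_mult)
          have "y / w \<le> exp (y / w)" using exp_ge_add_one_self[of "y / w"] by linarith
          then have "exp (- (y / w)) \<le> w / y"
            using y w by (simp add: exp_minus field_simps)
          also have "\<dots> \<le> sqrt w / y"
          proof -
            have "w = sqrt w * sqrt w" using w by simp
            also have "\<dots> \<le> sqrt w * 1" using w by (intro mult_left_mono) auto
            finally show ?thesis using y by (simp add: divide_right_mono)
          qed
          finally have "exp (- (y / w)) / (sqrt pi * (c * sqrt (2 * t)) * sqrt w) \<le> (sqrt w / y) / (sqrt pi * (c * sqrt (2 * t)) * sqrt w)"
            using c t w by (intro divide_right_mono) auto
          also have "\<dots> = C" using w by (simp add: C_def)
          finally have "w powr (\<delta> - 1) * (1 - w) powr (v - \<delta>) * (exp (- (y / w)) / (sqrt pi * (c * sqrt (2 * t)) * sqrt w)) \<le> w powr (\<delta> - 1) * (1 - w) powr (v - \<delta>) * C"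
            by (intro mult_left_mono) auto
          then have "F w \<le> C * (w powr (\<delta> - 1) * (1 - w) powr (b - 1))"
            unfolding F_def q by (simp add: y_def b_def mult_ac)
          then show ?thesis using True F0[OF w(1)] C
            by (simp add: ennreal_mult[symmetric] ennreal_leI)
        qed simp
      qed
      also have "\<dots> = ennreal C * ennreal (Beta \<delta> b)"
        by (subst nn_integral_cmult) (auto simp: nn_integral_Beta[OF \<delta> b0])
      also have "\<dots> < \<infinity>" by (simp add: ennreal_mult_less_top)
      finally show "(\<integral>\<^sup>+w. ennreal (norm (indicator {0<..<1} w *\<^sub>R F w)) \<partial>lborel) < \<infinity>" .
    qed measurable
  qed
  also have "ennreal (1 / Beta \<delta> b) * \<dots> = ennreal (1 / Beta \<delta> b * (LINT w|lborel. indicator {0<..<1} w *\<^sub>R F w))"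
    using B0 F0 by (intro ennreal_mult[symmetric] integral_nonneg_AE) (auto split: split_indicator)
  finally show ?thesis unfolding set_lebesgue_integral_def F_def b_def .
qed

theorem theorem4p1:
  fixes M :: "'a measure"
    and S \<theta> :: "nat \<Rightarrow> 'a \<Rightarrow> real"
    and B :: "nat \<Rightarrow> real \<Rightarrow> 'a \<Rightarrow> real"
    and p :: "real \<Rightarrow> real \<Rightarrow> real"
    and c l t :: real
    and m n d :: nat
  assumes "prob_space M"
    and "c > 0" and "l > 0" and "t > 0"
    and "d \<ge> 1" and "m \<in> {0, 1}" and "n \<ge> 1"
    and "v_index m n > real d / 2 - 1"
    and "poisson_event_times M l S"
    and "iid_angles M m \<theta>"
    and "prob_space.indep_set M (process_events M {1..} \<theta> borel) (process_events M UNIV S borel)"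
    and "\<forall>i\<in>{1..d}. standard_brownian_motion M (B i)"
    and "prob_space.indep_sets M (\<lambda>i. process_events M {0..} (B i) borel) {1..d}"
    and "prob_space.indep_set M
           (process_events M {0..} (bessel_process d B) borel)
           (process_events M {0..} (\<lambda>s \<omega>. (flight c S \<theta> s \<omega>, event_count S s \<omega>))
              (borel \<Otimes>\<^sub>M count_space UNIV))"
    and "conditional_density M (flight c S \<theta>) (event_count S) n p"
  shows "AE x in lborel.
           stopped_density M p (bessel_process d B t) x =
           ennreal (1 / Beta (real d / 2) (v_index m n - real d / 2 + 1) *
             (LBINT w:{0<..<1}.
                w powr (real d / 2 - 1) * (1 - w) powr (v_index m n - real d / 2) *
                (exp (- x\<^sup>2 / (2 * c\<^sup>2 * t * w)) / (sqrt (2 * pi * t * w) * c))))"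
proof -
  interpret prob_space M by fact
  interpret random_flight M l m S \<theta> by standard fact+
  let ?T = "bessel_process d B t" and ?v = "v_index m n"
  let ?q = "\<lambda>s x. ultraspherical_density ?v (c * s) x"
  note bessel = bessel_law[OF assms(4,5,12,13)]
  note [measurable] = bessel(1)
  let ?D = "distr M borel ?T"
  interpret D: prob_space ?D by (rule prob_space_distr) measurable
  interpret LD: pair_sigma_finite lborel ?D ..
  have v: "?v > - 1/2" using assms(7) by (auto simp: v_index_def)
  have p [measurable]: "(\<lambda>z. p (fst z) (snd z)) \<in> borel_measurable (borel \<Otimes>\<^sub>M borel)"
    using assms(15) by (simp add: conditional_density_def split_beta')
  have q [measurable]: "(\<lambda>z. ?q (snd z) (fst z)) \<in> borel_measurable (borel \<Otimes>\<^sub>M borel)"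
    unfolding ultraspherical_density_def by measurable
  \<comment> \<open>Exchanging the almost-everywhere quantifiers over s and x is Fubini for null
    sets and requires this set to be measurable, hence joint measurability of p.\<close>
  have "{z \<in> space (lborel \<Otimes>\<^sub>M ?D). 0 < snd z \<longrightarrow> p (fst z) (snd z) = ?q (snd z) (fst z)} \<in> sets (lborel \<Otimes>\<^sub>M ?D)"
  proof -
    have "{z \<in> space (borel \<Otimes>\<^sub>M borel). 0 < snd z \<longrightarrow> p (fst z) (snd z) = ?q (snd z) (fst z)} \<in> sets (borel \<Otimes>\<^sub>M borel)"
      by measurable
    moreover have "sets (lborel \<Otimes>\<^sub>M ?D) = sets (borel \<Otimes>\<^sub>M borel)" by (rule sets_pair_measure_cong) simp_all
    ultimately show ?thesis by (simp add: space_pair_measure)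
  qed
  moreover have "AE s in ?D. AE x in lborel. 0 < s \<longrightarrow> p x s = ?q s x"
  proof (rule AE_I2)
    fix s
    show "AE x in lborel. 0 < s \<longrightarrow> p x s = ?q s x"
      by (cases "0 < s") (use conditional_density_unique[OF assms(6,7,2) _ assms(15), of s] in auto)
  qed
  \<comment> \<open>For almost every x the agreement now holds at almost every time, which is what
    the mixture at a fixed x sees.\<close>
  ultimately have "AE x in lborel. AE s in ?D. 0 < s \<longrightarrow> p x s = ?q s x"
    by (subst LD.AE_commute)
  then show ?thesis
    using AE_lborel_singleton[of 0]
  proof eventually_elim
    case (elim x)
    have "stopped_density M p ?T x = (\<integral>\<^sup>+s. ennreal (?q s x) * indicator {0<..} s \<partial>?D)"
      unfolding stopped_density_def using elim(1)
      by (intro nn_integral_cong_AE) (auto split: split_indicator elim!: eventually_mono)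
    also have "\<dots> = (\<integral>\<^sup>+\<omega>. ennreal (?q (?T \<omega>) x) * indicator {0<..} (?T \<omega>) \<partial>M)"
      by (rule nn_integral_distr) (auto simp: ultraspherical_density_def)
    also have "\<dots> = (\<integral>\<^sup>+g. ennreal (gamma_density (real d / 2) g) *
        (ennreal (?q (sqrt (2 * t * g)) x) * indicator {0<..} (sqrt (2 * t * g))) \<partial>lborel)"
      by (rule bessel(2)) (auto simp: ultraspherical_density_def)
    also have "\<dots> = ennreal (1 / Beta (real d / 2) (?v - real d / 2 + 1) *
             (LBINT w:{0<..<1}. w powr (real d / 2 - 1) * (1 - w) powr (?v - real d / 2) *
                (exp (- x\<^sup>2 / (2 * c\<^sup>2 * t * w)) / (sqrt (2 * pi * t * w) * c))))"
      by (rule nn_integral_ultraspherical_gamma_mixture) (use assms v elim in auto)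
    finally show ?case .
  qed
qed

end
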